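(* Let $\Gamma\in\mathcal D_\infty$ be a digraph limit, and let $\mathbf W=(W_{00},W_{01},W_{10},W_{11},w)$ be any quintuple representing $\Gamma$. Then the following are equivalent: (i) $\Gamma\in\mathcal P_\infty$; (ii) $t_{\mathrm{ind}}(F,\Gamma)=0$ for every finite digraph $F$ that is not a poset; (iii) $t_{\mathrm{ind}}(\mathsf C_1,\Gamma)=t_{\mathrm{ind}}(\mathsf C_2,\Gamma)=t_{\mathrm{ind}}(\mathsf C_3,\Gamma)=t_{\mathrm{ind}}(\mathsf P_2,\Gamma)=0$; (iv) $w=0$ a.e., $W_{11}=0$ a.e., and $\{(x,y,z)\in[0,1]^3: W_{10}(x,y)>0,\ W_{10}(y,z)>0,\ W_{10}(x,z)<1\}$ is a Lebesgue null set; (v) there exists a quintuple $\mathbf W'=(W'_{00},W'_{01},W'_{10},W'_{11},w')$ representing $\Gamma$ with $w'=0$, $W'_{11}(x,y)=0$ and $W'_{10}(x,x)=0$ for all $x,y$, and such that $W'_{10}(x,y)>0$ and $W'_{10}(y,z)>0$ imply $W'_{10}(x,z)=1$ for all $x,y,z\in[0,1]$.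
   Context: A digraph has vertex set $V$ and edge set $E\subseteq V\times V$ (loops allowed); $\mathcal D$ is the set of isomorphism classes of finite nonempty digraphs. A poset (nonempty set with strict partial order $<$) is identified with the digraph having an edge $i\to j$ iff $i<j$; $\mathcal P\subset\mathcal D$ denotes the finite posets. For finite digraphs $F,G$: $t(F,G)$ is the proportion of all maps $\varphi:V(F)\to V(G)$ with ($i\to j$ in $F\Rightarrow\varphi(i)\to\varphi(j)$ in $G$); $t_{\mathrm{ind}}(F,G)$ is the proportion of injective maps with ($i\to j$ iff $\varphi(i)\to\varphi(j)$), and $0$ if $|F|>|G|$. Identify $\mathcal D$ with its (injective) image under $G\mapsto((t(F,G))_{F\in\mathcal D},|G|^{-1})\in[0,1]^{\mathcal D}\times[0,1]$, let $\overline{\mathcal D}$ be the closure (product topology), $\mathcal D_\infty=\overline{\mathcal D}\setminus\mathcal D$ (digraph limits); $t(F,\cdot),t_{\mathrm{ind}}(F,\cdot)$ extend continuously. $\overline{\mathcal P}$ is the closure of $\mathcal P$ in $\overline{\mathcal D}$ and $\mathcal P_\infty=\overline{\mathcal P}\setminus\mathcal P$ (poset limits). $\mathsf C_1$: one vertex with a loop; $\mathsf C_2$: two vertices with edges in both directions; $\mathsf C_3$: vertices $1,2,3$ with edges $1\to2,2\to3,3\to1$; $\mathsf P_2$: vertices $1,2,3$ with exactly edges $1\to2,2\to3$. A quintuple $\mathbf W=(W_{00},W_{01},W_{10},W_{11},w)$ consists of measurable $W_{\alpha\beta}:[0,1]^2\to[0,1]$ and $w:[0,1]\to\{0,1\}$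 with $\sum_{\alpha,\beta\in\{0,1\}}W_{\alpha\beta}(x,y)=1$ and $W_{\alpha\beta}(x,y)=W_{\beta\alpha}(y,x)$. It defines a random digraph $G(\infty,\mathbf W)$ on $\mathbb N$ with edge indicators $I_{ij}$: take i.i.d. uniform $X_i\in[0,1]$, set $I_{ii}=w(X_i)$, and for $i<j$ choose $(I_{ij},I_{ji})$ with $\mathbb P(I_{ij}=\alpha,I_{ji}=\beta)=W_{\alpha\beta}(X_i,X_j)$, conditionally independently over pairs. $\mathbf W$ represents $\Gamma\in\mathcal D_\infty$ if $G(\infty,\mathbf W)|_{\{1,\dots,n\}}\to\Gamma$ a.s. in $\overline{\mathcal D}$ (equivalently $t(F,\Gamma)=\mathbb P(F\subseteq G(\infty,\mathbf W))$ for all finite digraphs $F$ on subsets of $\mathbb N$); every $\Gamma\in\mathcal D_\infty$ has such a representing quintuple. *)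

theory Defs
  imports "HOL-Probability.Probability"
begin

text \<open>Finite digraphs are represented by pairs (n, E) with vertex set {0..<n}
  and edge relation E \<subseteq> {0..<n} \<times> {0..<n} (loops allowed).\<close>

type_synonym dg = "nat \<times> (nat \<times> nat) set"

definition wf_dg :: "dg \<Rightarrow> bool" where
  "wf_dg G \<longleftrightarrow> fst G \<ge> 1 \<and> snd G \<subseteq> {0..<fst G} \<times> {0..<fst G}"

definition is_poset :: "dg \<Rightarrow> bool" where
  "is_poset G \<longleftrightarrow> wf_dg G \<and> (\<forall>i. (i, i) \<notin> snd G) \<and> trans (snd G)"

definition hom_dens :: "dg \<Rightarrow> dg \<Rightarrow> real" where
  "hom_dens F G =
     real (card {\<phi> \<in> {0..<fst F} \<rightarrow>\<^sub>E {0..<fst G}.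
                 \<forall>(i, j) \<in> snd F. (\<phi> i, \<phi> j) \<in> snd G})
     / real (card ({0..<fst F} \<rightarrow>\<^sub>E {0..<fst G}))"

definition ind_dens :: "dg \<Rightarrow> dg \<Rightarrow> real" where
  "ind_dens F G =
     (if fst F > fst G then 0 else
     real (card {\<phi> \<in> {0..<fst F} \<rightarrow>\<^sub>E {0..<fst G}. inj_on \<phi> {0..<fst F} \<and>
                 (\<forall>i<fst F. \<forall>j<fst F. (i, j) \<in> snd F \<longleftrightarrow> (\<phi> i, \<phi> j) \<in> snd G)})
     / real (card {\<phi> \<in> {0..<fst F} \<rightarrow>\<^sub>E {0..<fst G}. inj_on \<phi> {0..<fst F}}))"

text \<open>The embedding G \<mapsto> ((t(F,G))_F, 1/|G|) into [0,1]^D \<times> [0,1]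
  (coordinates indexed by representatives F; the product topology on functions
  is the one of HOL-Analysis.Function_Topology).\<close>
definition embed :: "dg \<Rightarrow> (dg \<Rightarrow> real) \<times> real" where
  "embed G = ((\<lambda>F. if wf_dg F then hom_dens F G else 0), 1 / real (fst G))"

definition Dset :: "((dg \<Rightarrow> real) \<times> real) set" where
  "Dset = embed ` {G. wf_dg G}"

definition Dinf :: "((dg \<Rightarrow> real) \<times> real) set" where
  "Dinf = closure Dset - Dset"

definition Pset :: "((dg \<Rightarrow> real) \<times> real) set" where
  "Pset = embed ` {G. is_poset G}"

definition Pinf :: "((dg \<Rightarrow> real) \<times> real) set" where
  "Pinf = closure Pset - Pset"

definition ind_dens_lim :: "dg \<Rightarrow> (dg \<Rightarrow> real) \<times> real \<Rightarrow> real" where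
  "ind_dens_lim F \<Gamma> =
     Lim (at \<Gamma> within Dset) (\<lambda>x. ind_dens F (SOME G. wf_dg G \<and> embed G = x))"

definition C1 :: dg where "C1 = (1, {(0, 0)})"
definition C2 :: dg where "C2 = (2, {(0, 1), (1, 0)})"
definition C3 :: dg where "C3 = (3, {(0, 1), (1, 2), (2, 0)})"
definition P2 :: dg where "P2 = (3, {(0, 1), (1, 2)})"

definition unit_sq :: "(real \<times> real) set" where
  "unit_sq = {0..1} \<times> {0..1}"

definition quintuple ::
  "(real \<times> real \<Rightarrow> real) \<Rightarrow> (real \<times> real \<Rightarrow> real) \<Rightarrow> (real \<times> real \<Rightarrow> real)
   \<Rightarrow> (real \<times> real \<Rightarrow> real) \<Rightarrow> (real \<Rightarrow> real) \<Rightarrow> bool" where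
  "quintuple W00 W01 W10 W11 w \<longleftrightarrow>
     W00 \<in> borel_measurable (lebesgue_on unit_sq) \<and>
     W01 \<in> borel_measurable (lebesgue_on unit_sq) \<and>
     W10 \<in> borel_measurable (lebesgue_on unit_sq) \<and>
     W11 \<in> borel_measurable (lebesgue_on unit_sq) \<and>
     w \<in> borel_measurable (lebesgue_on {0..1}) \<and>
     (\<forall>x\<in>{0..1}. w x \<in> {0, 1}) \<and>
     (\<forall>x\<in>{0..1}. \<forall>y\<in>{0..1}.
        W00 (x, y) \<in> {0..1} \<and> W01 (x, y) \<in> {0..1} \<and>
        W10 (x, y) \<in> {0..1} \<and> W11 (x, y) \<in> {0..1} \<and>
        W00 (x, y) + W01 (x, y) + W10 (x, y) + W11 (x, y) = 1 \<and>
        W00 (x, y) = W00 (y, x) \<and> W01 (x, y) = W10 (y, x) \<and>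
        W10 (x, y) = W01 (y, x) \<and> W11 (x, y) = W11 (y, x))"

definition unit_cube :: "nat set \<Rightarrow> (nat \<Rightarrow> real) measure" where
  "unit_cube I = completion (Pi\<^sub>M I (\<lambda>_. restrict_space lborel {0..1::real}))"

text \<open>Conditional probability, given X_i = a, X_j = b (i<j), that the required
  edges among i\<rightarrow>j (e1) and j\<rightarrow>i (e2) are present in G(\<infinity>,W).\<close>
definition pair_prob ::
  "(real \<times> real \<Rightarrow> real) \<Rightarrow> (real \<times> real \<Rightarrow> real) \<Rightarrow> (real \<times> real \<Rightarrow> real)
   \<Rightarrow> real \<Rightarrow> real \<Rightarrow> bool \<Rightarrow> bool \<Rightarrow> real" where
  "pair_prob W01 W10 W11 a b e1 e2 =
     (if e1 \<and> e2 then W11 (a, b)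
      else if e1 then W10 (a, b) + W11 (a, b)
      else if e2 then W01 (a, b) + W11 (a, b)
      else 1)"

text \<open>P(F \<subseteq> G(\<infinity>,W)) for a digraph F on {0..<n}.\<close>
definition sub_prob ::
  "(real \<times> real \<Rightarrow> real) \<Rightarrow> (real \<times> real \<Rightarrow> real) \<Rightarrow> (real \<times> real \<Rightarrow> real)
   \<Rightarrow> (real \<Rightarrow> real) \<Rightarrow> dg \<Rightarrow> real" where
  "sub_prob W01 W10 W11 w F =
     (\<integral>x. (\<Prod>i\<in>{0..<fst F}. if (i, i) \<in> snd F then w (x i) else 1) *
          (\<Prod>p\<in>{(i, j). i < j \<and> j < fst F}.
              pair_prob W01 W10 W11 (x (fst p)) (x (snd p))
                 ((fst p, snd p) \<in> snd F) ((snd p, fst p) \<in> snd F))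
      \<partial>unit_cube {0..<fst F})"

definition represents ::
  "(real \<times> real \<Rightarrow> real) \<Rightarrow> (real \<times> real \<Rightarrow> real) \<Rightarrow> (real \<times> real \<Rightarrow> real)
   \<Rightarrow> (real \<times> real \<Rightarrow> real) \<Rightarrow> (real \<Rightarrow> real) \<Rightarrow> (dg \<Rightarrow> real) \<times> real \<Rightarrow> bool" where
  "represents W00 W01 W10 W11 w \<Gamma> \<longleftrightarrow>
     quintuple W00 W01 W10 W11 w \<and>
     (\<forall>F. wf_dg F \<longrightarrow> fst \<Gamma> F = sub_prob W01 W10 W11 w F)"

end

theory Submission
  imports Defs
begin

text \<open>All five conditions are compared with the condition that \<open>C1\<close> and \<open>C2\<close> have homomorphism
  density 0 in \<open>\<Gamma>\<close> and that the path \<open>P2\<close> and the transitive triangle \<open>T3\<close> have the same one.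
  Finite posets satisfy it exactly, and it is closed, so poset limits satisfy it. Conversely,
  pull a finite digraph \<open>G\<close> close to \<open>\<Gamma>\<close> back along a random map from \<open>{0..<k}\<close> to its vertices: a
  union bound shows that the result is a poset with high probability, and a second moment
  estimate that its densities are close to those of \<open>G\<close>. Since the four densities are integrals of
  the kernels, the condition is also equivalent to (iv). For (v), the kernel \<open>W10\<close> is redefined
  through the Lebesgue density points of \<open>{W10 > 0}\<close> and \<open>{W10 = 1}\<close>: if \<open>(x, y)\<close> and \<open>(y, z)\<close> are
  density points of the first set, the almost everywhere condition makes \<open>(x, z)\<close> a density point
  of the second one.\<close>

section \<open>Lebesgue measurable kernels at random points\<close>

text \<open>A finite \<open>G\<close> close to \<Gamma> has few violations of the poset axioms, but
  they may be spread over all its vertices, so repairing \<open>G\<close> itself would take a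
  removal lemma. A random sample of fixed size \<open>k\<close> avoids this: failure to be a poset
  is witnessed by a loop, a 2-cycle or an open path on three distinct vertices, so its probability
  is bounded by multiples \<open>k\<close>, \<open>k^2\<close>, \<open>k^3\<close> of densities that
  tend to 0 while \<open>k\<close> stays fixed. The second moment bound depends on \<open>k\<close>
  and the test digraph but not on \<open>G\<close>, so \<open>k\<close> can be chosen before
  \<open>G\<close>. No 3-cycle is among these witnesses. \<open>C3\<close> enters only because an
  open path whose ends are joined backwards is not an induced \<open>P2\<close>. For (v), the values
  of \<open>W10\<close> on a null set such as the diagonal are arbitrary, so almost everywhere
  identities cannot be used pointwise. Being a density point makes sense at every point and ignores
  null sets, and the closing of paths transfers to it by averaging over the middle vertex. Two sets
  occur because the conclusion \<open>W10 = 1\<close> is stronger than the hypothesis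
  \<open>W10 > 0\<close>.\<close>

lemma (in complete_measure) borel_measurable_AE_cong:
  fixes f g :: "'a \<Rightarrow> real"
  assumes g: "g \<in> borel_measurable M" and eq: "AE x in M. f x = g x"
  shows "f \<in> borel_measurable M"
proof (rule measurableI)
  fix A :: "real set" assume "A \<in> sets borel"
  then have "g -` A \<inter> space M \<in> sets M" using g by (rule measurable_sets[rotated])
  moreover have "AE x in M. x \<in> g -` A \<inter> space M \<longleftrightarrow> x \<in> f -` A \<inter> space M"
    using eq by eventually_elim auto
  ultimately show "f -` A \<inter> space M \<in> sets M"
    by (intro in_sets_AE[of "g -` A \<inter> space M" "f -` A \<inter> space M"]) auto
qed simp

lemma AE_lebesgue_on_iff:
  fixes S :: "'a::euclidean_space set"
  assumes "S \<in> sets borel"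
  shows "(AE x in lebesgue_on S. P x) \<longleftrightarrow> (AE x in lborel. x \<in> S \<longrightarrow> P x)"
  using assms by (subst AE_restrict_space_iff) (auto simp: AE_completion_iff)

lemma borel_version:
  fixes f :: "'a::euclidean_space \<Rightarrow> real"
  assumes S: "S \<in> sets borel" and f: "f \<in> borel_measurable (lebesgue_on S)"
  obtains g where "g \<in> borel_measurable borel" "AE x in lborel. x \<in> S \<longrightarrow> f x = g x"
proof -
  have "(\<lambda>x. indicator S x *\<^sub>R f x) \<in> borel_measurable lebesgue"
    using S f by (subst (asm) borel_measurable_restrict_space_iff) auto
  from completion_ex_borel_measurable_real[OF this]
  obtain g where "g \<in> borel_measurable lborel" "AE x in lborel. indicator S x *\<^sub>R f x = g x" by auto
  then show ?thesis by (intro that[of g]) (auto elim!: eventually_mono)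
qed

text \<open>Only null sets are required to pull back to null sets; this is what allows a Lebesgue
  (rather than Borel) measurable kernel to be composed with a coordinate projection.\<close>

definition nonsing :: "'b measure \<Rightarrow> ('b \<Rightarrow> 'a::euclidean_space) \<Rightarrow> 'a set \<Rightarrow> bool" where
  "nonsing M T S \<longleftrightarrow> T \<in> M \<rightarrow>\<^sub>M borel \<and> T \<in> space M \<rightarrow> S \<and> S \<in> sets borel \<and>
     (\<forall>N\<in>null_sets lborel. AE x in M. T x \<notin> N)"

lemma nonsing_AE:
  assumes "nonsing M T S" "AE y in lborel. y \<in> S \<longrightarrow> P y"
  shows "AE x in M. P (T x)"
proof -
  from assms(2) obtain N where N: "N \<in> null_sets lborel" "{y. \<not> (y \<in> S \<longrightarrow> P y)} \<subseteq> N"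
    by (elim AE_E) (use that in \<open>auto simp: null_sets_def\<close>)
  with assms(1) have "AE x in M. T x \<notin> N" by (auto simp: nonsing_def)
  moreover have "AE x in M. x \<in> space M" by simp
  ultimately show ?thesis
    by eventually_elim (use N assms(1) in \<open>auto simp: nonsing_def\<close>)
qed

text \<open>A Lebesgue measurable \<open>f\<close> composed with a merely Borel measurable
  \<open>T\<close> need not be measurable. A Borel version \<open>g\<close> composes well, and
  \<open>f (T x)\<close> differs from \<open>g (T x)\<close> only where \<open>T x\<close> lies in a
  null set, which the completion absorbs.\<close>

lemma nonsing_measurable:
  fixes f :: "'a::euclidean_space \<Rightarrow> real"
  assumes T: "nonsing M T S" and f: "f \<in> borel_measurable (lebesgue_on S)"
  shows "(\<lambda>x. f (T x)) \<in> borel_measurable (completion M)"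
proof -
  have S: "S \<in> sets borel" using T by (simp add: nonsing_def)
  obtain g where g: "g \<in> borel_measurable borel" "AE x in lborel. x \<in> S \<longrightarrow> f x = g x"
    using borel_version[OF S f] .
  have "(\<lambda>x. g (T x)) \<in> borel_measurable (completion M)"
    using T g(1) by (intro measurable_completion) (auto simp: nonsing_def)
  then show ?thesis
    by (rule completion.borel_measurable_AE_cong)
       (intro AE_completion nonsing_AE[OF T], use g(2) in simp)
qed

text \<open>Passing from \<open>M\<close> back to Lebesgue measure takes more than
  \<open>nonsing\<close>: \<open>T\<close> has to reach almost all of \<open>S\<close>, which the
  uniform law \<open>D\<close> provides.\<close>

lemma nonsing_AE_iff:
  assumes T: "nonsing M T S" and D: "distr M borel T = density lborel (indicator S)"
    and Q: "{y\<in>S. Q y} \<in> sets lebesgue"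
  shows "(AE x in completion M. Q (T x)) \<longleftrightarrow> (AE y in lborel. y \<in> S \<longrightarrow> Q y)"
proof
  have S: "S \<in> sets borel" and Tm: "T \<in> M \<rightarrow>\<^sub>M borel" using T by (simp_all add: nonsing_def)
  assume L: "AE x in completion M. Q (T x)"
  \<comment> \<open>The law of \<open>T\<close> only sees Borel sets, while \<open>Q\<close> holds
    on a Lebesgue measurable set; the Borel main part differs from it by a null set.\<close>
  let ?B = "main_part lborel {y\<in>S. Q y}"
  have B: "?B \<in> sets borel" using main_part_sets[OF Q] by simp
  have eq: "AE y in lborel. y \<in> ?B \<longleftrightarrow> y \<in> {y\<in>S. Q y}" by (rule AE_in_main_part[OF Q])
  have "AE x in M. T x \<in> ?B \<longleftrightarrow> T x \<in> {y\<in>S. Q y}"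
    by (rule nonsing_AE[OF T]) (use eq in eventually_elim, auto)
  moreover have "AE x in M. x \<in> space M" by simp
  moreover have "AE x in M. Q (T x)" using L by (simp add: AE_completion_iff)
  ultimately have "AE x in M. T x \<in> ?B"
    by eventually_elim (use T in \<open>auto simp: nonsing_def\<close>)
  then have "AE y in distr M borel T. y \<in> ?B"
    by (subst AE_distr_iff[OF Tm]) (use B in auto)
  then have "AE y in lborel. y \<in> S \<longrightarrow> y \<in> ?B"
    unfolding D by (subst (asm) AE_density) (use S in \<open>auto elim!: eventually_mono split: split_indicator_asm\<close>)
  with eq show "AE y in lborel. y \<in> S \<longrightarrow> Q y" by eventually_elim auto
next
  assume "AE y in lborel. y \<in> S \<longrightarrow> Q y"
  then show "AE x in completion M. Q (T x)" by (intro AE_completion nonsing_AE[OF T])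
qed

lemma nonsing_of_distr:
  fixes T :: "'b \<Rightarrow> 'a::euclidean_space" and M :: "'b measure"
  assumes "T \<in> M \<rightarrow>\<^sub>M borel" "T \<in> space M \<rightarrow> S" "S \<in> sets borel"
    and D: "distr M borel T = density lborel (indicator S)"
  shows "nonsing M T S"
  unfolding nonsing_def
proof (intro conjI ballI)
  fix N :: "'a set" assume N: "N \<in> null_sets lborel"
  have "AE y in lborel. y \<notin> N" using N by (rule AE_not_in)
  then have "AE y in distr M borel T. y \<notin> N"
    unfolding D by (subst AE_density) (use assms(3) in \<open>auto elim!: eventually_mono\<close>)
  then show "AE x in M. T x \<notin> N"
    using assms(1) by (rule AE_distrD[rotated])
qed (use assms in auto)

section \<open>Laws of one, two and three coordinates of a uniform random point\<close>

definition unit_lborel :: "real measure" where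
  "unit_lborel = restrict_space lborel {0..1}"

lemma prob_space_unit_lborel: "prob_space unit_lborel"
  unfolding unit_lborel_def by (rule prob_space_restrict_space) auto

lemma space_unit_lborel [simp]: "space unit_lborel = {0..1}"
  by (simp add: unit_lborel_def space_restrict_space)

lemma measurable_unit_lborel_borel: "(\<lambda>x. x) \<in> unit_lborel \<rightarrow>\<^sub>M borel"
  by (simp add: unit_lborel_def measurable_restrict_space1)

lemma measurable_PiM_unit_component:
  "i \<in> I \<Longrightarrow> (\<lambda>x. x i) \<in> borel_measurable (Pi\<^sub>M I (\<lambda>_. unit_lborel))"
  by (rule measurable_compose[OF measurable_component_singleton[of i I "\<lambda>_. unit_lborel"]
        measurable_unit_lborel_borel])

lemma unit_cube_eq: "unit_cube I = completion (Pi\<^sub>M I (\<lambda>_. unit_lborel))"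
  by (simp add: unit_cube_def unit_lborel_def)

lemma emeasure_unit_lborel:
  "A \<in> sets borel \<Longrightarrow> emeasure unit_lborel (A \<inter> {0..1}) = emeasure (density lborel (indicator {0..1})) A"
  by (simp add: unit_lborel_def emeasure_restrict_space emeasure_density Int_commute
      flip: indicator_inter_arith)

lemma distr_unit_component:
  assumes "i \<in> I"
  shows "distr (Pi\<^sub>M I (\<lambda>_. unit_lborel)) borel (\<lambda>x. x i) = density lborel (indicator {0..1})"
proof (rule measure_eqI)
  fix A assume "A \<in> sets (distr (Pi\<^sub>M I (\<lambda>_. unit_lborel)) borel (\<lambda>x. x i))"
  then have A: "A \<in> sets borel" by simp
  have "(\<lambda>x. x i) -` A \<inter> space (Pi\<^sub>M I (\<lambda>_. unit_lborel))
     = prod_emb I (\<lambda>_. unit_lborel) {i} (\<Pi>\<^sub>E _\<in>{i}. A \<inter> {0..1})"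
    using assms by (auto simp: prod_emb_def space_PiM PiE_iff)
  moreover have "A \<inter> {0..1} \<in> sets unit_lborel"
    using A by (auto simp: unit_lborel_def sets_restrict_space)
  ultimately show "emeasure (distr (Pi\<^sub>M I (\<lambda>_. unit_lborel)) borel (\<lambda>x. x i)) A
      = emeasure (density lborel (indicator {0..1})) A"
    using assms A prob_space_unit_lborel measurable_PiM_unit_component[OF assms]
    by (simp add: emeasure_distr emeasure_PiM_emb emeasure_unit_lborel)
qed simp

lemma sigma_finite_density_indicator:
  fixes A :: "'a::euclidean_space set"
  assumes "A \<in> sets borel" "emeasure lborel A < \<infinity>"
  shows "sigma_finite_measure (density lborel (indicator A))"
  by (rule finite_measure.axioms(1), rule finite_measureI)
     (use assms in \<open>simp add: emeasure_density\<close>)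

lemma density_indicator_pair:
  fixes S :: "'a::euclidean_space set" and R :: "'b::euclidean_space set"
  assumes [measurable]: "S \<in> sets borel" "R \<in> sets borel"
  and "emeasure lborel S < \<infinity>" "emeasure lborel R < \<infinity>"
  shows "density lborel (indicator S) \<Otimes>\<^sub>M density lborel (indicator R)
    = density (lborel :: ('a \<times> 'b) measure) (indicator (S \<times> R))"
proof -
  have "density lborel (indicator S) \<Otimes>\<^sub>M density lborel (indicator R)
     = density (lborel \<Otimes>\<^sub>M lborel) (\<lambda>(x, y). indicator S x * indicator R y)"
    by (rule pair_measure_density[OF _ _ lborel.sigma_finite_measure_axioms
          sigma_finite_density_indicator[OF assms(2,4)]]) auto
  also have "(\<lambda>(x, y). indicator S x * indicator R y) = (indicator (S \<times> R) :: _ \<Rightarrow> ennreal)"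
    by (auto simp: fun_eq_iff indicator_times)
  finally show ?thesis by (simp add: lborel_prod)
qed

lemma measurable_PiM_unit_pair:
  "i \<in> I \<Longrightarrow> j \<in> I \<Longrightarrow> (\<lambda>x. (x i, x j)) \<in> borel_measurable (Pi\<^sub>M I (\<lambda>_. unit_lborel))"
  by (intro borel_measurable_Pair measurable_PiM_unit_component)

text \<open>Rectangles determine the joint law, and distinct coordinates are independent. For
  \<open>i = j\<close> the law would live on the diagonal, which is a null set.\<close>

lemma distr_unit_pair:
  assumes ij: "i \<in> I" "j \<in> I" "i \<noteq> j"
  shows "distr (Pi\<^sub>M I (\<lambda>_. unit_lborel)) borel (\<lambda>x. (x i, x j)) = density lborel (indicator unit_sq)"
proof -
  let ?P = "Pi\<^sub>M I (\<lambda>_. unit_lborel)" and ?D = "density lborel (indicator {0..1::real})"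
  have sf: "sigma_finite_measure ?D"
    by (rule sigma_finite_density_indicator) auto
  have "?D \<Otimes>\<^sub>M ?D = distr ?P borel (\<lambda>x. (x i, x j))"
  proof (rule pair_measure_eqI[OF sf sf])
    show "sets (?D \<Otimes>\<^sub>M ?D) = sets (distr ?P borel (\<lambda>x. (x i, x j)))"
      by (subst sets_pair_measure_cong[of _ borel _ borel]) (simp_all only: borel_prod sets_distr sets_density sets_lborel)
  next
    fix A B assume "A \<in> sets ?D" "B \<in> sets ?D"
    then have A: "A \<in> sets borel" and B: "B \<in> sets borel" by auto
    have "(\<lambda>x. (x i, x j)) -` (A \<times> B) \<inter> space ?P
       = prod_emb I (\<lambda>_. unit_lborel) {i,j} (\<Pi>\<^sub>E k\<in>{i,j}. (if k = i then A else B) \<inter> {0..1})"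
      using ij by (auto simp: prod_emb_def space_PiM PiE_iff)
    moreover have "emeasure ?P (prod_emb I (\<lambda>_. unit_lborel) {i,j} (\<Pi>\<^sub>E k\<in>{i,j}. (if k = i then A else B) \<inter> {0..1}))
       = (\<Prod>k\<in>{i,j}. emeasure unit_lborel ((if k = i then A else B) \<inter> {0..1}))"
      using ij A B prob_space_unit_lborel
      by (intro emeasure_PiM_emb) (auto simp: unit_lborel_def sets_restrict_space)
    moreover have "A \<times> B \<in> sets borel" using A B by (simp add: borel_Times)
    ultimately show "emeasure ?D A * emeasure ?D B = emeasure (distr ?P borel (\<lambda>x. (x i, x j))) (A \<times> B)"
      using ij A B by (simp add: emeasure_distr emeasure_unit_lborel measurable_PiM_unit_pair)
  qed
  moreover have "?D \<Otimes>\<^sub>M ?D = density lborel (indicator unit_sq)"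
    unfolding unit_sq_def by (rule density_indicator_pair) auto
  ultimately show ?thesis by simp
qed

lemma unit_sq_borel [measurable, simp]: "unit_sq \<in> sets borel"
  by (simp add: unit_sq_def borel_Times)

text \<open>Coordinate 0 is split off and the other two are handled by the pair law. The shape
  \<open>{0..1} \<times> unit_sq\<close> follows the right nesting of triples.\<close>

lemma distr_unit_triple:
  "distr (Pi\<^sub>M {0..<3::nat} (\<lambda>_. unit_lborel)) borel (\<lambda>x. (x 0, x 1, x 2))
    = density lborel (indicator ({0..1} \<times> unit_sq))"
proof -
  let ?U = "\<lambda>_::nat. unit_lborel"
  let ?D = "density lborel (indicator {0..1::real})" and ?D2 = "density lborel (indicator unit_sq)"
  have I: "{0..<3::nat} = insert 0 {1, 2}" by auto
  have "Pi\<^sub>M {0..<3} ?U = distr (unit_lborel \<Otimes>\<^sub>M Pi\<^sub>M {1,2} ?U) (Pi\<^sub>M {0..<3} ?U) (\<lambda>(x, X). X(0 := x))"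
    unfolding I by (rule distr_pair_PiM_eq_PiM[symmetric]) (auto intro: prob_space_unit_lborel)
  then have "distr (Pi\<^sub>M {0..<3} ?U) borel (\<lambda>x. (x 0, x 1, x 2))
     = distr (distr (unit_lborel \<Otimes>\<^sub>M Pi\<^sub>M {1,2} ?U) (Pi\<^sub>M {0..<3} ?U) (\<lambda>(x, X). X(0 := x))) borel (\<lambda>x. (x 0, x 1, x 2))"
    by simp
  also have "\<dots> = distr (unit_lborel \<Otimes>\<^sub>M Pi\<^sub>M {1,2} ?U) borel ((\<lambda>x. (x 0, x 1, x 2)) \<circ> (\<lambda>(x, X). X(0 := x)))"
    unfolding I
    by (rule distr_distr)
       (intro borel_measurable_Pair measurable_PiM_unit_component insertI1 insertI2, measurable)
  also have "((\<lambda>x. (x 0, x 1, x 2)) \<circ> (\<lambda>(x, X). X(0 := x))) = (\<lambda>(x, X). (x, (X 1, X (2::nat))))"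
    by (auto simp: fun_eq_iff)
  also have "distr (unit_lborel \<Otimes>\<^sub>M Pi\<^sub>M {1,2} ?U) borel (\<lambda>(x, X). (x, (X 1, X 2)))
     = distr (unit_lborel \<Otimes>\<^sub>M Pi\<^sub>M {1,2} ?U) (borel \<Otimes>\<^sub>M borel) (\<lambda>(x, X). (x, (X 1, X 2)))"
    by (rule distr_cong) (simp_all only: borel_prod)
  also have "\<dots> = distr unit_lborel borel (\<lambda>x. x) \<Otimes>\<^sub>M distr (Pi\<^sub>M {1,2} ?U) borel (\<lambda>X. (X 1, X 2))"
  proof (rule pair_measure_distr[symmetric])
    interpret P: prob_space "distr (Pi\<^sub>M {1,2} ?U) borel (\<lambda>X. (X 1, X (2::nat)))"
      by (rule prob_space.prob_space_distr)
         (auto intro!: prob_space_PiM prob_space_unit_lborel measurable_PiM_unit_pair)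
    show "sigma_finite_measure (distr (Pi\<^sub>M {1,2} ?U) borel (\<lambda>X. (X 1, X (2::nat))))" ..
  qed (rule measurable_unit_lborel_borel, rule measurable_PiM_unit_pair, auto)
  also have "distr unit_lborel borel (\<lambda>x. x) = ?D"
  proof (rule measure_eqI)
    fix A assume "A \<in> sets (distr unit_lborel borel (\<lambda>x. x))"
    then show "emeasure (distr unit_lborel borel (\<lambda>x. x)) A = emeasure ?D A"
      using measurable_unit_lborel_borel by (simp add: emeasure_distr emeasure_unit_lborel)
  qed simp
  also have "distr (Pi\<^sub>M {1,2} ?U) borel (\<lambda>X. (X 1, X 2)) = ?D2"
    by (rule distr_unit_pair) auto
  also have "?D \<Otimes>\<^sub>M ?D2 = density lborel (indicator ({0..1} \<times> unit_sq))"
  proof (rule density_indicator_pair)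
    show "emeasure lborel unit_sq < \<infinity>"
      by (rule emeasure_bounded_finite) (simp add: unit_sq_def bounded_Times)
  qed auto
  finally show ?thesis .
qed

lemma nonsing_component:
  "i \<in> I \<Longrightarrow> nonsing (Pi\<^sub>M I (\<lambda>_. unit_lborel)) (\<lambda>x. x i) {0..1}"
  by (rule nonsing_of_distr) (auto simp: distr_unit_component measurable_PiM_unit_component space_PiM PiE_iff)

lemma nonsing_pair:
  "i \<in> I \<Longrightarrow> j \<in> I \<Longrightarrow> i \<noteq> j \<Longrightarrow> nonsing (Pi\<^sub>M I (\<lambda>_. unit_lborel)) (\<lambda>x. (x i, x j)) unit_sq"
  by (rule nonsing_of_distr) (auto simp: distr_unit_pair measurable_PiM_unit_pair space_PiM PiE_iff unit_sq_def[THEN eqset_imp_iff])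

lemma nonsing_triple:
  "nonsing (Pi\<^sub>M {0..<3::nat} (\<lambda>_. unit_lborel)) (\<lambda>x. (x 0, x 1, x 2)) ({0..1} \<times> unit_sq)"
  by (rule nonsing_of_distr[OF _ _ _ distr_unit_triple])
     (auto intro!: borel_measurable_Pair measurable_PiM_unit_component simp: space_PiM PiE_iff borel_Times unit_sq_def[THEN eqset_imp_iff])

section \<open>Null sets under coordinate maps of the plane and of space\<close>

lemma AE_lborel_pair_iff:
  fixes N :: "('a::euclidean_space \<times> 'b::euclidean_space) set"
  assumes "N \<in> sets borel"
  shows "(AE p in lborel. p \<notin> N) \<longleftrightarrow> (AE x in lborel. AE y in lborel. (x, y) \<notin> N)"
proof -
  have "{p \<in> space (lborel \<Otimes>\<^sub>M lborel). (fst p, snd p) \<notin> N} = - N" by (auto simp: space_pair_measure)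
  moreover have "- N \<in> sets (lborel \<Otimes>\<^sub>M lborel :: ('a \<times> 'b) measure)"
    using assms by (simp only: lborel_prod sets_lborel borel_comp)
  ultimately have "{p \<in> space (lborel \<Otimes>\<^sub>M lborel). (fst p, snd p) \<notin> N} \<in> sets (lborel \<Otimes>\<^sub>M lborel)"
    by metis
  from lborel_pair.AE_pair_iff[OF this] show ?thesis by (simp only: lborel_prod prod.collapse)
qed

text \<open>Fubini reduces the condition on preimages of null sets to almost every section, so that
  the coordinate maps below are treated one variable at a time.\<close>

lemma nonsing_lborelI:
  fixes T :: "'a::euclidean_space \<times> 'b::euclidean_space \<Rightarrow> 'c::euclidean_space"
  assumes T: "T \<in> borel_measurable borel"
    and *: "\<And>N. N \<in> sets borel \<Longrightarrow> AE p in lborel. p \<notin> N \<Longrightarrow> AE x in lborel. AE y in lborel. T (x, y) \<notin> N"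
  shows "nonsing lborel T UNIV"
  unfolding nonsing_def
proof (intro conjI ballI)
  fix N :: "'c set" assume N: "N \<in> null_sets lborel"
  then have Nb: "N \<in> sets borel" by auto
  have "T -` N \<in> sets borel" using measurable_sets[OF T Nb] by simp
  then show "AE x in lborel. T x \<notin> N"
    using AE_lborel_pair_iff[of "T -` N"] *[OF Nb AE_not_in[OF N]] by simp
qed (use T in auto)

lemma nonsing_fst: "nonsing lborel fst (UNIV :: 'a::euclidean_space set)"
  by (rule nonsing_lborelI) (auto simp: borel_measurable_continuous_onI[OF continuous_on_fst[OF continuous_on_id]] elim: eventually_mono)

lemma nonsing_snd: "nonsing lborel snd (UNIV :: 'a::euclidean_space set)"
  by (rule nonsing_lborelI) (auto simp: borel_measurable_continuous_onI[OF continuous_on_snd[OF continuous_on_id]] elim: eventually_mono)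

lemma nonsing_swap: "nonsing lborel (\<lambda>(a, b). (b, a)) (UNIV :: (real \<times> real) set)"
proof (rule nonsing_lborelI)
  fix N :: "(real \<times> real) set" assume N: "N \<in> sets borel" "AE p in lborel. p \<notin> N"
  have "{p \<in> space (lborel \<Otimes>\<^sub>M lborel). (fst p, snd p) \<notin> N} = - N" by (auto simp: space_pair_measure)
  moreover have "- N \<in> sets (lborel \<Otimes>\<^sub>M lborel :: (real \<times> real) measure)"
    using N by (simp only: lborel_prod sets_lborel borel_comp)
  ultimately have "{p \<in> space (lborel \<Otimes>\<^sub>M lborel). (fst p, snd p) \<notin> N} \<in> sets (lborel \<Otimes>\<^sub>M lborel)"
    by metis
  from lborel_pair.AE_commute[OF this]
  show "AE x in lborel. AE y in lborel. (case (x, y) of (a, b) \<Rightarrow> (b, a)) \<notin> N"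
    using AE_lborel_pair_iff[of N] N by simp
qed (simp_all add: case_prod_beta' borel_measurable_continuous_onI continuous_on_Pair
        continuous_on_fst continuous_on_snd continuous_on_id)

lemma nonsing_proj12: "nonsing lborel (\<lambda>(a :: real, b, c :: real). (a, b)) (UNIV :: (real \<times> real) set)"
proof (rule nonsing_lborelI)
  fix N :: "(real \<times> real) set" assume N: "N \<in> sets borel" "AE p in lborel. p \<notin> N"
  have "AE x in lborel. AE y in lborel. (x, y) \<notin> N" using N AE_lborel_pair_iff by blast
  then show "AE x in lborel. AE y in lborel. (case (x, y) of (a, b, c :: real) \<Rightarrow> (a, b)) \<notin> N"
  proof eventually_elim
    case (elim a)
    then show ?case using nonsing_AE[OF nonsing_fst, of "\<lambda>b. (a, b) \<notin> N"] by (simp add: case_prod_beta')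
  qed
qed (simp_all add: case_prod_beta' borel_measurable_continuous_onI continuous_on_Pair
        continuous_on_fst continuous_on_snd continuous_on_id)

lemma nonsing_proj23: "nonsing lborel (\<lambda>(a :: real, b, c). (b, c)) (UNIV :: (real \<times> real) set)"
  by (rule nonsing_lborelI)
     (simp_all add: case_prod_beta' borel_measurable_continuous_onI continuous_on_Pair
        continuous_on_fst continuous_on_snd continuous_on_id)

lemma nonsing_proj13: "nonsing lborel (\<lambda>(a :: real, b :: real, c). (a, c)) (UNIV :: (real \<times> real) set)"
proof (rule nonsing_lborelI)
  fix N :: "(real \<times> real) set" assume N: "N \<in> sets borel" "AE p in lborel. p \<notin> N"
  have "AE x in lborel. AE y in lborel. (x, y) \<notin> N" using N AE_lborel_pair_iff by blast
  then show "AE x in lborel. AE y in lborel. (case (x, y) of (a, b :: real, c) \<Rightarrow> (a, c)) \<notin> N"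
  proof eventually_elim
    case (elim a)
    then show ?case using nonsing_AE[OF nonsing_snd, of "\<lambda>b. (a, b) \<notin> N"] by (simp add: case_prod_beta')
  qed
qed (simp_all add: case_prod_beta' borel_measurable_continuous_onI continuous_on_Pair
        continuous_on_fst continuous_on_snd continuous_on_id)

section \<open>Integrals of kernels and subgraph probabilities\<close>

lemma lebesgue_on_zero_set:
  fixes f :: "'a::euclidean_space \<Rightarrow> real"
  assumes "S \<in> sets borel" "f \<in> borel_measurable (lebesgue_on S)"
  shows "{y \<in> S. f y = 0} \<in> sets lebesgue"
proof -
  have "{y \<in> space (lebesgue_on S). f y = 0} \<in> sets (lebesgue_on S)" using assms(2) by measurable
  moreover have "S \<inter> space lebesgue \<in> sets lebesgue" using assms(1) by simp
  ultimately have "{y \<in> space (lebesgue_on S). f y = 0} \<in> sets lebesgue"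
    by (metis sets_restrict_space_iff)
  then show ?thesis
    by (simp only: space_restrict_space space_completion space_lborel space_borel Int_UNIV_right)
qed

lemma nonsing_integrable:
  fixes f :: "'a::euclidean_space \<Rightarrow> real"
  assumes M: "prob_space M" and T: "nonsing M T S" 
    and f: "f \<in> borel_measurable (lebesgue_on S)" and b: "\<And>y. y \<in> S \<Longrightarrow> \<bar>f y\<bar> \<le> B"
  shows "integrable (completion M) (\<lambda>x. f (T x))"
proof -
  interpret prob_space "completion M" using prob_space.prob_space_completion[OF M] .
  show ?thesis
    by (rule integrable_const_bound[of _ B])
       (use T b in \<open>auto intro!: nonsing_measurable[OF T f] AE_I2 simp: nonsing_def Pi_iff\<close>)
qed

lemma nonsing_integral_0_iff:
  fixes f :: "'a::euclidean_space \<Rightarrow> real"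
  assumes M: "prob_space M" and T: "nonsing M T S" and D: "distr M borel T = density lborel (indicator S)"
    and f: "f \<in> borel_measurable (lebesgue_on S)" and b: "\<And>y. y \<in> S \<Longrightarrow> 0 \<le> f y \<and> f y \<le> B"
  shows "(\<integral>x. f (T x) \<partial>completion M) = 0 \<longleftrightarrow> (AE y in lborel. y \<in> S \<longrightarrow> f y = 0)"
proof -
  have S: "S \<in> sets borel" using T by (simp add: nonsing_def)
  have "(\<integral>x. f (T x) \<partial>completion M) = 0 \<longleftrightarrow> (AE x in completion M. f (T x) = 0)"
  proof (rule integral_nonneg_eq_0_iff_AE)
    show "integrable (completion M) (\<lambda>x. f (T x))"
      by (rule nonsing_integrable[OF M T f, of B]) (use b in force)
    show "AE x in completion M. 0 \<le> f (T x)"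
      by (rule AE_I2) (use T b in \<open>auto simp: nonsing_def\<close>)
  qed
  also have "\<dots> \<longleftrightarrow> (AE y in lborel. y \<in> S \<longrightarrow> f y = 0)"
    by (rule nonsing_AE_iff[OF T D lebesgue_on_zero_set[OF S f]])
  finally show ?thesis .
qed

lemma prob_space_PiM_unit: "prob_space (Pi\<^sub>M I (\<lambda>_. unit_lborel))"
  by (intro prob_space_PiM prob_space_unit_lborel)

text \<open>The transitive triangle, that is, \<open>P2\<close> with its closing edge. Its
  homomorphisms are those of \<open>P2\<close> whose end vertices are joined, so a difference of two
  homomorphism densities measures the paths left open.\<close>

definition T3 :: dg where "T3 = (3, {(0, 1), (1, 2), (0, 2)})"

lemma pairs_below_1: "{(i, j). i < j \<and> j < (1::nat)} = {}" by auto
lemma pairs_below_2: "{(i, j). i < j \<and> j < (2::nat)} = {(0, 1)}" by auto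
lemma pairs_below_3: "{(i, j). i < j \<and> j < (3::nat)} = {(0, 1), (0, 2), (1, 2)}" by auto

lemma sub_prob_C1: "sub_prob W01 W10 W11 w C1 = (\<integral>x. w (x 0) \<partial>unit_cube {0..<1})"
  unfolding sub_prob_def C1_def fst_conv snd_conv pairs_below_1 by simp

lemma sub_prob_C2: "sub_prob W01 W10 W11 w C2 = (\<integral>x. W11 (x 0, x 1) \<partial>unit_cube {0..<2})"
proof -
  have "{0..<2} = {0, 1::nat}" by auto
  then have "(\<Prod>i\<in>{0..<2::nat}. if (i, i) \<in> {(0, 1), (1, 0)} then w (x i) else 1) = 1" for x by simp
  then show ?thesis unfolding sub_prob_def C2_def fst_conv snd_conv pairs_below_2 by (simp add: pair_prob_def)
qed

lemma sub_prob_P2: "sub_prob W01 W10 W11 w P2 =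
   (\<integral>x. (W10 (x 0, x 1) + W11 (x 0, x 1)) * (W10 (x 1, x 2) + W11 (x 1, x 2)) \<partial>unit_cube {0..<3})"
proof -
  have "{0..<3} = {0, 1, 2::nat}" by auto
  then have "(\<Prod>i\<in>{0..<3::nat}. if (i, i) \<in> {(0, 1), (1, 2)} then w (x i) else 1) = 1" for x by simp
  then show ?thesis unfolding sub_prob_def P2_def fst_conv snd_conv pairs_below_3 by (simp add: pair_prob_def)
qed

lemma sub_prob_T3: "sub_prob W01 W10 W11 w T3 =
   (\<integral>x. (W10 (x 0, x 1) + W11 (x 0, x 1)) * (W10 (x 1, x 2) + W11 (x 1, x 2)) * (W10 (x 0, x 2) + W11 (x 0, x 2))
     \<partial>unit_cube {0..<3})"
proof -
  have "{0..<3} = {0, 1, 2::nat}" by auto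
  then have "(\<Prod>i\<in>{0..<3::nat}. if (i, i) \<in> {(0, 1), (1, 2), (0, 2)} then w (x i) else 1) = 1" for x by simp
  then show ?thesis unfolding sub_prob_def T3_def fst_conv snd_conv pairs_below_3
    by (simp add: pair_prob_def mult_ac)
qed

text \<open>Two distinct coordinates have an absolutely continuous joint law, so changing a kernel
  on a planar null set changes the integrand on a null set only. This permits the redefinition of
  kernels in \<open>strict_representation\<close>.\<close>

lemma sub_prob_cong_AE:
  assumes W: "quintuple W00 W01 W10 W11 w" and V: "quintuple V00 V01 V10 V11 v"
    and ae: "AE x in lborel. x \<in> {0..1} \<longrightarrow> w x = v x"
    "AE p in lborel. p \<in> unit_sq \<longrightarrow> W01 p = V01 p" "AE p in lborel. p \<in> unit_sq \<longrightarrow> W10 p = V10 p"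
    "AE p in lborel. p \<in> unit_sq \<longrightarrow> W11 p = V11 p"
  shows "sub_prob W01 W10 W11 w F = sub_prob V01 V10 V11 v F"
proof -
  let ?I = "{0..<fst F}" and ?J = "{(i, j). i < j \<and> j < fst F}"
  have "finite ?J" by (rule finite_subset[of _ "?I \<times> ?I"]) auto
  note w_meas = nonsing_measurable[OF nonsing_component]
  note W_meas = nonsing_measurable[OF nonsing_pair]
  have meas: "(\<lambda>x. (\<Prod>i\<in>?I. if (i, i) \<in> snd F then w (x i) else 1) *
          (\<Prod>p\<in>?J. pair_prob W01 W10 W11 (x (fst p)) (x (snd p))
                 ((fst p, snd p) \<in> snd F) ((snd p, fst p) \<in> snd F)))
      \<in> borel_measurable (completion (Pi\<^sub>M ?I (\<lambda>_. unit_lborel)))"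
    if "quintuple W00 W01 W10 W11 w" for W00 W01 W10 W11 w
    using that unfolding pair_prob_def quintuple_def
    by (intro borel_measurable_times borel_measurable_prod)
       (auto intro!: w_meas W_meas borel_measurable_add)
  have ae_w: "AE x in completion (Pi\<^sub>M ?I (\<lambda>_. unit_lborel)). w (x i) = v (x i)" if "i \<in> ?I" for i
    by (intro AE_completion nonsing_AE[OF nonsing_component] that) (use ae in simp)
  have ae_W: "AE x in completion (Pi\<^sub>M ?I (\<lambda>_. unit_lborel)).
      pair_prob W01 W10 W11 (x (fst p)) (x (snd p)) a b = pair_prob V01 V10 V11 (x (fst p)) (x (snd p)) a b"
    if "p \<in> ?J" for p a b
  proof -
    have p: "fst p \<in> ?I" "snd p \<in> ?I" "fst p \<noteq> snd p" using that by auto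
    note * = AE_completion[OF nonsing_AE[OF nonsing_pair[OF p]]]
    from *[OF ae(2)] *[OF ae(3)] *[OF ae(4)] show ?thesis
      by eventually_elim (simp add: pair_prob_def)
  qed
  have "AE x in completion (Pi\<^sub>M ?I (\<lambda>_. unit_lborel)). \<forall>i\<in>?I. w (x i) = v (x i)"
    using ae_w by (intro AE_finite_allI) auto
  moreover have "AE x in completion (Pi\<^sub>M ?I (\<lambda>_. unit_lborel)). \<forall>p\<in>?J.
      pair_prob W01 W10 W11 (x (fst p)) (x (snd p)) ((fst p, snd p) \<in> snd F) ((snd p, fst p) \<in> snd F)
      = pair_prob V01 V10 V11 (x (fst p)) (x (snd p)) ((fst p, snd p) \<in> snd F) ((snd p, fst p) \<in> snd F)"
    using ae_W \<open>finite ?J\<close> by (intro AE_finite_allI) auto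
  ultimately have "AE x in completion (Pi\<^sub>M ?I (\<lambda>_. unit_lborel)).
      (\<Prod>i\<in>?I. if (i, i) \<in> snd F then w (x i) else 1) *
      (\<Prod>p\<in>?J. pair_prob W01 W10 W11 (x (fst p)) (x (snd p))
                 ((fst p, snd p) \<in> snd F) ((snd p, fst p) \<in> snd F))
      = (\<Prod>i\<in>?I. if (i, i) \<in> snd F then v (x i) else 1) *
      (\<Prod>p\<in>?J. pair_prob V01 V10 V11 (x (fst p)) (x (snd p))
                 ((fst p, snd p) \<in> snd F) ((snd p, fst p) \<in> snd F))"
  proof eventually_elim
    case (elim x)
    show ?case
      by (intro arg_cong2[where f="(*)"] prod.cong refl elim(2)[rule_format]) (use elim(1) in simp)
  qed
  then show ?thesis unfolding sub_prob_def unit_cube_eq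
    by (intro integral_cong_AE meas[OF W] meas[OF V])
qed

lemma lebesgue_extend_by_0:
  fixes f :: "'a::euclidean_space \<Rightarrow> real"
  assumes "S \<in> sets borel" "f \<in> borel_measurable (lebesgue_on S)"
  shows "(\<lambda>p. indicator S p * f p) \<in> borel_measurable (lebesgue_on UNIV)"
proof -
  have "S \<inter> space lebesgue \<in> sets lebesgue" using assms(1) by simp
  from borel_measurable_restrict_space_iff[OF this, of f] assms(2) show ?thesis
    by (simp add: lebesgue_on_UNIV_eq)
qed

text \<open>Homomorphism densities see the total edge probability \<open>W10 + W11\<close>. The
  density of \<open>P2\<close> minus that of \<open>T3\<close> is the integral of the conditional
  probability that a path is present and its closing edge absent, so equality forces a nonnegative
  integrand to vanish almost everywhere.\<close>

lemma poset_kernel_iff: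
  assumes W: "quintuple W00 W01 W10 W11 w"
  shows "sub_prob W01 W10 W11 w C1 = 0 \<and> sub_prob W01 W10 W11 w C2 = 0 \<and>
      sub_prob W01 W10 W11 w P2 = sub_prob W01 W10 W11 w T3 \<longleftrightarrow>
     (AE x in lborel. x \<in> {0..1} \<longrightarrow> w x = 0) \<and> (AE p in lborel. p \<in> unit_sq \<longrightarrow> W11 p = 0) \<and>
     (AE t in lborel. case t of (x, y, z) \<Rightarrow> x \<in> {0..1} \<and> y \<in> {0..1} \<and> z \<in> {0..1} \<longrightarrow>
         \<not> (W10 (x, y) > 0 \<and> W10 (y, z) > 0 \<and> W10 (x, z) < 1))"
proof -
  have m: "w \<in> borel_measurable (lebesgue_on {0..1})" "W11 \<in> borel_measurable (lebesgue_on unit_sq)"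
      "W10 \<in> borel_measurable (lebesgue_on unit_sq)" using W by (auto simp: quintuple_def)
  have b: "0 \<le> W11 p" "W11 p \<le> 1" "0 \<le> W10 p" "W10 p \<le> 1" "0 \<le> W10 p + W11 p" "W10 p + W11 p \<le> 1"
    if "p \<in> unit_sq" for p
  proof -
    obtain x y where p: "p = (x, y)" and xy: "x \<in> {0..1}" "y \<in> {0..1}"
      using \<open>p \<in> unit_sq\<close> by (auto simp: unit_sq_def)
    have "W00 (x, y) \<in> {0..1}" "W01 (x, y) \<in> {0..1}" "W10 (x, y) \<in> {0..1}" "W11 (x, y) \<in> {0..1}"
      "W00 (x, y) + W01 (x, y) + W10 (x, y) + W11 (x, y) = 1"
      using W xy unfolding quintuple_def by blast+
    then show "0 \<le> W11 p" "W11 p \<le> 1" "0 \<le> W10 p" "W10 p \<le> 1" "0 \<le> W10 p + W11 p" "W10 p + W11 p \<le> 1"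
      unfolding p by auto
  qed
  have C1: "sub_prob W01 W10 W11 w C1 = 0 \<longleftrightarrow> (AE x in lborel. x \<in> {0..1} \<longrightarrow> w x = 0)"
    unfolding sub_prob_C1 unit_cube_eq
  proof (rule nonsing_integral_0_iff[OF prob_space_PiM_unit nonsing_component distr_unit_component m(1)])
    fix y :: real assume "y \<in> {0..1}"
    then have "w y \<in> {0, 1}" using W unfolding quintuple_def by blast
    then show "0 \<le> w y \<and> w y \<le> 1" by auto
  qed auto
  have C2: "sub_prob W01 W10 W11 w C2 = 0 \<longleftrightarrow> (AE p in lborel. p \<in> unit_sq \<longrightarrow> W11 p = 0)"
    unfolding sub_prob_C2 unit_cube_eq
    by (rule nonsing_integral_0_iff[OF prob_space_PiM_unit nonsing_pair distr_unit_pair m(2), where B = 1])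
       (use b in auto)
  \<comment> \<open>Extension by 0 outside the square makes \<open>A\<close> a kernel on the whole
    plane, which can be composed with the projections from space.\<close>
  define A where "A = (\<lambda>p. indicator unit_sq p * (W10 p + W11 p))"
  have Am: "A \<in> borel_measurable (lebesgue_on UNIV)"
    unfolding A_def by (intro lebesgue_extend_by_0 borel_measurable_add m) simp
  have Ab: "0 \<le> A p" "A p \<le> 1" for p using b[of p] by (auto simp: A_def indicator_def)
  define h :: "real \<times> real \<times> real \<Rightarrow> real" where "h = (\<lambda>(a, b, c). A (a, b) * A (b, c) * (1 - A (a, c)))"
  let ?S = "{0..1} \<times> unit_sq" and ?P = "Pi\<^sub>M {0..<3::nat} (\<lambda>_. unit_lborel)"
  have hm: "h \<in> borel_measurable (lebesgue_on ?S)"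
  proof (rule measurable_restrict_space1)
    have "(\<lambda>t. A (case t of (a, b, c) \<Rightarrow> (a, b)) * A (case t of (a, b, c) \<Rightarrow> (b, c))
        * (1 - A (case t of (a, b, c) \<Rightarrow> (a, c)))) \<in> borel_measurable lebesgue"
      by (intro borel_measurable_times borel_measurable_diff borel_measurable_const
          nonsing_measurable[OF nonsing_proj12 Am] nonsing_measurable[OF nonsing_proj23 Am]
          nonsing_measurable[OF nonsing_proj13 Am])
    then show "h \<in> borel_measurable lebesgue" by (simp add: h_def case_prod_beta')
  qed
  have A_sq: "A (x i, x j) = W10 (x i, x j) + W11 (x i, x j)"
    if "x \<in> space ?P" "i < 3" "j < 3" for x i j
    using that by (auto simp: A_def space_PiM PiE_iff unit_sq_def)
  have int: "integrable (completion ?P) (\<lambda>x. A (x 0, x 1) * A (x 1, x 2))"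
     "integrable (completion ?P) (\<lambda>x. A (x 0, x 1) * A (x 1, x 2) * A (x 0, x 2))"
  proof -
    interpret prob_space "completion ?P" using prob_space.prob_space_completion[OF prob_space_PiM_unit] .
    have AUm: "A \<in> borel_measurable (lebesgue_on unit_sq)"
      using Am by (auto simp: lebesgue_on_UNIV_eq intro: measurable_restrict_space1)
    have mm: "(\<lambda>x. A (x i, x j)) \<in> borel_measurable (completion ?P)" if "i < 3" "j < 3" "i \<noteq> j" for i j
      by (rule nonsing_measurable[OF nonsing_pair AUm]) (use that in auto)
    show "integrable (completion ?P) (\<lambda>x. A (x 0, x 1) * A (x 1, x 2))"
      by (rule integrable_const_bound[of _ 1])
         (auto intro!: borel_measurable_times mm AE_I2 mult_le_one Ab simp: abs_mult Ab)
    show "integrable (completion ?P) (\<lambda>x. A (x 0, x 1) * A (x 1, x 2) * A (x 0, x 2))"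
      by (rule integrable_const_bound[of _ 1])
         (auto intro!: borel_measurable_times mm AE_I2 mult_le_one Ab simp: abs_mult Ab)
  qed
  have "sub_prob W01 W10 W11 w P2 = (\<integral>x. A (x 0, x 1) * A (x 1, x 2) \<partial>completion ?P)"
    unfolding sub_prob_P2 unit_cube_eq by (rule Bochner_Integration.integral_cong) (auto simp: A_sq)
  moreover have "sub_prob W01 W10 W11 w T3 = (\<integral>x. A (x 0, x 1) * A (x 1, x 2) * A (x 0, x 2) \<partial>completion ?P)"
    unfolding sub_prob_T3 unit_cube_eq by (rule Bochner_Integration.integral_cong) (auto simp: A_sq)
  ultimately have "sub_prob W01 W10 W11 w P2 - sub_prob W01 W10 W11 w T3
     = (\<integral>x. A (x 0, x 1) * A (x 1, x 2) - A (x 0, x 1) * A (x 1, x 2) * A (x 0, x 2) \<partial>completion ?P)"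
    using int by simp
  also have "\<dots> = (\<integral>x. h (x 0, x 1, x 2) \<partial>completion ?P)"
    by (rule Bochner_Integration.integral_cong) (auto simp: h_def algebra_simps)
  finally have "sub_prob W01 W10 W11 w P2 = sub_prob W01 W10 W11 w T3
     \<longleftrightarrow> (\<integral>x. h (x 0, x 1, x 2) \<partial>completion ?P) = 0" by linarith
  also have "\<dots> \<longleftrightarrow> (AE t in lborel. t \<in> ?S \<longrightarrow> h t = 0)"
  proof (rule nonsing_integral_0_iff[OF prob_space_PiM_unit nonsing_triple distr_unit_triple hm])
    show "0 \<le> h y \<and> h y \<le> 1" for y
      by (auto simp: h_def Ab split: prod.split intro!: mult_le_one mult_nonneg_nonneg)
  qed
  finally have P2: "sub_prob W01 W10 W11 w P2 = sub_prob W01 W10 W11 w T3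
     \<longleftrightarrow> (AE t in lborel. t \<in> ?S \<longrightarrow> h t = 0)" .
  \<comment> \<open>\<open>h\<close> is built from \<open>W10 + W11\<close>, condition (iv) from
    \<open>W10\<close> alone. They are compared under the assumption that \<open>W11\<close>
    vanishes almost everywhere, which is a conjunct on both sides of the claim.\<close>
  have "(AE t in lborel. t \<in> ?S \<longrightarrow> h t = 0) \<longleftrightarrow>
     (AE t in lborel. case t of (x, y, z) \<Rightarrow> x \<in> {0..1} \<and> y \<in> {0..1} \<and> z \<in> {0..1} \<longrightarrow>
         \<not> (W10 (x, y) > 0 \<and> W10 (y, z) > 0 \<and> W10 (x, z) < 1))"
    if ae: "AE p in lborel. p \<in> unit_sq \<longrightarrow> W11 p = 0"
  proof -
    have ae': "AE p in lborel. p \<in> UNIV \<longrightarrow> (p \<in> unit_sq \<longrightarrow> W11 p = 0)" using ae by simp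
    have "AE t in lborel. (t \<in> ?S \<longrightarrow> h t = 0) \<longleftrightarrow>
      (case t of (x, y, z) \<Rightarrow> x \<in> {0..1} \<and> y \<in> {0..1} \<and> z \<in> {0..1} \<longrightarrow>
         \<not> (W10 (x, y) > 0 \<and> W10 (y, z) > 0 \<and> W10 (x, z) < 1))"
      using nonsing_AE[OF nonsing_proj12 ae'] nonsing_AE[OF nonsing_proj23 ae']
        nonsing_AE[OF nonsing_proj13 ae']
    proof eventually_elim
      case (elim t)
      obtain x y z where t: "t = (x, y, z)" by (cases t)
      show ?case
      proof (cases "t \<in> ?S")
        case True
        then have xyz: "x \<in> {0..1}" "y \<in> {0..1}" "z \<in> {0..1}" by (auto simp: t unit_sq_def)
        then have sq: "(x, y) \<in> unit_sq" "(y, z) \<in> unit_sq" "(x, z) \<in> unit_sq" by (auto simp: unit_sq_def)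
        then have "A (x, y) = W10 (x, y)" "A (y, z) = W10 (y, z)" "A (x, z) = W10 (x, z)"
          using elim by (auto simp: A_def t)
        then have "h t = W10 (x, y) * W10 (y, z) * (1 - W10 (x, z))" by (simp add: h_def t)
        then show ?thesis using True xyz b(3,4)[OF sq(1)] b(3,4)[OF sq(2)] b(3,4)[OF sq(3)] 
          by (auto simp: t)
      qed (auto simp: t unit_sq_def)
    qed
    then show ?thesis by (intro iffI) (auto elim: eventually_elim2)
  qed
  with C1 C2 P2 show ?thesis by blast
qed

section \<open>Averages over maps into a finite digraph\<close>

text \<open>Expectation under a uniformly random map: for finite nonempty \<open>V\<close> its
  coordinates are independent and uniform on \<open>V\<close>, and densities in finite digraphs
  become probabilities.\<close>

definition avg :: "'a set \<Rightarrow> 'b set \<Rightarrow> (('a \<Rightarrow> 'b) \<Rightarrow> real) \<Rightarrow> real" where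
  "avg K V f = (\<Sum>\<phi>\<in>K \<rightarrow>\<^sub>E V. f \<phi>) / real (card (K \<rightarrow>\<^sub>E V))"

lemma avg_cong: "(\<And>\<phi>. \<phi> \<in> K \<rightarrow>\<^sub>E V \<Longrightarrow> f \<phi> = g \<phi>) \<Longrightarrow> avg K V f = avg K V g"
  by (simp add: avg_def cong: sum.cong)

lemma avg_of_bool:
  assumes "finite K" "finite V"
  shows "avg K V (\<lambda>\<phi>. of_bool (P \<phi>)) = real (card {\<phi> \<in> K \<rightarrow>\<^sub>E V. P \<phi>}) / real (card (K \<rightarrow>\<^sub>E V))"
  using assms by (simp add: avg_def sum_of_bool_eq finite_PiE Int_def)

lemma avg_mono: "(\<And>\<phi>. \<phi> \<in> K \<rightarrow>\<^sub>E V \<Longrightarrow> f \<phi> \<le> g \<phi>) \<Longrightarrow> avg K V f \<le> avg K V g"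
  unfolding avg_def by (intro divide_right_mono sum_mono) auto

lemma avg_nonneg: "(\<And>\<phi>. \<phi> \<in> K \<rightarrow>\<^sub>E V \<Longrightarrow> 0 \<le> f \<phi>) \<Longrightarrow> 0 \<le> avg K V f"
  unfolding avg_def by (intro divide_nonneg_nonneg sum_nonneg) auto

lemma avg_add: "avg K V (\<lambda>\<phi>. f \<phi> + g \<phi>) = avg K V f + avg K V g"
  by (simp add: avg_def sum.distrib add_divide_distrib)

lemma avg_diff: "avg K V (\<lambda>\<phi>. f \<phi> - g \<phi>) = avg K V f - avg K V g"
  by (simp add: avg_def sum_subtractf diff_divide_distrib)

lemma avg_cmult: "avg K V (\<lambda>\<phi>. c * f \<phi>) = c * avg K V f"
  by (simp add: avg_def flip: sum_distrib_left)

lemma avg_multc: "avg K V (\<lambda>\<phi>. f \<phi> * c) = avg K V f * c"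
  using avg_cmult[of K V c f] by (simp add: mult.commute)

lemma avg_sum: "avg K V (\<lambda>\<phi>. \<Sum>i\<in>I. f i \<phi>) = (\<Sum>i\<in>I. avg K V (f i))"
  unfolding avg_def by (subst sum.swap) (simp add: sum_divide_distrib)

lemma avg_swap: "avg K V (\<lambda>\<phi>. avg L W (f \<phi>)) = avg L W (\<lambda>\<psi>. avg K V (\<lambda>\<phi>. f \<phi> \<psi>))"
  unfolding avg_def by (subst sum_divide_distrib[symmetric], subst sum.swap) (simp add: sum_divide_distrib mult.commute)

lemma avg_const:
  assumes "finite K" "finite V" "V \<noteq> {}"
  shows "avg K V (\<lambda>_. c) = c"
  using assms by (simp add: avg_def card_PiE)

lemma avg_less_imp_ex:
  assumes "avg K V f < c" "finite K" "finite V" "V \<noteq> {}"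
  shows "\<exists>\<phi>\<in>K \<rightarrow>\<^sub>E V. f \<phi> < c"
proof (rule ccontr)
  assume "\<not> ?thesis"
  then have "avg K V (\<lambda>_. c) \<le> avg K V f" by (intro avg_mono) (auto simp: not_less)
  then show False using assms by (simp add: avg_const)
qed

text \<open>Independence of disjoint blocks of coordinates. The functions \<open>f'\<close> and
  \<open>g'\<close> express that each factor depends on its own block only; \<open>merge\<close>
  inverts the restriction to the two blocks.\<close>

lemma avg_prod:
  assumes "A \<inter> B = {}"
    and f: "\<And>\<phi>. \<phi> \<in> A \<union> B \<rightarrow>\<^sub>E V \<Longrightarrow> f \<phi> = f' (restrict \<phi> A)"
    and g: "\<And>\<phi>. \<phi> \<in> A \<union> B \<rightarrow>\<^sub>E V \<Longrightarrow> g \<phi> = g' (restrict \<phi> B)"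
    and "finite A" "finite B"
  shows "avg (A \<union> B) V (\<lambda>\<phi>. f \<phi> * g \<phi>) = avg A V f' * avg B V g'"
proof -
  have "(\<Sum>\<phi>\<in>A \<union> B \<rightarrow>\<^sub>E V. f \<phi> * g \<phi>)
      = (\<Sum>(a, b)\<in>(A \<rightarrow>\<^sub>E V) \<times> (B \<rightarrow>\<^sub>E V). f' a * g' b)"
  proof (rule sum.reindex_bij_witness[where i = "merge A B" and j = "\<lambda>\<phi>. (restrict \<phi> A, restrict \<phi> B)"])
    fix \<phi> assume "\<phi> \<in> A \<union> B \<rightarrow>\<^sub>E V"
    then show "merge A B (restrict \<phi> A, restrict \<phi> B) = \<phi>"
      by (auto simp: merge_def PiE_iff extensional_def fun_eq_iff)
  next
    fix p assume p: "p \<in> (A \<rightarrow>\<^sub>E V) \<times> (B \<rightarrow>\<^sub>E V)"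
    then obtain a b where ab: "p = (a, b)" "a \<in> A \<rightarrow>\<^sub>E V" "b \<in> B \<rightarrow>\<^sub>E V" by auto
    have "x \<notin> A" if "x \<in> B" for x using that \<open>A \<inter> B = {}\<close> by auto
    then have "restrict (merge A B p) A = a" "restrict (merge A B p) B = b"
      using ab by (auto simp: merge_def PiE_iff extensional_def fun_eq_iff)
    then show "(restrict (merge A B p) A, restrict (merge A B p) B) = p" by (simp add: ab)
    show "merge A B p \<in> A \<union> B \<rightarrow>\<^sub>E V"
      using ab by (auto simp: merge_def PiE_iff extensional_def)
  qed (auto simp: f g)
  also have "\<dots> = (\<Sum>a\<in>A \<rightarrow>\<^sub>E V. f' a) * (\<Sum>b\<in>B \<rightarrow>\<^sub>E V. g' b)"
    by (simp add: sum_product sum.cartesian_product)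
  finally show ?thesis
    using assms by (simp add: avg_def card_PiE card_Un_disjoint power_add)
qed

text \<open>Marginalisation: the coordinates outside the image of \<xi> average out. Injectivity
  matters, since a repeated coordinate would not give a uniform map on \<open>M\<close>.\<close>

lemma avg_pull:
  assumes K: "finite K" and V: "finite V" "V \<noteq> {}" and xi: "inj_on \<xi> M" "\<xi> ` M \<subseteq> K"
    and f: "\<And>\<phi>. \<phi> \<in> K \<rightarrow>\<^sub>E V \<Longrightarrow> f \<phi> = g (\<lambda>i\<in>M. \<phi> (\<xi> i))"
  shows "avg K V f = avg M V g"
proof -
  have K': "K = \<xi> ` M \<union> (K - \<xi> ` M)" using xi by blast
  have fin: "finite M" "finite (\<xi> ` M)"
    using finite_subset[OF xi(2) K] finite_imageD[OF _ xi(1)] by auto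
  have "avg K V f = avg (\<xi> ` M \<union> (K - \<xi> ` M)) V (\<lambda>\<phi>. f \<phi> * 1)"
    using K' by simp
  also have "\<dots> = avg (\<xi> ` M) V (\<lambda>\<phi>. g (\<lambda>i\<in>M. \<phi> (\<xi> i))) * avg (K - \<xi> ` M) V (\<lambda>_. 1)"
  proof (rule avg_prod)
    fix \<phi> assume "\<phi> \<in> \<xi> ` M \<union> (K - \<xi> ` M) \<rightarrow>\<^sub>E V"
    then have "f \<phi> = g (\<lambda>i\<in>M. \<phi> (\<xi> i))" using f K' by metis
    also have "(\<lambda>i\<in>M. \<phi> (\<xi> i)) = (\<lambda>i\<in>M. restrict \<phi> (\<xi> ` M) (\<xi> i))" by (auto simp: restrict_def)
    finally show "f \<phi> = g (\<lambda>i\<in>M. restrict \<phi> (\<xi> ` M) (\<xi> i))" .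
  qed (use K fin in auto)
  also have "\<dots> = avg (\<xi> ` M) V (\<lambda>\<phi>. g (\<lambda>i\<in>M. \<phi> (\<xi> i)))"
    using avg_const[of "K - \<xi> ` M" V 1] K V by simp
  also have "\<dots> = avg M V g"
  proof -
    have "(\<Sum>\<phi>\<in>\<xi> ` M \<rightarrow>\<^sub>E V. g (\<lambda>i\<in>M. \<phi> (\<xi> i))) = (\<Sum>\<psi>\<in>M \<rightarrow>\<^sub>E V. g \<psi>)"
    proof (rule sum.reindex_bij_witness[where j = "\<lambda>\<phi>. \<lambda>i\<in>M. \<phi> (\<xi> i)"
          and i = "\<lambda>\<psi>. \<lambda>x\<in>\<xi> ` M. \<psi> (the_inv_into M \<xi> x)"])
      fix \<phi> assume "\<phi> \<in> \<xi> ` M \<rightarrow>\<^sub>E V"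
      then show "(\<lambda>x\<in>\<xi> ` M. (\<lambda>i\<in>M. \<phi> (\<xi> i)) (the_inv_into M \<xi> x)) = \<phi>"
        using xi by (auto simp: PiE_iff extensional_def fun_eq_iff the_inv_into_f_f)
    qed (use xi in \<open>auto simp: PiE_iff extensional_def fun_eq_iff the_inv_into_f_f\<close>)
    then show ?thesis using fin xi by (simp add: avg_def card_PiE card_image)
  qed
  finally show ?thesis .
qed

lemma avg_coord1:
  assumes "finite K" "finite V" "V \<noteq> {}" "a \<in> K"
  shows "avg K V (\<lambda>\<phi>. f (\<phi> a)) = avg {0..<1::nat} V (\<lambda>\<phi>. f (\<phi> 0))"
  by (rule avg_pull[where \<xi> = "\<lambda>_. a"]) (use assms in \<open>auto simp: inj_on_def\<close>)

lemma avg_coord2: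
  assumes "finite K" "finite V" "V \<noteq> {}" "a \<in> K" "b \<in> K" "a \<noteq> b"
  shows "avg K V (\<lambda>\<phi>. f (\<phi> a) (\<phi> b)) = avg {0..<2::nat} V (\<lambda>\<phi>. f (\<phi> 0) (\<phi> 1))"
  by (rule avg_pull[where \<xi> = "\<lambda>i. if i = 0 then a else b"])
     (use assms in \<open>auto simp: inj_on_def less_2_cases_iff\<close>)

lemma avg_coord3:
  assumes "finite K" "finite V" "V \<noteq> {}" "a \<in> K" "b \<in> K" "c \<in> K" "a \<noteq> b" "a \<noteq> c" "b \<noteq> c"
  shows "avg K V (\<lambda>\<phi>. f (\<phi> a) (\<phi> b) (\<phi> c)) = avg {0..<3::nat} V (\<lambda>\<phi>. f (\<phi> 0) (\<phi> 1) (\<phi> 2))"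
  by (rule avg_pull[where \<xi> = "\<lambda>i. if i = 0 then a else if i = 1 then b else c"])
     (use assms in \<open>auto simp: inj_on_def\<close>)

lemma avg_eq_const:
  assumes "finite K" "finite V" "c \<in> V" "i \<in> K"
  shows "avg K V (\<lambda>\<phi>. of_bool (\<phi> i = c)) = 1 / real (card V)"
proof -
  have "V \<noteq> {}" using assms by auto
  then have "avg K V (\<lambda>\<phi>. of_bool (\<phi> i = c)) = avg {0..<1::nat} V (\<lambda>\<phi>. of_bool (\<phi> 0 = c))"
    using assms by (intro avg_coord1)
  moreover have "(\<Sum>\<phi>\<in>{0..<1::nat} \<rightarrow>\<^sub>E V. of_bool (\<phi> 0 = c) :: real) = (\<Sum>v\<in>V. of_bool (v = c))"
    by (rule sum.reindex_bij_witness[where i = "\<lambda>v. \<lambda>_\<in>{0..<1}. v" and j = "\<lambda>\<phi>. \<phi> 0"])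
       (auto simp: PiE_iff extensional_def fun_eq_iff)
  ultimately show ?thesis using assms by (simp add: avg_def card_PiE)
qed

text \<open>Summing over the common value \<open>c\<close> gives \<open>card V\<close> terms, each a
  product of two independent probabilities \<open>1 / card V\<close>.\<close>

lemma avg_eq_coords:
  assumes "finite K" "finite V" "V \<noteq> {}" "i \<in> K" "j \<in> K" "i \<noteq> j"
  shows "avg K V (\<lambda>\<phi>. of_bool (\<phi> i = \<phi> j)) = 1 / real (card V)"
proof -
  have "avg K V (\<lambda>\<phi>. of_bool (\<phi> i = \<phi> j)) = avg K V (\<lambda>\<phi>. \<Sum>c\<in>V. of_bool (\<phi> i = c) * of_bool (\<phi> j = c))"
  proof (rule avg_cong)
    fix \<phi> assume "\<phi> \<in> K \<rightarrow>\<^sub>E V"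
    then have "\<phi> i \<in> V" using assms by auto
    have "(\<Sum>c\<in>V. of_bool (\<phi> i = c) * of_bool (\<phi> j = c) :: real)
        = (\<Sum>c\<in>V. if c = \<phi> i then of_bool (\<phi> i = \<phi> j) else 0)"
      by (rule sum.cong) auto
    then show "of_bool (\<phi> i = \<phi> j) = (\<Sum>c\<in>V. of_bool (\<phi> i = c) * of_bool (\<phi> j = c) :: real)"
      using \<open>\<phi> i \<in> V\<close> assms by simp
  qed
  also have "\<dots> = (\<Sum>c\<in>V. avg K V (\<lambda>\<phi>. of_bool (\<phi> i = c) * of_bool (\<phi> j = c)))"
    by (rule avg_sum)
  also have "\<dots> = (\<Sum>c\<in>V. 1 / real (card V) * (1 / real (card V)))"
  proof (rule sum.cong[OF refl])
    fix c assume c: "c \<in> V"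
    have K: "K = {i} \<union> (K - {i})" using assms by auto
    have "avg ({i} \<union> (K - {i})) V (\<lambda>\<phi>. of_bool (\<phi> i = c) * of_bool (\<phi> j = c))
       = avg {i} V (\<lambda>\<phi>. of_bool (\<phi> i = c)) * avg (K - {i}) V (\<lambda>\<phi>. of_bool (\<phi> j = c))"
      by (rule avg_prod) (use assms in auto)
    then show "avg K V (\<lambda>\<phi>. of_bool (\<phi> i = c) * of_bool (\<phi> j = c)) = 1 / real (card V) * (1 / real (card V))"
      using K c assms by (simp add: avg_eq_const)
  qed
  also have "\<dots> = 1 / real (card V)" using assms by (simp add: field_simps)
  finally show ?thesis .
qed

section \<open>Densities of small patterns as averages\<close>

definition homs :: "dg \<Rightarrow> dg \<Rightarrow> (nat \<Rightarrow> nat) \<Rightarrow> bool" where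
  "homs F G \<phi> \<longleftrightarrow> (\<forall>(i, j)\<in>snd F. (\<phi> i, \<phi> j) \<in> snd G)"

lemma hom_dens_avg: "hom_dens F G = avg {0..<fst F} {0..<fst G} (\<lambda>\<phi>. of_bool (homs F G \<phi>))"
  by (simp add: hom_dens_def avg_of_bool homs_def)

lemma homs_cong:
  assumes "wf_dg F" "\<And>i. i < fst F \<Longrightarrow> \<phi> i = \<psi> i"
  shows "homs F G \<phi> \<longleftrightarrow> homs F G \<psi>"
  unfolding homs_def using assms by (intro ball_cong) (auto simp: wf_dg_def)

lemma fst_dgs: "fst C1 = 1" "fst C2 = 2" "fst C3 = 3" "fst P2 = 3" "fst T3 = 3"
  by (simp_all add: C1_def C2_def C3_def P2_def T3_def)

lemma homs_C1: "homs C1 G \<phi> \<longleftrightarrow> (\<phi> 0, \<phi> 0) \<in> snd G" by (simp add: homs_def C1_def)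
lemma homs_C2: "homs C2 G \<phi> \<longleftrightarrow> (\<phi> 0, \<phi> 1) \<in> snd G \<and> (\<phi> 1, \<phi> 0) \<in> snd G" by (simp add: homs_def C2_def)
lemma homs_C3: "homs C3 G \<phi> \<longleftrightarrow> (\<phi> 0, \<phi> 1) \<in> snd G \<and> (\<phi> 1, \<phi> 2) \<in> snd G \<and> (\<phi> 2, \<phi> 0) \<in> snd G"
  by (simp add: homs_def C3_def)
lemma homs_P2: "homs P2 G \<phi> \<longleftrightarrow> (\<phi> 0, \<phi> 1) \<in> snd G \<and> (\<phi> 1, \<phi> 2) \<in> snd G"
  by (simp add: homs_def P2_def)
lemma homs_T3: "homs T3 G \<phi> \<longleftrightarrow> (\<phi> 0, \<phi> 1) \<in> snd G \<and> (\<phi> 1, \<phi> 2) \<in> snd G \<and> (\<phi> 0, \<phi> 2) \<in> snd G"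
  by (simp add: homs_def T3_def)

definition loop :: "dg \<Rightarrow> nat \<Rightarrow> bool" where "loop G u \<longleftrightarrow> (u, u) \<in> snd G"
definition cyc :: "dg \<Rightarrow> nat \<Rightarrow> nat \<Rightarrow> bool" where "cyc G u v \<longleftrightarrow> (u, v) \<in> snd G \<and> (v, u) \<in> snd G"
definition open_path :: "dg \<Rightarrow> nat \<Rightarrow> nat \<Rightarrow> nat \<Rightarrow> bool" where
  "open_path G u v z \<longleftrightarrow> (u, v) \<in> snd G \<and> (v, z) \<in> snd G \<and> (u, z) \<notin> snd G"
definition cyc3 :: "dg \<Rightarrow> nat \<Rightarrow> nat \<Rightarrow> nat \<Rightarrow> bool" where
  "cyc3 G u v z \<longleftrightarrow> (u, v) \<in> snd G \<and> (v, z) \<in> snd G \<and> (z, u) \<in> snd G"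

lemma all_less_2: "(\<forall>i<2. P i) \<longleftrightarrow> P 0 \<and> P (1::nat)"
  by (auto simp: less_2_cases_iff)

lemma all_less_3: "(\<forall>i<3. P i) \<longleftrightarrow> P 0 \<and> P 1 \<and> P (2::nat)"
proof -
  have "n < 3 \<longleftrightarrow> n = 0 \<or> n = 1 \<or> n = 2" for n :: nat by auto
  then show ?thesis by auto
qed

text \<open>Union bound over ordered pairs of distinct indices, each colliding with probability
  \<open>1 / v\<close>; \<open>n^2\<close> is a crude bound for their number.\<close>

lemma avg_not_inj:
  assumes "v \<ge> 1"
  shows "avg {0..<n} {0..<v} (\<lambda>\<phi>. of_bool (\<not> inj_on \<phi> {0..<n})) \<le> (real n)\<^sup>2 / real (v)"
proof -
  let ?S = "{(i, j). i < n \<and> j < n \<and> i \<noteq> j}"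
  have S: "?S \<subseteq> {0..<n} \<times> {0..<n}" by auto
  have fS: "finite ?S" and cS: "card ?S \<le> n * n"
    using finite_subset[OF S] card_mono[OF _ S] by auto
  have "avg {0..<n} {0..<v} (\<lambda>\<phi>. of_bool (\<not> inj_on \<phi> {0..<n}))
     \<le> avg {0..<n} {0..<v} (\<lambda>\<phi>. \<Sum>p\<in>?S. of_bool (\<phi> (fst p) = \<phi> (snd p)))"
  proof (rule avg_mono)
    fix \<phi> :: "nat \<Rightarrow> nat"
    show "of_bool (\<not> inj_on \<phi> {0..<n}) \<le> (\<Sum>p\<in>?S. of_bool (\<phi> (fst p) = \<phi> (snd p)) :: real)"
    proof (cases "inj_on \<phi> {0..<n}")
      case False
      then obtain i j where "(i, j) \<in> ?S" "\<phi> i = \<phi> j" by (auto simp: inj_on_def)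
      then have "1 \<le> (\<Sum>p\<in>?S. of_bool (\<phi> (fst p) = \<phi> (snd p)) :: real)"
        using member_le_sum[of "(i, j)" ?S "\<lambda>p. of_bool (\<phi> (fst p) = \<phi> (snd p)) :: real"] fS by simp
      then show ?thesis by simp
    qed (simp add: sum_nonneg)
  qed
  also have "\<dots> = (\<Sum>p\<in>?S. 1 / real (v))"
    unfolding avg_sum
  proof (rule sum.cong[OF refl])
    fix p assume "p \<in> ?S"
    then show "avg {0..<n} {0..<v} (\<lambda>\<phi>. of_bool (\<phi> (fst p) = \<phi> (snd p))) = 1 / real (v)"
      using avg_eq_coords[of "{0..<n}" "{0..<v}" "fst p" "snd p"] assms by auto
  qed
  also have "\<dots> \<le> (real n)\<^sup>2 / real (v)"
  proof -
    have "real (card ?S) \<le> (real n)\<^sup>2" using cS by (simp add: power2_eq_square flip: of_nat_mult)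
    then show ?thesis by (simp add: divide_right_mono)
  qed
  finally show ?thesis .
qed

context
  fixes G :: dg
  assumes G: "wf_dg G"
begin

lemma verts: "finite {0..<fst G}" "{0..<fst G} \<noteq> {}"
  using G by (auto simp: wf_dg_def)

lemma avg_loop:
  assumes "finite K" "a \<in> K"
  shows "avg K {0..<fst G} (\<lambda>\<phi>. of_bool (loop G (\<phi> a))) = hom_dens C1 G"
proof -
  have "hom_dens C1 G = avg {0..<1::nat} {0..<fst G} (\<lambda>\<phi>. of_bool (loop G (\<phi> 0)))"
    by (simp only: hom_dens_avg homs_C1 loop_def fst_dgs)
  then show ?thesis
    using avg_coord1[OF assms(1) verts assms(2), of "\<lambda>u. of_bool (loop G u)"] by metis
qed

lemma avg_cyc:
  assumes "finite K" "a \<in> K" "b \<in> K" "a \<noteq> b"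
  shows "avg K {0..<fst G} (\<lambda>\<phi>. of_bool (cyc G (\<phi> a) (\<phi> b))) = hom_dens C2 G"
proof -
  have "hom_dens C2 G = avg {0..<2::nat} {0..<fst G} (\<lambda>\<phi>. of_bool (cyc G (\<phi> 0) (\<phi> 1)))"
    by (simp only: hom_dens_avg homs_C2 cyc_def fst_dgs)
  then show ?thesis
    using avg_coord2[OF assms(1) verts assms(2-4), of "\<lambda>u v. of_bool (cyc G u v)"] by simp
qed

lemma avg_cyc3:
  assumes "finite K" "a \<in> K" "b \<in> K" "c \<in> K" "a \<noteq> b" "a \<noteq> c" "b \<noteq> c"
  shows "avg K {0..<fst G} (\<lambda>\<phi>. of_bool (cyc3 G (\<phi> a) (\<phi> b) (\<phi> c))) = hom_dens C3 G"
proof -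
  have "hom_dens C3 G = avg {0..<3::nat} {0..<fst G} (\<lambda>\<phi>. of_bool (cyc3 G (\<phi> 0) (\<phi> 1) (\<phi> 2)))"
    by (simp only: hom_dens_avg homs_C3 cyc3_def fst_dgs)
  then show ?thesis
    using avg_coord3[OF assms(1) verts assms(2-7), of "\<lambda>u v w. of_bool (cyc3 G u v w)"] by simp
qed

lemma avg_open_path:
  assumes "finite K" "a \<in> K" "b \<in> K" "c \<in> K" "a \<noteq> b" "a \<noteq> c" "b \<noteq> c"
  shows "avg K {0..<fst G} (\<lambda>\<phi>. of_bool (open_path G (\<phi> a) (\<phi> b) (\<phi> c))) = hom_dens P2 G - hom_dens T3 G"
proof -
  have "hom_dens P2 G - hom_dens T3 G
     = avg {0..<3::nat} {0..<fst G} (\<lambda>\<phi>. of_bool (homs P2 G \<phi>) - of_bool (homs T3 G \<phi>))"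
    by (simp only: hom_dens_avg avg_diff fst_dgs)
  also have "\<dots> = avg {0..<3::nat} {0..<fst G} (\<lambda>\<phi>. of_bool (open_path G (\<phi> 0) (\<phi> 1) (\<phi> 2)))"
    by (rule avg_cong) (auto simp: homs_P2 homs_T3 open_path_def)
  finally show ?thesis
    using avg_coord3[OF assms(1) verts assms(2-7), of "\<lambda>u v w. of_bool (open_path G u v w)"] by simp
qed

section \<open>Induced densities against homomorphism densities\<close>

lemma hom_dens_nonneg: "0 \<le> hom_dens F G"
  unfolding hom_dens_avg by (rule avg_nonneg) simp

lemma hom_dens_T3_le_P2: "hom_dens T3 G \<le> hom_dens P2 G"
  using avg_open_path[of "{0..<3::nat}" 0 1 2]
    avg_nonneg[of "{0..<3::nat}" "{0..<fst G}" "\<lambda>\<phi>. of_bool (open_path G (\<phi> 0) (\<phi> 1) (\<phi> 2))"] by simp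

text \<open>Injectivity is dropped on purpose: this is a plain average, whereas
  \<open>ind_dens\<close> is a conditional probability.\<close>

definition ind_prob :: "dg \<Rightarrow> real" where
  "ind_prob F = avg {0..<fst F} {0..<fst G}
     (\<lambda>\<phi>. of_bool (\<forall>i<fst F. \<forall>j<fst F. (i, j) \<in> snd F \<longleftrightarrow> (\<phi> i, \<phi> j) \<in> snd G))"

text \<open>With \<open>b\<close> the probability of injectivity and \<open>a\<close> that of an
  injective induced map, \<open>ind_dens\<close> is \<open>a / b\<close>. Both \<open>a / b\<close>
  and \<open>ind_prob F\<close> lie between \<open>a\<close> and \<open>a + (1 - b)\<close>, and
  \<open>1 - b\<close> is a collision probability.\<close>

lemma ind_dens_approx: "\<bar>ind_dens F G - ind_prob F\<bar> \<le> (real (fst F))\<^sup>2 / real (fst G)"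
proof -
  let ?n = "fst F" and ?v = "fst G"
  let ?ind = "\<lambda>\<phi>. \<forall>i<?n. \<forall>j<?n. (i, j) \<in> snd F \<longleftrightarrow> (\<phi> i, \<phi> j) \<in> snd G"
  let ?av = "avg {0..<?n} {0..<?v}"
  define a where "a = ?av (\<lambda>\<phi>. of_bool (inj_on \<phi> {0..<?n} \<and> ?ind \<phi>))"
  define b where "b = ?av (\<lambda>\<phi>. of_bool (inj_on \<phi> {0..<?n}))"
  have v: "?v \<ge> 1" using G by (simp add: wf_dg_def)
  have one: "?av (\<lambda>_. 1) = 1" by (rule avg_const) (use verts in auto)
  have p0: "0 \<le> ind_prob F" "ind_prob F \<le> 1"
    using avg_mono[of "{0..<?n}" "{0..<?v}" "\<lambda>\<phi>. of_bool (?ind \<phi>)" "\<lambda>_. 1"] one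
    by (auto simp: ind_prob_def intro: avg_nonneg)
  have b1: "1 - b = ?av (\<lambda>\<phi>. of_bool (\<not> inj_on \<phi> {0..<?n}))"
  proof -
    have "1 - b = ?av (\<lambda>_. 1) - b" by (simp only: one)
    also have "\<dots> = ?av (\<lambda>\<phi>. 1 - of_bool (inj_on \<phi> {0..<?n}))" unfolding b_def by (rule avg_diff[symmetric])
    also have "\<dots> = ?av (\<lambda>\<phi>. of_bool (\<not> inj_on \<phi> {0..<?n}))" by (rule avg_cong) simp
    finally show ?thesis .
  qed
  have bb: "1 - b \<le> (real ?n)\<^sup>2 / real ?v" using avg_not_inj[OF v, of ?n] b1 by simp
  have b0: "0 \<le> b" "b \<le> 1" using b1 avg_nonneg[of "{0..<?n}" "{0..<?v}" "\<lambda>\<phi>. of_bool (\<not> inj_on \<phi> {0..<?n})"]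
    by (auto simp: b_def intro: avg_nonneg)
  have ap: "a \<le> ind_prob F" unfolding a_def ind_prob_def by (rule avg_mono) auto
  have ab: "a \<le> b" unfolding a_def b_def by (rule avg_mono) auto
  have a0: "0 \<le> a" unfolding a_def by (rule avg_nonneg) auto
  have pa: "ind_prob F \<le> a + (1 - b)"
    unfolding a_def b1 ind_prob_def avg_add[symmetric] by (rule avg_mono) auto
  show ?thesis
  proof (cases "?n > ?v")
    case True
    \<comment> \<open>When \<open>F\<close> has more vertices than \<open>G\<close>, the density is
      0 by definition and the claimed bound is at least 1.\<close>
    have "real ?v \<le> real ?n" using True by simp
    also have "\<dots> \<le> (real ?n)\<^sup>2" using True v by (intro self_le_power) auto
    finally have "1 \<le> (real ?n)\<^sup>2 / real ?v" using v by (simp add: le_divide_eq)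
    then show ?thesis using True p0 by (simp add: ind_dens_def)
  next
    case False
    let ?N = "real (card ({0..<?n} \<rightarrow>\<^sub>E {0..<?v}))"
    have "?N > 0" using v by (simp add: card_PiE)
    moreover have "ind_dens F G = (a * ?N) / (b * ?N)"
      using False \<open>?N > 0\<close> by (simp add: ind_dens_def a_def b_def avg_of_bool)
    ultimately have "ind_dens F G = a / b" by simp
    moreover have "\<bar>a / b - ind_prob F\<bar> \<le> 1 - b"
    proof (cases "b = 0")
      case True
      then show ?thesis using p0 by simp
    next
      case False
      then have "b > 0" using b0 by simp
      then have q: "a / b \<le> 1" "0 \<le> a / b" using ab a0 by auto
      have "a / b - a = a / b * (1 - b)" using \<open>b > 0\<close> by (simp add: field_simps)
      moreover have "a / b * (1 - b) \<le> 1 * (1 - b)" using q b0 by (intro mult_right_mono) auto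
      moreover have "0 \<le> a / b * (1 - b)" using q b0 by (intro mult_nonneg_nonneg) auto
      ultimately have "0 \<le> a / b - a" "a / b - a \<le> 1 - b" by auto
      then show ?thesis using ap pa by linarith
    qed
    ultimately show ?thesis using bb by simp
  qed
qed

text \<open>A digraph that is not a poset has a loop or, if it has none, edges
  \<open>i -> j -> l\<close> without \<open>i -> l\<close>. In the second case consecutive vertices
  differ, and either \<open>i = l\<close> gives a 2-cycle or the three vertices are distinct and
  form an open path. An induced map carries the witness into \<open>G\<close>.\<close>

lemma ind_prob_not_poset:
  assumes F: "wf_dg F" "\<not> is_poset F"
  shows "ind_prob F \<le> hom_dens C1 G + hom_dens C2 G + (hom_dens P2 G - hom_dens T3 G)"
proof -
  let ?n = "fst F"
  have nn: "0 \<le> hom_dens C1 G" "0 \<le> hom_dens C2 G" "0 \<le> hom_dens P2 G - hom_dens T3 G"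
    using hom_dens_nonneg hom_dens_T3_le_P2 by auto
  consider (loop) i where "(i, i) \<in> snd F"
    | (path) i j l where "\<forall>i. (i, i) \<notin> snd F" "(i, j) \<in> snd F" "(j, l) \<in> snd F" "(i, l) \<notin> snd F"
    using F unfolding is_poset_def trans_def by blast
  then show ?thesis
  proof cases
    case loop
    then have i: "i < ?n" using F by (auto simp: wf_dg_def)
    have "ind_prob F \<le> avg {0..<?n} {0..<fst G} (\<lambda>\<phi>. of_bool (loop G (\<phi> i)))"
      unfolding ind_prob_def by (rule avg_mono) (use loop i in \<open>auto simp: loop_def\<close>)
    then show ?thesis using avg_loop[of "{0..<?n}" i] i nn by simp
  next
    case path
    then have lt: "i < ?n" "j < ?n" "l < ?n" and ne: "i \<noteq> j" "j \<noteq> l" using F by (auto simp: wf_dg_def)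
    show ?thesis
    proof (cases "i = l")
      case True
      have "ind_prob F \<le> avg {0..<?n} {0..<fst G} (\<lambda>\<phi>. of_bool (cyc G (\<phi> i) (\<phi> j)))"
        unfolding ind_prob_def by (rule avg_mono) (use path lt True in \<open>auto simp: cyc_def\<close>)
      then show ?thesis using avg_cyc[of "{0..<?n}" i j] lt ne nn by simp
    next
      case False
      have "ind_prob F \<le> avg {0..<?n} {0..<fst G} (\<lambda>\<phi>. of_bool (open_path G (\<phi> i) (\<phi> j) (\<phi> l)))"
        unfolding ind_prob_def by (rule avg_mono) (use path lt in \<open>auto simp: open_path_def\<close>)
      then show ?thesis using avg_open_path[of "{0..<?n}" i j l] lt ne False nn by simp
    qed
  qed
qed

lemma ind_prob_C1: "ind_prob C1 = hom_dens C1 G"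
  using avg_loop[of "{0..<1::nat}" 0] by (simp add: ind_prob_def C1_def loop_def)

text \<open>A 2-cycle that is not induced has a loop at one of the two chosen vertices, whence the
  factor 2. Maps that identify the two vertices are covered too, since their 2-cycle is a
  loop.\<close>

lemma ind_prob_C2: "ind_prob C2 \<le> hom_dens C2 G" "hom_dens C2 G \<le> ind_prob C2 + 2 * hom_dens C1 G"
proof -
  let ?av = "avg {0..<2::nat} {0..<fst G}"
  let ?ind = "\<lambda>\<phi>. \<forall>i<2. \<forall>j<2. (i, j) \<in> snd C2 \<longleftrightarrow> (\<phi> i, \<phi> j) \<in> snd G"
  have ip: "ind_prob C2 = ?av (\<lambda>\<phi>. of_bool (?ind \<phi>))" by (simp add: ind_prob_def C2_def)
  have c: "?av (\<lambda>\<phi>. of_bool (cyc G (\<phi> 0) (\<phi> 1))) = hom_dens C2 G" by (rule avg_cyc) auto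
  show "ind_prob C2 \<le> hom_dens C2 G"
    unfolding ip c[symmetric] by (rule avg_mono) (auto simp: cyc_def C2_def all_less_2)
  have "hom_dens C2 G \<le> ?av (\<lambda>\<phi>. of_bool (?ind \<phi>) + of_bool (loop G (\<phi> 0)) + of_bool (loop G (\<phi> 1)))"
    unfolding c[symmetric] by (rule avg_mono) (auto simp: cyc_def loop_def C2_def all_less_2)
  then show "hom_dens C2 G \<le> ind_prob C2 + 2 * hom_dens C1 G"
    unfolding avg_add ip[symmetric] by (simp add: avg_loop)
qed

text \<open>The extra edges that spoil an induced 3-cycle are three possible loops and three
  reversed edges, each reversal creating a 2-cycle.\<close>

lemma ind_prob_C3: "ind_prob C3 \<le> hom_dens C3 G"
  "hom_dens C3 G \<le> ind_prob C3 + 3 * hom_dens C1 G + 3 * hom_dens C2 G"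
proof -
  let ?av = "avg {0..<3::nat} {0..<fst G}"
  let ?ind = "\<lambda>\<phi>. \<forall>i<3. \<forall>j<3. (i, j) \<in> snd C3 \<longleftrightarrow> (\<phi> i, \<phi> j) \<in> snd G"
  have ip: "ind_prob C3 = ?av (\<lambda>\<phi>. of_bool (?ind \<phi>))" by (simp add: ind_prob_def C3_def)
  have c: "?av (\<lambda>\<phi>. of_bool (cyc3 G (\<phi> 0) (\<phi> 1) (\<phi> 2))) = hom_dens C3 G" by (rule avg_cyc3) auto
  show "ind_prob C3 \<le> hom_dens C3 G"
    unfolding ip c[symmetric] by (rule avg_mono) (auto simp: cyc3_def C3_def all_less_3)
  have "hom_dens C3 G \<le> ?av (\<lambda>\<phi>. of_bool (?ind \<phi>)
       + of_bool (loop G (\<phi> 0)) + of_bool (loop G (\<phi> 1)) + of_bool (loop G (\<phi> 2))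
       + of_bool (cyc G (\<phi> 0) (\<phi> 1)) + of_bool (cyc G (\<phi> 0) (\<phi> 2)) + of_bool (cyc G (\<phi> 1) (\<phi> 2)))"
    unfolding c[symmetric]
    by (rule avg_mono) (auto simp: cyc3_def cyc_def loop_def C3_def all_less_3)
  then show "hom_dens C3 G \<le> ind_prob C3 + 3 * hom_dens C1 G + 3 * hom_dens C2 G"
    unfolding avg_add ip[symmetric] by (simp add: avg_loop avg_cyc)
qed

text \<open>In an open path the edge from the first to the last vertex is absent. The possible extra
  edges are three loops, the reversals of the two path edges, and the edge from the last to the
  first vertex, which closes a 3-cycle.\<close>

lemma ind_prob_P2: "ind_prob P2 \<le> hom_dens P2 G - hom_dens T3 G"
  "hom_dens P2 G - hom_dens T3 G \<le> ind_prob P2 + 3 * hom_dens C1 G + 2 * hom_dens C2 G + hom_dens C3 G"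
proof -
  let ?av = "avg {0..<3::nat} {0..<fst G}"
  let ?ind = "\<lambda>\<phi>. \<forall>i<3. \<forall>j<3. (i, j) \<in> snd P2 \<longleftrightarrow> (\<phi> i, \<phi> j) \<in> snd G"
  have ip: "ind_prob P2 = ?av (\<lambda>\<phi>. of_bool (?ind \<phi>))" by (simp add: ind_prob_def P2_def)
  have c: "?av (\<lambda>\<phi>. of_bool (open_path G (\<phi> 0) (\<phi> 1) (\<phi> 2))) = hom_dens P2 G - hom_dens T3 G"
    by (rule avg_open_path) auto
  show "ind_prob P2 \<le> hom_dens P2 G - hom_dens T3 G"
    unfolding ip c[symmetric] by (rule avg_mono) (auto simp: open_path_def P2_def all_less_3)
  have "hom_dens P2 G - hom_dens T3 G \<le> ?av (\<lambda>\<phi>. of_bool (?ind \<phi>)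
       + of_bool (loop G (\<phi> 0)) + of_bool (loop G (\<phi> 1)) + of_bool (loop G (\<phi> 2))
       + of_bool (cyc G (\<phi> 0) (\<phi> 1)) + of_bool (cyc G (\<phi> 1) (\<phi> 2)) + of_bool (cyc3 G (\<phi> 0) (\<phi> 1) (\<phi> 2)))"
    unfolding c[symmetric]
    by (rule avg_mono) (auto simp: open_path_def cyc3_def cyc_def loop_def P2_def all_less_3)
  then show "hom_dens P2 G - hom_dens T3 G \<le> ind_prob P2 + 3 * hom_dens C1 G + 2 * hom_dens C2 G + hom_dens C3 G"
    unfolding avg_add ip[symmetric] by (simp add: avg_loop avg_cyc avg_cyc3)
qed

section \<open>Sampling \<open>k\<close> vertices of \<open>G\<close> with replacement\<close>

definition pull :: "nat \<Rightarrow> (nat \<Rightarrow> nat) \<Rightarrow> dg" where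
  "pull k \<phi> = (k, {(a, b). a < k \<and> b < k \<and> (\<phi> a, \<phi> b) \<in> snd G})"

lemma pull_edge: "(a, b) \<in> snd (pull k \<phi>) \<longleftrightarrow> a < k \<and> b < k \<and> (\<phi> a, \<phi> b) \<in> snd G"
  by (simp add: pull_def)

text \<open>Union bound over indices, pairs and triples, with the same three witnesses as in
  \<open>ind_prob_not_poset\<close>. Only distinct indices have to be counted, and their images are
  independent uniform vertices.\<close>

lemma avg_pull_not_poset:
  assumes k: "k \<ge> 1"
  shows "avg {0..<k} {0..<fst G} (\<lambda>\<phi>. of_bool (\<not> is_poset (pull k \<phi>)))
     \<le> real k * hom_dens C1 G + (real k)^2 * hom_dens C2 G + (real k)^3 * (hom_dens P2 G - hom_dens T3 G)"
proof -
  let ?K = "{0..<k}"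
  let ?av = "avg ?K {0..<fst G}"
  let ?L = "\<lambda>\<phi>. \<Sum>a\<in>?K. of_bool (loop G (\<phi> a)) :: real"
  let ?C = "\<lambda>\<phi>. \<Sum>a\<in>?K. \<Sum>b\<in>?K. of_bool (a \<noteq> b \<and> cyc G (\<phi> a) (\<phi> b)) :: real"
  let ?O = "\<lambda>\<phi>. \<Sum>a\<in>?K. \<Sum>b\<in>?K. \<Sum>c\<in>?K.
      of_bool (a \<noteq> b \<and> a \<noteq> c \<and> b \<noteq> c \<and> open_path G (\<phi> a) (\<phi> b) (\<phi> c)) :: real"
  have nn: "0 \<le> hom_dens C1 G" "0 \<le> hom_dens C2 G" "0 \<le> hom_dens P2 G - hom_dens T3 G"
    using hom_dens_nonneg hom_dens_T3_le_P2 by auto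
  have "?av (\<lambda>\<phi>. of_bool (\<not> is_poset (pull k \<phi>))) \<le> ?av (\<lambda>\<phi>. ?L \<phi> + ?C \<phi> + ?O \<phi>)"
  proof (rule avg_mono)
    fix \<phi> :: "nat \<Rightarrow> nat"
    have nn': "0 \<le> ?L \<phi>" "0 \<le> ?C \<phi>" "0 \<le> ?O \<phi>" by (auto intro!: sum_nonneg)
    show "of_bool (\<not> is_poset (pull k \<phi>)) \<le> ?L \<phi> + ?C \<phi> + ?O \<phi>"
    proof (cases "is_poset (pull k \<phi>)")
      case False
      have "wf_dg (pull k \<phi>)" using k by (auto simp: wf_dg_def pull_def)
      with False consider (loop) a where "a < k" "loop G (\<phi> a)"
        | (path) a b c where "\<forall>a<k. \<not> loop G (\<phi> a)" "a < k" "b < k" "c < k"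
             "(\<phi> a, \<phi> b) \<in> snd G" "(\<phi> b, \<phi> c) \<in> snd G" "(\<phi> a, \<phi> c) \<notin> snd G"
        unfolding is_poset_def trans_def pull_edge loop_def by blast
      then have "1 \<le> ?L \<phi> \<or> 1 \<le> ?C \<phi> \<or> 1 \<le> ?O \<phi>"
      proof cases
        case loop
        then show ?thesis
          using member_le_sum[of a ?K "\<lambda>a. of_bool (loop G (\<phi> a)) :: real"] by simp
      next
        case path
        then have ne: "a \<noteq> b" "b \<noteq> c" by (auto simp: loop_def)
        show ?thesis
        proof (cases "a = c")
          case True
          have "1 \<le> (\<Sum>b\<in>?K. of_bool (a \<noteq> b \<and> cyc G (\<phi> a) (\<phi> b)) :: real)"
            using member_le_sum[of b ?K "\<lambda>b. of_bool (a \<noteq> b \<and> cyc G (\<phi> a) (\<phi> b)) :: real"] path ne True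
            by (simp add: cyc_def)
          also have "\<dots> \<le> ?C \<phi>"
            using path(2) by (intro member_le_sum[of a ?K "\<lambda>a. \<Sum>b\<in>?K. of_bool (a \<noteq> b \<and> cyc G (\<phi> a) (\<phi> b)) :: real"])
              (auto intro: sum_nonneg)
          finally show ?thesis by simp
        next
          case False
          let ?f = "\<lambda>a b c. of_bool (a \<noteq> b \<and> a \<noteq> c \<and> b \<noteq> c \<and> open_path G (\<phi> a) (\<phi> b) (\<phi> c)) :: real"
          have "1 \<le> (\<Sum>c\<in>?K. ?f a b c)"
            using member_le_sum[of c ?K "?f a b"] path ne False by (simp add: open_path_def)
          also have "\<dots> \<le> (\<Sum>b\<in>?K. \<Sum>c\<in>?K. ?f a b c)"
            using path(3) by (intro member_le_sum[of b ?K "\<lambda>b. \<Sum>c\<in>?K. ?f a b c"]) (auto intro: sum_nonneg)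
          also have "\<dots> \<le> ?O \<phi>"
            using path(2) by (intro member_le_sum[of a ?K "\<lambda>a. \<Sum>b\<in>?K. \<Sum>c\<in>?K. ?f a b c"]) (auto intro!: sum_nonneg)
          finally show ?thesis by simp
        qed
      qed
      then show ?thesis using nn' False by auto
    qed (use nn' in simp)
  qed
  also have "\<dots> = (\<Sum>a\<in>?K. ?av (\<lambda>\<phi>. of_bool (loop G (\<phi> a))))
      + (\<Sum>a\<in>?K. \<Sum>b\<in>?K. ?av (\<lambda>\<phi>. of_bool (a \<noteq> b \<and> cyc G (\<phi> a) (\<phi> b))))
      + (\<Sum>a\<in>?K. \<Sum>b\<in>?K. \<Sum>c\<in>?K.
          ?av (\<lambda>\<phi>. of_bool (a \<noteq> b \<and> a \<noteq> c \<and> b \<noteq> c \<and> open_path G (\<phi> a) (\<phi> b) (\<phi> c))))"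
    by (simp only: avg_add avg_sum)
  also have "\<dots> \<le> (\<Sum>a\<in>?K. hom_dens C1 G) + (\<Sum>a\<in>?K. \<Sum>b\<in>?K. hom_dens C2 G)
      + (\<Sum>a\<in>?K. \<Sum>b\<in>?K. \<Sum>c\<in>?K. (hom_dens P2 G - hom_dens T3 G))"
  proof (intro add_mono sum_mono)
    fix a b assume ab: "a \<in> ?K" "b \<in> ?K"
    show "?av (\<lambda>\<phi>. of_bool (a \<noteq> b \<and> cyc G (\<phi> a) (\<phi> b))) \<le> hom_dens C2 G"
      using avg_cyc[of ?K a b] ab nn avg_const[of ?K "{0..<fst G}" 0] verts by (cases "a = b") auto
    fix c assume c: "c \<in> ?K"
    show "?av (\<lambda>\<phi>. of_bool (a \<noteq> b \<and> a \<noteq> c \<and> b \<noteq> c \<and> open_path G (\<phi> a) (\<phi> b) (\<phi> c)))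
        \<le> hom_dens P2 G - hom_dens T3 G"
      using avg_open_path[of ?K a b c] ab c nn avg_const[of ?K "{0..<fst G}" 0] verts
      by (cases "a = b \<or> a = c \<or> b = c") auto
  qed (simp add: avg_loop)
  also have "\<dots> = real k * hom_dens C1 G + (real k)^2 * hom_dens C2 G + (real k)^3 * (hom_dens P2 G - hom_dens T3 G)"
    by (simp add: power2_eq_square power3_eq_cube mult.assoc)
  finally show ?thesis .
qed

text \<open>Along an injective \<psi> the composition \<open>\<phi> \<circ> \<psi>\<close> is again
  a uniformly random map. Non-injective \<psi> are one source of the error in
  \<open>avg_hom_dens_pull\<close>.\<close>

lemma avg_homs_comp:
  assumes F: "wf_dg F" and psi: "inj_on \<psi> {0..<fst F}" "\<psi> ` {0..<fst F} \<subseteq> K" and K: "finite K"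
  shows "avg K {0..<fst G} (\<lambda>\<phi>. of_bool (homs F G (\<lambda>i. \<phi> (\<psi> i)))) = hom_dens F G"
  unfolding hom_dens_avg
proof (rule avg_pull[OF K verts psi])
  fix \<phi>
  show "of_bool (homs F G (\<lambda>i. \<phi> (\<psi> i))) = (of_bool (homs F G (\<lambda>i\<in>{0..<fst F}. \<phi> (\<psi> i))) :: real)"
    using homs_cong[OF F, of "\<lambda>i. \<phi> (\<psi> i)" "\<lambda>i\<in>{0..<fst F}. \<phi> (\<psi> i)"] by simp
qed

text \<open>The deviation is an average of \<open>X \<phi> \<psi>\<close> over maps \<psi>, so its
  square is an average over pairs of maps. The three bad events, namely that the first map is not
  injective, that the second is not, or that their images meet, have probability at most
  \<open>n^2 / k\<close> each with \<open>n = fst F\<close>, whence the constant 3. The centre is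
  the density in \<open>G\<close>, not the mean density of the sample, so the bias from
  non-injective maps is included.\<close>

lemma avg_hom_dens_pull:
  assumes F: "wf_dg F" and k: "k \<ge> 1"
  shows "avg {0..<k} {0..<fst G} (\<lambda>\<phi>. (hom_dens F (pull k \<phi>) - hom_dens F G)\<^sup>2) \<le> 3 * (real (fst F))\<^sup>2 / real k"
proof -
  let ?n = "fst F" and ?N = "{0..<fst F}" and ?K = "{0..<k}" and ?V = "{0..<fst G}"
  let ?t = "hom_dens F G"
  have K: "finite ?K" "?K \<noteq> {}" using k by auto
  define X where "X \<phi> \<psi> = of_bool (homs F G (\<lambda>i. \<phi> (\<psi> i))) - ?t" for \<phi> \<psi> :: "nat \<Rightarrow> nat"
  have t: "0 \<le> ?t" "?t \<le> 1"
  proof -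
    have "?t \<le> avg ?N ?V (\<lambda>_. 1)" unfolding hom_dens_avg by (rule avg_mono) simp
    then show "?t \<le> 1" using avg_const[of ?N ?V 1] verts by simp
  qed (rule hom_dens_nonneg)
  have X1: "X \<phi> \<psi> * X \<phi> \<psi>' \<le> 1" for \<phi> \<psi> \<psi>'
  proof -
    have "\<bar>X \<phi> \<psi>\<bar> \<le> 1" "\<bar>X \<phi> \<psi>'\<bar> \<le> 1" using t by (auto simp: X_def)
    then have "\<bar>X \<phi> \<psi>\<bar> * \<bar>X \<phi> \<psi>'\<bar> \<le> 1" by (intro mult_le_one) auto
    then show ?thesis by (simp flip: abs_mult)
  qed
  have pull: "hom_dens F (pull k \<phi>) - ?t = avg ?N ?K (X \<phi>)" for \<phi>
  proof -
    have "hom_dens F (pull k \<phi>) = avg ?N ?K (\<lambda>\<psi>. of_bool (homs F (pull k \<phi>) \<psi>))"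
      unfolding hom_dens_avg by (simp add: pull_def)
    also have "\<dots> = avg ?N ?K (\<lambda>\<psi>. of_bool (homs F G (\<lambda>i. \<phi> (\<psi> i))))"
    proof (rule avg_cong)
      fix \<psi> assume "\<psi> \<in> ?N \<rightarrow>\<^sub>E ?K"
      then have "\<psi> i < k" if "i < ?n" for i using that by (auto simp: PiE_iff)
      then show "of_bool (homs F (pull k \<phi>) \<psi>) = (of_bool (homs F G (\<lambda>i. \<phi> (\<psi> i))) :: real)"
        using F unfolding homs_def wf_dg_def pull_edge
        by (intro arg_cong[where f = of_bool] ball_cong) auto
    qed
    finally show ?thesis
      using avg_const[of ?N ?K ?t] K unfolding X_def avg_diff by simp
  qed
  let ?bad = "\<lambda>\<psi> \<psi>'. of_bool (\<not> inj_on \<psi> ?N) + of_bool (\<not> inj_on \<psi>' ?N)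
      + (\<Sum>i\<in>?N. \<Sum>j\<in>?N. of_bool (\<psi>' j = \<psi> i)) :: real"
  \<comment> \<open>The two factors are independent and centred unless the images of the two maps collide.\<close>
  have cov: "avg ?K ?V (\<lambda>\<phi>. X \<phi> \<psi> * X \<phi> \<psi>') \<le> ?bad \<psi> \<psi>'"
    if psi: "\<psi> \<in> ?N \<rightarrow>\<^sub>E ?K" "\<psi>' \<in> ?N \<rightarrow>\<^sub>E ?K" for \<psi> \<psi>'
  proof (cases "inj_on \<psi> ?N \<and> inj_on \<psi>' ?N \<and> \<psi> ` ?N \<inter> \<psi>' ` ?N = {}")
    case True
    \<comment> \<open>The second block is the whole complement of the first image: it contains the
      image of \<open>\<psi>'\<close>, and the two blocks exhaust \<open>?K\<close>.\<close>
    let ?A = "\<psi> ` ?N" and ?B = "?K - \<psi> ` ?N"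
    have AB: "?A \<union> ?B = ?K" "\<psi>' ` ?N \<subseteq> ?B" using psi True by auto
    have "avg (?A \<union> ?B) ?V (\<lambda>\<phi>. X \<phi> \<psi> * X \<phi> \<psi>') = avg ?A ?V (\<lambda>\<phi>. X \<phi> \<psi>) * avg ?B ?V (\<lambda>\<phi>. X \<phi> \<psi>')"
    proof (rule avg_prod)
      show "X \<phi> \<psi> = X (restrict \<phi> ?A) \<psi>" for \<phi>
        unfolding X_def using homs_cong[OF F, of "\<lambda>i. \<phi> (\<psi> i)" "\<lambda>i. restrict \<phi> ?A (\<psi> i)"] by simp
      show "X \<phi> \<psi>' = X (restrict \<phi> ?B) \<psi>'" for \<phi>
      proof -
        have "\<psi>' i \<in> ?B" if "i < ?n" for i using AB(2) that by (meson atLeastLessThan_iff imageI le0 subsetD)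
        then have "homs F G (\<lambda>i. \<phi> (\<psi>' i)) \<longleftrightarrow> homs F G (\<lambda>i. restrict \<phi> ?B (\<psi>' i))"
          by (intro homs_cong[OF F]) (simp only: restrict_apply')
        then show ?thesis by (simp add: X_def)
      qed
    qed auto
    \<comment> \<open>One centred factor is enough: the product vanishes whatever the other average
      is.\<close>
    also have "avg ?A ?V (\<lambda>\<phi>. X \<phi> \<psi>) = 0"
      unfolding X_def avg_diff using avg_homs_comp[OF F, of \<psi> ?A] True avg_const[of ?A ?V ?t] verts by simp
    finally show ?thesis using AB(1) by (simp add: sum_nonneg)
  next
    case False
    have "1 \<le> ?bad \<psi> \<psi>'"
    proof (cases "inj_on \<psi> ?N \<and> inj_on \<psi>' ?N")
      case True
      with False obtain x where "x \<in> \<psi> ` ?N" "x \<in> \<psi>' ` ?N" by blast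
      then obtain i j where ij: "i \<in> ?N" "j \<in> ?N" "\<psi>' j = \<psi> i" unfolding image_iff by force
      have "1 \<le> (\<Sum>j\<in>?N. of_bool (\<psi>' j = \<psi> i) :: real)"
        using member_le_sum[of j ?N "\<lambda>j. of_bool (\<psi>' j = \<psi> i) :: real"] ij by simp
      also have "\<dots> \<le> (\<Sum>i\<in>?N. \<Sum>j\<in>?N. of_bool (\<psi>' j = \<psi> i))"
        using ij(1) by (intro member_le_sum[of i ?N "\<lambda>i. \<Sum>j\<in>?N. of_bool (\<psi>' j = \<psi> i) :: real"]) (auto intro: sum_nonneg)
      finally show ?thesis using True by simp
    next
      case False
      moreover have "0 \<le> (\<Sum>i\<in>?N. \<Sum>j\<in>?N. of_bool (\<psi>' j = \<psi> i) :: real)" by (intro sum_nonneg) simp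
      ultimately show ?thesis by auto
    qed
    moreover have "avg ?K ?V (\<lambda>\<phi>. X \<phi> \<psi> * X \<phi> \<psi>') \<le> avg ?K ?V (\<lambda>_. 1)"
      by (rule avg_mono) (rule X1)
    ultimately show ?thesis using avg_const[of ?K ?V 1] verts by simp
  qed
  have "avg ?K ?V (\<lambda>\<phi>. (hom_dens F (pull k \<phi>) - ?t)\<^sup>2)
     = avg ?K ?V (\<lambda>\<phi>. avg ?N ?K (\<lambda>\<psi>. avg ?N ?K (\<lambda>\<psi>'. X \<phi> \<psi> * X \<phi> \<psi>')))"
    unfolding pull power2_eq_square by (simp only: avg_cmult avg_multc)
  \<comment> \<open>Moving the average over \<phi> inside turns the double average into the
    quantities bounded by \<open>cov\<close>.\<close>
  also have "\<dots> = avg ?N ?K (\<lambda>\<psi>. avg ?N ?K (\<lambda>\<psi>'. avg ?K ?V (\<lambda>\<phi>. X \<phi> \<psi> * X \<phi> \<psi>')))"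
    by (subst avg_swap) (subst avg_swap[of ?K ?V], rule refl)
  also have "\<dots> \<le> avg ?N ?K (\<lambda>\<psi>. avg ?N ?K (\<lambda>\<psi>'. ?bad \<psi> \<psi>'))"
    by (intro avg_mono cov)
  also have "\<dots> = avg ?N ?K (\<lambda>\<psi>. of_bool (\<not> inj_on \<psi> ?N)) + avg ?N ?K (\<lambda>\<psi>. of_bool (\<not> inj_on \<psi> ?N))
      + (\<Sum>i\<in>?N. \<Sum>j\<in>?N. avg ?N ?K (\<lambda>\<psi>. avg ?N ?K (\<lambda>\<psi>'. of_bool (\<psi>' j = \<psi> i))))"
    by (simp only: avg_add avg_sum avg_const[OF _ K] finite_atLeastLessThan)
  also have "(\<Sum>i\<in>?N. \<Sum>j\<in>?N. avg ?N ?K (\<lambda>\<psi>. avg ?N ?K (\<lambda>\<psi>'. of_bool (\<psi>' j = \<psi> i)))) = (\<Sum>i\<in>?N. \<Sum>j\<in>?N. 1 / real k)"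
  proof (intro sum.cong refl)
    fix i j assume ij: "i \<in> ?N" "j \<in> ?N"
    have "avg ?N ?K (\<lambda>\<psi>. avg ?N ?K (\<lambda>\<psi>'. of_bool (\<psi>' j = \<psi> i))) = avg ?N ?K (\<lambda>_. 1 / real k)"
    proof (rule avg_cong)
      fix \<psi> assume "\<psi> \<in> ?N \<rightarrow>\<^sub>E ?K"
      then show "avg ?N ?K (\<lambda>\<psi>'. of_bool (\<psi>' j = \<psi> i)) = 1 / real k"
        using ij by (subst avg_eq_const) auto
    qed
    then show "avg ?N ?K (\<lambda>\<psi>. avg ?N ?K (\<lambda>\<psi>'. of_bool (\<psi>' j = \<psi> i))) = 1 / real k"
      using avg_const[of ?N ?K "1 / real k"] K by simp
  qed
  also have "(\<Sum>i\<in>?N. \<Sum>j\<in>?N. 1 / real k) = (real ?n)\<^sup>2 / real k" by (simp add: power2_eq_square)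
  finally show ?thesis using avg_not_inj[OF k, of ?n] by simp
qed

end

section \<open>Lebesgue density in the plane\<close>

text \<open>Vitali covering: every bad point is the centre of arbitrarily small balls that stay in
  an open \<open>U\<close> around \<open>A\<close> and have more than the fraction \<open>e\<close>
  outside \<open>A\<close>. Disjoint balls of this kind cover the bad points up to a null set, and
  their total measure is at most that of \<open>U - A\<close> divided by \<open>e\<close>, which is
  arbitrarily small.\<close>

lemma lebesgue_density_cball:
  fixes A :: "'a::euclidean_space set"
  assumes A: "A \<in> sets lebesgue" and e: "e > 0"
  shows "negligible {x \<in> A. \<forall>d>0. \<exists>r. 0 < r \<and> r < d \<and> measure lebesgue (cball x r - A) > e * measure lebesgue (cball x r)}"
proof -
  define B where "B = {x \<in> A. \<forall>d>0. \<exists>r. 0 < r \<and> r < d \<and> measure lebesgue (cball x r - A) > e * measure lebesgue (cball x r)}"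
  have "negligible B"
    unfolding negligible_outer_le
  proof (intro allI impI)
    fix \<eta> :: real assume "\<eta> > 0"
    let ?\<mu> = "measure lebesgue"
    \<comment> \<open>The factor \<open>e\<close> cancels when the parts outside \<open>A\<close>
      are replaced by whole balls, which leaves the bound \<eta>.\<close>
    obtain U where U: "open U" "A \<subseteq> U" "U - A \<in> lmeasurable" "emeasure lebesgue (U - A) < ennreal (e * \<eta>)"
      using sets_lebesgue_outer_open[OF A, of "e * \<eta>"] e \<open>\<eta> > 0\<close> by auto
    have UA: "?\<mu> (U - A) \<le> e * \<eta>"
      using U(3,4) e \<open>\<eta> > 0\<close> by (simp add: emeasure_eq_measure2 ennreal_less_iff)
    define K where "K = {(x, r). x \<in> B \<and> 0 < r \<and> cball x r \<subseteq> U \<and> ?\<mu> (cball x r - A) > e * ?\<mu> (cball x r)}"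
    have Vit: "\<exists>i. i \<in> K \<and> x \<in> cball (fst i) (snd i) \<and> snd i < d" if "x \<in> B" "0 < d" for x d
    proof -
      have "x \<in> U" using that(1) U(2) by (auto simp: B_def)
      then obtain d' where d': "d' > 0" "cball x d' \<subseteq> U"
        using U(1) open_contains_cball by blast
      have "min d d' > 0" using that d'(1) by simp
      with that(1) have "\<exists>r. 0 < r \<and> r < min d d' \<and> ?\<mu> (cball x r - A) > e * ?\<mu> (cball x r)"
        unfolding B_def by blast
      then obtain r where r: "0 < r" "r < min d d'" "?\<mu> (cball x r - A) > e * ?\<mu> (cball x r)"
        by blast
      then have "cball x r \<subseteq> U" using d'(2) subset_cball[of r d' x] by auto
      then show ?thesis using r that by (intro exI[of _ "(x, r)"]) (auto simp: K_def)
    qed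
    have Kpos: "0 < snd i" if "i \<in> K" for i using that by (auto simp: K_def)
    obtain C where C: "countable C" "C \<subseteq> K"
       "pairwise (\<lambda>i j. disjnt (cball (fst i) (snd i)) (cball (fst j) (snd j))) C"
       "negligible (B - (\<Union>i\<in>C. cball (fst i) (snd i)))"
      using Kpos Vit by (rule Vitali_covering_theorem_cballs)
    have fin: "(\<Sum>i\<in>D. ?\<mu> (cball (fst i) (snd i))) \<le> \<eta>" if D: "D \<subseteq> C" "finite D" for D
    proof -
      have "e * (\<Sum>i\<in>D. ?\<mu> (cball (fst i) (snd i))) \<le> (\<Sum>i\<in>D. ?\<mu> (cball (fst i) (snd i) - A))"
        unfolding sum_distrib_left using D C(2) by (intro sum_mono) (auto simp: K_def)
      also have "\<dots> = ?\<mu> (\<Union>i\<in>D. cball (fst i) (snd i) - A)"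
      proof (rule measure_UNION'[symmetric])
        show "finite D" by fact
        show "cball (fst i) (snd i) - A \<in> lmeasurable" for i :: "'a \<times> real"
          using A by (intro fmeasurable_Diff) auto
        show "pairwise (\<lambda>i j. disjnt (cball (fst i) (snd i) - A) (cball (fst j) (snd j) - A)) D"
          using C(3) D(1) unfolding pairwise_def disjnt_def by blast
      qed
      also have "\<dots> \<le> ?\<mu> (U - A)"
      proof (rule measure_mono_fmeasurable)
        show "(\<Union>i\<in>D. cball (fst i) (snd i) - A) \<subseteq> U - A" using D C(2) by (force simp: K_def)
        show "(\<Union>i\<in>D. cball (fst i) (snd i) - A) \<in> sets lebesgue" using D A by (auto intro!: sets.finite_UN)
      qed (use U in auto)
      finally show ?thesis using UA e by (smt (verit) mult_le_cancel_left_pos)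
    qed
    have *: "(\<Union>i\<in>C. cball (fst i) (snd i)) \<in> lmeasurable" "?\<mu> (\<Union>i\<in>C. cball (fst i) (snd i)) \<le> \<eta>"
    proof -
      have 1: "cball (fst i) (snd i) \<in> lmeasurable" if "i \<in> C" for i by simp
      have 2: "?\<mu> (\<Union>i\<in>D. cball (fst i) (snd i)) \<le> \<eta>" if "D \<subseteq> C" "finite D" for D
        using measure_UNION_le[of D "\<lambda>i. cball (fst i) (snd i)" lebesgue] fin[OF that] that by force
      show "(\<Union>i\<in>C. cball (fst i) (snd i)) \<in> lmeasurable" by (rule fmeasurable_UN_bound[OF C(1) 1 2])
      show "?\<mu> (\<Union>i\<in>C. cball (fst i) (snd i)) \<le> \<eta>" by (rule measure_UN_bound[OF C(1) 1 2])
    qed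
    let ?T = "(\<Union>i\<in>C. cball (fst i) (snd i)) \<union> (B - (\<Union>i\<in>C. cball (fst i) (snd i)))"
    have t1: "?T \<in> lmeasurable" by (rule fmeasurable.Un[OF *(1) negligible_imp_measurable[OF C(4)]])
    have t2: "?\<mu> ?T = ?\<mu> (\<Union>i\<in>C. cball (fst i) (snd i))"
      by (rule measure_Un_null_set[OF fmeasurableD[OF *(1)] C(4)[unfolded negligible_iff_null_sets]])
    have t3: "B \<subseteq> ?T" by blast
    show "\<exists>T. B \<subseteq> T \<and> T \<in> lmeasurable \<and> ?\<mu> T \<le> \<eta>"
      by (intro exI[of _ ?T] conjI t3 t1) (simp only: t2 *(2))
  qed
  then show ?thesis by (simp add: B_def)
qed

definition sqr :: "real \<times> real \<Rightarrow> real \<Rightarrow> (real \<times> real) set" where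
  "sqr p r = {fst p - r..fst p + r} \<times> {snd p - r..snd p + r}"

lemma sqr_eq_cbox: "sqr p r = cbox (fst p - r, snd p - r) (fst p + r, snd p + r)"
  by (simp add: sqr_def cbox_Pair_eq)

lemma sqr_measurable [simp]: "sqr p r \<in> sets borel" "sqr p r \<in> lmeasurable" 
  by (simp_all add: sqr_eq_cbox)

lemma sqr_Diff_measurable [simp]:
  "A \<in> sets borel \<Longrightarrow> sqr p r - A \<in> sets borel"
  "A \<in> sets lebesgue \<Longrightarrow> sqr p r - A \<in> sets lebesgue"
  using sqr_measurable(1) fmeasurableD[OF sqr_measurable(2)] by (blast intro: sets.Diff)+

lemma measure_sqr: "0 \<le> r \<Longrightarrow> measure lborel (sqr p r) = 4 * r\<^sup>2"
  by (simp add: sqr_eq_cbox content_Pair power2_eq_square)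

text \<open>Squares instead of balls, because they are compatible with Fubini in \<open>emeasure_triangle\<close>.\<close>

definition dens :: "(real \<times> real) set \<Rightarrow> real \<times> real \<Rightarrow> bool" where
  "dens A p \<longleftrightarrow> (\<forall>e>0. \<exists>d>0. \<forall>r. 0 < r \<and> r < d \<longrightarrow> measure lebesgue (sqr p r - A) \<le> e * r\<^sup>2)"

lemma sqr_subset_cball: "0 \<le> r \<Longrightarrow> sqr p r \<subseteq> cball p (2 * r)"
proof
  fix q assume r: "0 \<le> r" and q: "q \<in> sqr p r"
  have "dist p q \<le> dist (fst p) (fst q) + dist (snd p) (snd q)"
    by (cases p, cases q) (simp add: dist_Pair_Pair sqrt_sum_squares_le_sum)
  also have "\<dots> \<le> r + r" using q by (intro add_mono) (auto simp: sqr_def dist_real_def)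
  finally show "q \<in> cball p (2 * r)" by simp
qed

lemma cball_subset_sqr: "cball p r \<subseteq> sqr p r"
proof
  fix q assume "q \<in> cball p r"
  then have "dist (fst p) (fst q) \<le> r" "dist (snd p) (snd q) \<le> r"
    using dist_fst_le[of p q] dist_snd_le[of p q] by auto
  then show "q \<in> sqr p r" by (cases q) (auto simp: sqr_def dist_real_def)
qed

text \<open>Balls and squares are comparable up to a fixed factor, so density on balls gives density
  on squares. Testing only the fractions \<open>1 / Suc n\<close> keeps the exceptional set a
  countable union of null sets.\<close>

lemma dens_AE_mem:
  assumes A: "A \<in> sets lebesgue"
  shows "AE p in lborel. p \<in> A \<longrightarrow> dens A p"
proof -
  let ?\<mu> = "measure lebesgue"
  define N where "N n = {x \<in> A. \<forall>d>0. \<exists>r. 0 < r \<and> r < d \<and>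
      ?\<mu> (cball x r - A) > 1 / real (Suc n) * ?\<mu> (cball x r)}" for n
  have "N n \<in> null_sets lebesgue" for n
    using lebesgue_density_cball[OF A, of "1 / real (Suc n)"] by (simp add: N_def negligible_iff_null_sets)
  then have "AE p in lborel. \<forall>n. p \<notin> N n"
    using AE_completion_iff[of "\<lambda>p. \<forall>n. p \<notin> N n" lborel] by (simp add: AE_all_countable AE_not_in)
  then show ?thesis
  proof eventually_elim
    case (elim p)
    show ?case
    proof
      assume p: "p \<in> A"
      show "dens A p" unfolding dens_def
      proof (intro allI impI)
        fix e :: real assume e: "e > 0"
        \<comment> \<open>The square lies in a ball of radius \<open>2 * r\<close>, which lies in a
          square of area \<open>16 * r^2\<close>; hence the constant 16.\<close>
        obtain n where n: "16 / e < real (Suc n)" using reals_Archimedean2[of "16 / e"]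
          by (meson less_trans of_nat_less_iff lessI)
        then have n': "16 / real (Suc n) \<le> e" using e by (simp add: field_simps)
        obtain d where d: "d > 0"
            "\<And>r. 0 < r \<Longrightarrow> r < d \<Longrightarrow> ?\<mu> (cball p r - A) \<le> 1 / real (Suc n) * ?\<mu> (cball p r)"
          using elim[rule_format, of n] p unfolding N_def mem_Collect_eq by (meson not_less)
        show "\<exists>d>0. \<forall>r. 0 < r \<and> r < d \<longrightarrow> ?\<mu> (sqr p r - A) \<le> e * r\<^sup>2"
        proof (intro exI[of _ "d / 2"] conjI allI impI)
          fix r assume r: "0 < r \<and> r < d / 2"
          have "?\<mu> (sqr p r - A) \<le> ?\<mu> (cball p (2 * r) - A)"
            using sqr_subset_cball[of r p] r A
            by (intro measure_mono_fmeasurable fmeasurable_Diff) auto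
          also have "\<dots> \<le> 1 / real (Suc n) * ?\<mu> (cball p (2 * r))" using d(2) r by simp
          also have "\<dots> \<le> 1 / real (Suc n) * ?\<mu> (sqr p (2 * r))"
            using cball_subset_sqr[of p "2 * r"]
            by (intro mult_left_mono measure_mono_fmeasurable) auto
          also have "\<dots> = 16 / real (Suc n) * r\<^sup>2" using r by (simp add: measure_sqr)
          also have "\<dots> \<le> e * r\<^sup>2" using n' by (intro mult_right_mono) auto
          finally show "?\<mu> (sqr p r - A) \<le> e * r\<^sup>2" .
        qed (use d in simp)
      qed
    qed
  qed
qed

lemma dens_mono:
  assumes "A \<subseteq> B" "A \<in> sets lebesgue" "B \<in> sets lebesgue" "dens A p"
  shows "dens B p"
proof -
  have "measure lebesgue (sqr p r - B) \<le> measure lebesgue (sqr p r - A)" for r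
    using assms by (intro measure_mono_fmeasurable fmeasurable_Diff) auto
  then show ?thesis using \<open>dens A p\<close> unfolding dens_def by (meson order_trans)
qed

text \<open>A small square has area \<open>4 * r^2\<close>, but it is covered by its parts outside
  \<open>A\<close> and outside \<open>B\<close>, of area at most \<open>r^2\<close> each, and a null
  set.\<close>

lemma not_dens_disjoint:
  assumes A: "A \<in> sets lebesgue" "B \<in> sets lebesgue" and null: "A \<inter> B \<in> null_sets lebesgue"
    and d: "dens A p" "dens B p"
  shows False
proof -
  let ?\<mu> = "measure lebesgue"
  obtain d1 where d1: "d1 > 0" "\<And>r. 0 < r \<Longrightarrow> r < d1 \<Longrightarrow> ?\<mu> (sqr p r - A) \<le> r\<^sup>2"
    using d(1)[unfolded dens_def, rule_format, of 1] by auto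
  obtain d2 where d2: "d2 > 0" "\<And>r. 0 < r \<Longrightarrow> r < d2 \<Longrightarrow> ?\<mu> (sqr p r - B) \<le> r\<^sup>2"
    using d(2)[unfolded dens_def, rule_format, of 1] by auto
  define r where "r = min d1 d2 / 2"
  have r: "0 < r" "r < d1" "r < d2" using d1 d2 by (auto simp: r_def)
  have "4 * r\<^sup>2 = ?\<mu> (sqr p r)" using r by (simp add: measure_sqr)
  also have "\<dots> \<le> ?\<mu> (((sqr p r - A) \<union> (sqr p r - B)) \<union> A \<inter> B)"
    using A null by (intro measure_mono_fmeasurable fmeasurable.Un fmeasurable_Diff fmeasurableI_null_sets[OF null]) auto
  also have "\<dots> = ?\<mu> ((sqr p r - A) \<union> (sqr p r - B))"
    using A null by (intro measure_Un_null_set) auto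
  also have "\<dots> \<le> ?\<mu> (sqr p r - A) + ?\<mu> (sqr p r - B)"
    using A by (intro measure_Un_le) auto
  also have "\<dots> \<le> r\<^sup>2 + r\<^sup>2" using d1(2)[OF r(1,2)] d2(2)[OF r(1,3)] by (rule add_mono)
  finally show False using r(1) by simp
qed

lemma dens_AE_iff:
  assumes A: "A \<in> sets lebesgue"
  shows "AE p in lborel. dens A p \<longleftrightarrow> p \<in> A"
proof -
  have A': "- A \<in> sets lebesgue" using A by (simp add: Compl_eq_Diff_UNIV sets.Diff)
  show ?thesis using dens_AE_mem[OF A] dens_AE_mem[OF A']
    by eventually_elim (use not_dens_disjoint[OF A A'] in auto)
qed

section \<open>Fubini and the triangle estimate for squares\<close>

lemma nn_integral_lborel_pair:
  fixes f :: "'a::euclidean_space \<times> 'b::euclidean_space \<Rightarrow> ennreal"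
  assumes "f \<in> borel_measurable borel"
  shows "(\<integral>\<^sup>+ t. f t \<partial>lborel) = (\<integral>\<^sup>+ a. \<integral>\<^sup>+ b. f (a, b) \<partial>lborel \<partial>lborel)"
proof -
  have "f \<in> borel_measurable (lborel \<Otimes>\<^sub>M lborel)"
    using assms by (simp only: lborel_prod measurable_lborel2)
  from lborel.nn_integral_fst[OF this, symmetric] show ?thesis by (simp only: lborel_prod)
qed

lemma borel_measurable_Pair_section:
  fixes f :: "'a::euclidean_space \<times> 'b::euclidean_space \<Rightarrow> ennreal"
  assumes "f \<in> borel_measurable borel"
  shows "(\<lambda>b. f (a, b)) \<in> borel_measurable borel"
  by (rule measurable_compose[OF _ assms])
     (rule borel_measurable_continuous_onI, intro continuous_on_Pair continuous_on_const continuous_on_id)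

lemma nn_integral_lborel_triple:
  fixes f :: "real \<times> real \<times> real \<Rightarrow> ennreal"
  assumes "f \<in> borel_measurable borel"
  shows "(\<integral>\<^sup>+ t. f t \<partial>lborel) = (\<integral>\<^sup>+ a. \<integral>\<^sup>+ b. \<integral>\<^sup>+ c. f (a, b, c) \<partial>lborel \<partial>lborel \<partial>lborel)"
  unfolding nn_integral_lborel_pair[OF assms]
  by (rule nn_integral_cong) (rule nn_integral_lborel_pair[OF borel_measurable_Pair_section[OF assms]])

lemma emeasure_lborel_pair:
  fixes N :: "('a::euclidean_space \<times> 'b::euclidean_space) set"
  assumes "N \<in> sets borel"
  shows "emeasure lborel N = (\<integral>\<^sup>+ a. \<integral>\<^sup>+ b. indicator N (a, b) \<partial>lborel \<partial>lborel)"
  using nn_integral_lborel_pair[of "indicator N"] assms by simp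

text \<open>Consider the box of side \<open>2 * r\<close> around \<open>(x, y, z)\<close>. For
  almost every triple in it, a missing \<open>(a, c)\<close> forces \<open>(a, b)\<close> or
  \<open>(b, c)\<close> to be missing. Integration over the box counts each of the three planar sets
  with the length \<open>2 * r\<close> of the free coordinate, so this factor cancels.\<close>

lemma emeasure_triangle:
  fixes E O' :: "(real \<times> real) set"
  assumes E: "E \<in> sets borel" and O': "O' \<in> sets borel"
    and h: "AE t in lborel. case t of (a, b, c) \<Rightarrow> (a, b) \<in> E \<and> (b, c) \<in> E \<longrightarrow> (a, c) \<in> O'"
    and r: "0 < r"
  shows "emeasure lborel (sqr (x, z) r - O') \<le> emeasure lborel (sqr (x, y) r - E) + emeasure lborel (sqr (y, z) r - E)"
proof -
  let ?J = "\<lambda>x. {x - r..x + r}"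
  let ?B = "sqr (x, z) r - O'" and ?N = "sqr (x, y) r - E" and ?N' = "sqr (y, z) r - E"
  have [simp]: "?B \<in> sets borel" "?N \<in> sets borel" "?N' \<in> sets borel" using E O' by auto
  have J: "emeasure lborel (?J x) = ennreal (2 * r)" for x using r by simp
  have sec: "(\<lambda>b. indicator N (a, b) :: ennreal) \<in> borel_measurable borel"
    if "N \<in> sets borel" for N :: "(real \<times> real) set" and a
    by (rule borel_measurable_Pair_section) (use that in simp)
  have sec2: "(\<lambda>a. \<integral>\<^sup>+ b. indicator N (a, b) \<partial>lborel) \<in> borel_measurable borel"
    if "N \<in> sets borel" for N :: "(real \<times> real) set"
  proof -
    have "(indicator N :: _ \<Rightarrow> ennreal) \<in> borel_measurable (lborel \<Otimes>\<^sub>M lborel)"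
      using that by (simp only: lborel_prod measurable_lborel2 borel_measurable_indicator)
    from lborel.borel_measurable_nn_integral_fst[OF this] show ?thesis by simp
  qed
  have m1: "(\<lambda>t. g (f t)) \<in> borel_measurable borel" if "g \<in> borel_measurable borel" "continuous_on UNIV f"
    for g :: "'c::topological_space \<Rightarrow> ennreal" and f :: "real \<times> real \<times> real \<Rightarrow> 'c"
    by (rule measurable_compose[OF borel_measurable_continuous_onI that(1)]) (rule that)
  have cont: "continuous_on UNIV (\<lambda>t :: real \<times> real \<times> real. (fst t, snd (snd t)))"
      "continuous_on UNIV (\<lambda>t :: real \<times> real \<times> real. (fst t, fst (snd t)))"
      "continuous_on UNIV (\<lambda>t :: real \<times> real \<times> real. (fst (snd t), snd (snd t)))"
      "continuous_on UNIV (\<lambda>t :: real \<times> real \<times> real. fst (snd t))"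
      "continuous_on UNIV (\<lambda>t :: real \<times> real \<times> real. snd (snd t))"
      "continuous_on UNIV (\<lambda>t :: real \<times> real \<times> real. fst t)"
    by (intro continuous_intros)+
  have M: "(\<lambda>t. indicator ?B (fst t, snd (snd t)) * indicator (?J y) (fst (snd t)) :: ennreal) \<in> borel_measurable borel"
    "(\<lambda>t. indicator ?N (fst t, fst (snd t)) * indicator (?J z) (snd (snd t)) :: ennreal) \<in> borel_measurable borel"
    "(\<lambda>t. indicator ?N' (fst (snd t), snd (snd t)) * indicator (?J x) (fst t) :: ennreal) \<in> borel_measurable borel"
    by (intro borel_measurable_times_ennreal m1[OF _ cont(1)] m1[OF _ cont(4)] borel_measurable_indicator; simp)
       (intro borel_measurable_times_ennreal m1[OF _ cont(2)] m1[OF _ cont(5)] borel_measurable_indicator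
          m1[OF _ cont(3)] m1[OF _ cont(6)]; simp)+
  have "ennreal (2 * r) * emeasure lborel ?B
     = (\<integral>\<^sup>+ a. \<integral>\<^sup>+ b. \<integral>\<^sup>+ c. indicator ?B (a, c) * indicator (?J y) b \<partial>lborel \<partial>lborel \<partial>lborel)"
    by (simp add: nn_integral_multc nn_integral_cmult sec sec2 emeasure_lborel_pair J mult.commute
        del: emeasure_lborel_Icc emeasure_lborel_Icc_eq)
  also have "\<dots> = (\<integral>\<^sup>+ t. indicator ?B (fst t, snd (snd t)) * indicator (?J y) (fst (snd t)) \<partial>lborel)"
    by (subst nn_integral_lborel_triple) (simp_all only: M fst_conv snd_conv)
  also have "\<dots> \<le> (\<integral>\<^sup>+ t. indicator ?N (fst t, fst (snd t)) * indicator (?J z) (snd (snd t))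
        + indicator ?N' (fst (snd t), snd (snd t)) * indicator (?J x) (fst t) \<partial>lborel)"
    by (rule nn_integral_mono_AE, use h in eventually_elim) (auto simp: sqr_def indicator_def)
  also have "\<dots> = (\<integral>\<^sup>+ t. indicator ?N (fst t, fst (snd t)) * indicator (?J z) (snd (snd t)) \<partial>lborel)
        + (\<integral>\<^sup>+ t. indicator ?N' (fst (snd t), snd (snd t)) * indicator (?J x) (fst t) \<partial>lborel)"
    by (rule nn_integral_add) (simp_all only: M measurable_lborel2)
  also have "(\<integral>\<^sup>+ t. indicator ?N (fst t, fst (snd t)) * indicator (?J z) (snd (snd t)) \<partial>lborel)
     = (\<integral>\<^sup>+ a. \<integral>\<^sup>+ b. \<integral>\<^sup>+ c. indicator ?N (a, b) * indicator (?J z) c \<partial>lborel \<partial>lborel \<partial>lborel)"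
    by (subst nn_integral_lborel_triple) (simp_all only: M fst_conv snd_conv)
  also have "\<dots> = ennreal (2 * r) * emeasure lborel ?N"
    by (simp add: nn_integral_multc nn_integral_cmult sec sec2 emeasure_lborel_pair J mult.commute
        del: emeasure_lborel_Icc emeasure_lborel_Icc_eq)
  also have "(\<integral>\<^sup>+ t. indicator ?N' (fst (snd t), snd (snd t)) * indicator (?J x) (fst t) \<partial>lborel)
     = (\<integral>\<^sup>+ a. \<integral>\<^sup>+ b. \<integral>\<^sup>+ c. indicator ?N' (b, c) * indicator (?J x) a \<partial>lborel \<partial>lborel \<partial>lborel)"
    by (subst nn_integral_lborel_triple) (simp_all only: M fst_conv snd_conv)
  also have "\<dots> = ennreal (2 * r) * emeasure lborel ?N'"
    by (simp add: nn_integral_multc nn_integral_cmult sec sec2 emeasure_lborel_pair J mult.commute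
        del: emeasure_lborel_Icc emeasure_lborel_Icc_eq)
  finally have "ennreal (2 * r) * emeasure lborel ?B \<le> ennreal (2 * r) * (emeasure lborel ?N + emeasure lborel ?N')"
    by (simp add: distrib_left)
  then show ?thesis using r by (subst (asm) ennreal_mult_le_mult_iff) auto
qed

text \<open>Density is tested on squares of positive area, so a hypothesis on almost all triples
  yields a conclusion at every triple. The tolerance is halved between the two given
  squares.\<close>

lemma dens_triangle:
  fixes E O' :: "(real \<times> real) set"
  assumes E: "E \<in> sets borel" and O': "O' \<in> sets borel"
    and h: "AE t in lborel. case t of (a, b, c) \<Rightarrow> (a, b) \<in> E \<and> (b, c) \<in> E \<longrightarrow> (a, c) \<in> O'"
    and d: "dens E (x, y)" "dens E (y, z)"
  shows "dens O' (x, z)"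
  unfolding dens_def
proof (intro allI impI)
  let ?\<mu> = "measure lebesgue"
  fix e :: real assume e: "e > 0"
  obtain d1 where d1: "d1 > 0" "\<And>r. 0 < r \<Longrightarrow> r < d1 \<Longrightarrow> ?\<mu> (sqr (x, y) r - E) \<le> e / 2 * r\<^sup>2"
    using d(1)[unfolded dens_def, rule_format, of "e / 2"] e by auto
  obtain d2 where d2: "d2 > 0" "\<And>r. 0 < r \<Longrightarrow> r < d2 \<Longrightarrow> ?\<mu> (sqr (y, z) r - E) \<le> e / 2 * r\<^sup>2"
    using d(2)[unfolded dens_def, rule_format, of "e / 2"] e by auto
  show "\<exists>d>0. \<forall>r. 0 < r \<and> r < d \<longrightarrow> ?\<mu> (sqr (x, z) r - O') \<le> e * r\<^sup>2"
  proof (intro exI[of _ "min d1 d2"] conjI allI impI)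
    fix r assume r: "0 < r \<and> r < min d1 d2"
    have fm: "sqr p r - A \<in> fmeasurable lborel" if "A \<in> sets borel" for p A
      using that sqr_measurable(2)[of p r] by (intro fmeasurable_Diff) (auto simp: sqr_eq_cbox)
    have "?\<mu> (sqr (x, z) r - O') \<le> ?\<mu> (sqr (x, y) r - E) + ?\<mu> (sqr (y, z) r - E)"
      using emeasure_triangle[OF E O' h, of r x z y] r fm E O' fmeasurableD[OF fm]
      by (simp add: emeasure_eq_measure2 flip: ennreal_plus)
    also have "\<dots> \<le> e / 2 * r\<^sup>2 + e / 2 * r\<^sup>2" using d1 d2 r by (intro add_mono) auto
    finally show "?\<mu> (sqr (x, z) r - O') \<le> e * r\<^sup>2" by simp
  qed (use d1 d2 in simp)
qed

text \<open>Reflection in the diagonal preserves area and maps squares to squares. It is used to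
  compare opposite edges in \<open>strict_representation\<close>.\<close>

lemma dens_swap:
  assumes A: "A \<in> sets borel" and d: "dens A (x, y)"
  shows "dens (prod.swap -` A) (y, x)"
proof -
  have sw: "prod.swap \<in> borel_measurable (borel :: (real \<times> real) measure)"
    by (intro borel_measurable_continuous_onI continuous_on_swap)
  have "measure lebesgue (sqr (y, x) r - prod.swap -` A) = measure lebesgue (sqr (x, y) r - A)" for r
  proof -
    have eq: "sqr (y, x) r - prod.swap -` A = prod.swap -` (sqr (x, y) r - A)"
      by (auto simp: sqr_def)
    have "emeasure lborel (sqr (x, y) r - A) = (\<integral>\<^sup>+ b. \<integral>\<^sup>+ a. indicator (sqr (x, y) r - A) (a, b) \<partial>lborel \<partial>lborel)"
    proof -
      have "(indicator (sqr (x, y) r - A) :: _ \<Rightarrow> ennreal) \<in> borel_measurable (lborel \<Otimes>\<^sub>M lborel)"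
        unfolding lborel_prod measurable_lborel2 by (rule borel_measurable_indicator) (use A in auto)
      from lborel_pair.nn_integral_snd[OF this] show ?thesis
        using nn_integral_indicator[of "sqr (x, y) r - A" lborel] A by (simp add: sets.Diff lborel_prod)
    qed
    also have "\<dots> = emeasure lborel (prod.swap -` (sqr (x, y) r - A))"
      using A measurable_sets[OF sw, of "sqr (x, y) r - A"] by (subst emeasure_lborel_pair) (auto simp: indicator_def)
    finally show ?thesis using A measurable_sets[OF sw, of "sqr (x, y) r - A"] 
      unfolding eq by (simp add: measure_completion measure_def)
  qed
  then show ?thesis using d by (simp add: dens_def)
qed

section \<open>A representation with the poset conditions at every point\<close>

lemma unit_sq_iff: "(x, y) \<in> unit_sq \<longleftrightarrow> x \<in> {0..1} \<and> y \<in> {0..1}"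
  by (simp add: unit_sq_def)

lemma lebesgue_on_AE_cong:
  fixes f g :: "'a::euclidean_space \<Rightarrow> real"
  assumes S: "S \<in> sets borel" and f: "f \<in> borel_measurable (lebesgue_on S)"
    and eq: "AE x in lborel. x \<in> S \<longrightarrow> g x = f x"
  shows "g \<in> borel_measurable (lebesgue_on S)"
proof -
  have S': "S \<inter> space lebesgue \<in> sets lebesgue" using S by simp
  note iff = borel_measurable_restrict_space_iff[OF S']
  have "(\<lambda>x. indicator S x *\<^sub>R f x) \<in> borel_measurable lebesgue" using f unfolding iff .
  then have "(\<lambda>x. indicator S x *\<^sub>R g x) \<in> borel_measurable lebesgue"
    by (rule completion.borel_measurable_AE_cong)
       (rule AE_completion, use eq in eventually_elim, simp add: indicator_def)
  then show ?thesis unfolding iff .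
qed

lemma strict_representation:
  assumes W: "quintuple W00 W01 W10 W11 w"
    and iv1: "AE x in lborel. x \<in> {0..1} \<longrightarrow> w x = 0"
    and iv2: "AE p in lborel. p \<in> unit_sq \<longrightarrow> W11 p = 0"
    and iv3: "AE t in lborel. case t of (x, y, z) \<Rightarrow> x \<in> {0..1} \<and> y \<in> {0..1} \<and> z \<in> {0..1} \<longrightarrow>
         \<not> (W10 (x, y) > 0 \<and> W10 (y, z) > 0 \<and> W10 (x, z) < 1)"
  obtains V00 V01 V10 V11 v where "quintuple V00 V01 V10 V11 v"
    "\<And>F. sub_prob V01 V10 V11 v F = sub_prob W01 W10 W11 w F"
    "\<And>x. v x = 0" "\<And>p. V11 p = 0" "\<And>x. V10 (x, x) = 0"
    "\<And>x y z. x \<in> {0..1} \<Longrightarrow> y \<in> {0..1} \<Longrightarrow> z \<in> {0..1} \<Longrightarrow> V10 (x, y) > 0 \<Longrightarrow> V10 (y, z) > 0 \<Longrightarrow> V10 (x, z) = 1"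
proof -
  have Wm: "W01 \<in> borel_measurable (lebesgue_on unit_sq)" "W10 \<in> borel_measurable (lebesgue_on unit_sq)"
    using W by (auto simp: quintuple_def)
  have Wb: "0 \<le> W10 (x, y)" "W10 (x, y) \<le> 1" "W10 (x, y) + W10 (y, x) \<le> 1" "W01 (x, y) = W10 (y, x)"
    if "(x, y) \<in> unit_sq" for x y
  proof -
    have "W00 (x, y) \<in> {0..1}" "W01 (x, y) \<in> {0..1}" "W10 (x, y) \<in> {0..1}" "W11 (x, y) \<in> {0..1}"
      "W00 (x, y) + W01 (x, y) + W10 (x, y) + W11 (x, y) = 1" "W01 (x, y) = W10 (y, x)"
      using W that unfolding quintuple_def unit_sq_iff by blast+
    then show "0 \<le> W10 (x, y)" "W10 (x, y) \<le> 1" "W10 (x, y) + W10 (y, x) \<le> 1" "W01 (x, y) = W10 (y, x)"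
      by auto
  qed
  obtain g where g: "g \<in> borel_measurable borel" "AE p in lborel. p \<in> unit_sq \<longrightarrow> W10 p = g p"
    using borel_version[OF unit_sq_borel Wm(2)] .
  have g': "AE p in lborel. p \<in> UNIV \<longrightarrow> (p \<in> unit_sq \<longrightarrow> W10 p = g p)" using g(2) by simp
  \<comment> \<open>The sets come from the Borel version \<open>g\<close>, as the Fubini argument
    behind \<open>dens_triangle\<close> works with Borel sets; the intermediate values of the new
    kernel are still those of \<open>W10\<close>.\<close>
  define E where "E = {p \<in> unit_sq. g p > 0}"
  define O1 where "O1 = {p \<in> unit_sq. g p = 1}"
  have E: "E \<in> sets borel" and O1: "O1 \<in> sets borel"
  proof -
    have "g -` {0<..} \<inter> space borel \<in> sets borel" "g -` {1} \<inter> space borel \<in> sets borel"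
      by (rule measurable_sets[OF g(1)], simp)+
    moreover have "E = unit_sq \<inter> (g -` {0<..} \<inter> space borel)" "O1 = unit_sq \<inter> (g -` {1} \<inter> space borel)"
      by (auto simp: E_def O1_def)
    ultimately show "E \<in> sets borel" "O1 \<in> sets borel" by (metis sets.Int unit_sq_borel)+
  qed
  have El: "E \<in> sets lebesgue" and Ol: "O1 \<in> sets lebesgue" using E O1 by (simp_all add: sets_completionI_sets)
  have tri: "AE t in lborel. case t of (a, b, c) \<Rightarrow> (a, b) \<in> E \<and> (b, c) \<in> E \<longrightarrow> (a, c) \<in> O1"
    using iv3 nonsing_AE[OF nonsing_proj12 g'] nonsing_AE[OF nonsing_proj23 g'] nonsing_AE[OF nonsing_proj13 g']
  proof eventually_elim
    case (elim t)
    obtain a b c where t: "t = (a, b, c)" by (cases t)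
    show ?case using elim Wb(2)[of a c] unfolding t E_def O1_def by (force simp: unit_sq_iff)
  qed
  \<comment> \<open>A positive value at \<open>(x, y)\<close> together with the value 1 at
    \<open>(y, x)\<close> would violate \<open>W10 (x, y) + W10 (y, x) \<le> 1\<close>.\<close>
  have disj: "E \<inter> prod.swap -` O1 \<in> null_sets lebesgue"
  proof -
    have "AE p in lborel. p \<notin> E \<inter> prod.swap -` O1"
      using g(2) nonsing_AE[OF nonsing_swap g']
    proof eventually_elim
      case (elim p)
      obtain x y where p: "p = (x, y)" by (cases p)
      show ?case using elim Wb(3)[of x y] unfolding p E_def O1_def by (auto simp: unit_sq_iff)
    qed
    then have "AE p in lebesgue. p \<notin> E \<inter> prod.swap -` O1" by (rule AE_completion)
    then show ?thesis by (simp add: completion.null_sets_iff_AE)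
  qed
  have swO: "prod.swap -` O1 \<in> sets lebesgue"
  proof -
    have "prod.swap \<in> borel_measurable (borel :: (real \<times> real) measure)"
      by (intro borel_measurable_continuous_onI continuous_on_swap)
    from measurable_sets[OF this O1] show ?thesis by (simp add: sets_completionI_sets)
  qed
  have OE: "dens E p" if "dens O1 p" for p
    by (rule dens_mono[OF _ Ol El that]) (auto simp: E_def O1_def)
  have anti: "\<not> dens E (y, x)" if "dens O1 (x, y)" for x y
    using not_dens_disjoint[OF El swO disj _ dens_swap[OF O1 that]] by blast
  have trans: "dens O1 (x, z)" if "dens E (x, y)" "dens E (y, z)" for x y z
    by (rule dens_triangle[OF E O1 tri that])
  \<comment> \<open>The density conditions hold at every point, unlike the conditions on \<open>W10\<close>.\<close>
  define V10 where "V10 p = (if dens O1 p then 1 else if dens E p then W10 p else 0)" for p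
  define V01 where "V01 p = V10 (prod.swap p)" for p
  have V_dens: "dens E p" if "V10 p > 0" for p using that OE by (auto simp: V10_def split: if_splits)
  have ae10: "AE p in lborel. p \<in> unit_sq \<longrightarrow> V10 p = W10 p"
    using dens_AE_iff[OF El] dens_AE_iff[OF Ol] g(2)
  proof eventually_elim
    case (elim p)
    then show ?case using Wb(1)[of "fst p" "snd p"] unfolding V10_def by (auto simp: E_def O1_def)
  qed
  then have "AE p in lborel. p \<in> UNIV \<longrightarrow> (p \<in> unit_sq \<longrightarrow> V10 p = W10 p)" by simp
  from nonsing_AE[OF nonsing_swap this] have ae01: "AE p in lborel. p \<in> unit_sq \<longrightarrow> V01 p = W01 p"
  proof eventually_elim
    case (elim p)
    then show ?case using Wb(4)[of "fst p" "snd p"] by (cases p) (auto simp: V01_def unit_sq_iff)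
  qed
  note Vm = lebesgue_on_AE_cong[OF unit_sq_borel Wm(1) ae01] lebesgue_on_AE_cong[OF unit_sq_borel Wm(2) ae10]
  have Vb: "0 \<le> V10 (x, y)" "V10 (x, y) \<le> 1" "V10 (x, y) + V10 (y, x) \<le> 1"
    if "x \<in> {0..1}" "y \<in> {0..1}" for x y
  proof -
    have b: "0 \<le> W10 (x, y)" "W10 (x, y) \<le> 1" "0 \<le> W10 (y, x)" "W10 (y, x) \<le> 1" "W10 (x, y) + W10 (y, x) \<le> 1"
      using Wb[of x y] Wb[of y x] that by (auto simp: unit_sq_iff)
    then show "0 \<le> V10 (x, y)" "V10 (x, y) \<le> 1" by (auto simp: V10_def)
    \<comment> \<open>If one of the two points is a density point of \<open>O1\<close>, the other is
      not one of \<open>E\<close> and has value 0; otherwise both values are bounded by those of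
      \<open>W10\<close>.\<close>
    show "V10 (x, y) + V10 (y, x) \<le> 1"
      using b anti[of x y] anti[of y x] OE[of "(x, y)"] OE[of "(y, x)"] by (auto simp: V10_def)
  qed
  have V01_pair: "V01 (x, y) = V10 (y, x)" for x y by (simp add: V01_def)
  let ?V00 = "\<lambda>p. 1 - V10 p - V01 p"
  have V: "quintuple ?V00 V01 V10 (\<lambda>_. 0) (\<lambda>_. 0)"
    unfolding quintuple_def
  proof (intro conjI ballI)
    fix x y :: real assume xy: "x \<in> {0..1}" "y \<in> {0..1}"
    note b = Vb[OF xy] Vb[OF xy(2,1)]
    show "?V00 (x, y) \<in> {0..1}" "V01 (x, y) \<in> {0..1}" "V10 (x, y) \<in> {0..1}"
      using b by (auto simp: V01_def)
  qed (use Vm in \<open>auto simp: V01_pair intro: borel_measurable_diff\<close>)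
  have eq: "sub_prob V01 V10 (\<lambda>_. 0) (\<lambda>_. 0) F = sub_prob W01 W10 W11 w F" for F
    by (rule sub_prob_cong_AE[OF V W])
       (use iv1 iv2 ae01 ae10 in \<open>auto elim: eventually_mono\<close>)
  show thesis
  proof (rule that[OF V eq])
    \<comment> \<open>If \<open>(x, x)\<close> were a density point of \<open>E\<close>, then
      \<open>trans\<close> for the triple \<open>x, x, x\<close> would make it one of
      \<open>O1\<close>, contradicting \<open>anti\<close>.\<close>
    show "V10 (x, x) = 0" for x
      using anti[of x x] trans[of x x x] OE[of "(x, x)"] by (auto simp: V10_def)
    show "V10 (x, z) = 1" if "V10 (x, y) > 0" "V10 (y, z) > 0" for x y z
      using trans[OF V_dens[OF that(1)] V_dens[OF that(2)]] by (simp add: V10_def)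
  qed auto
qed

section \<open>Digraph limits\<close>

text \<open>Equal densities of \<open>P2\<close> and \<open>T3\<close> mean that almost no path of length two lacks its closing
  edge. Unlike induced densities, these are coordinates of the embedding.\<close>

definition poset_like :: "(dg \<Rightarrow> real) \<times> real \<Rightarrow> bool" where
  "poset_like \<Gamma> \<longleftrightarrow> fst \<Gamma> C1 = 0 \<and> fst \<Gamma> C2 = 0 \<and> fst \<Gamma> P2 = fst \<Gamma> T3"

lemma wf_dgs: "wf_dg C1" "wf_dg C2" "wf_dg C3" "wf_dg P2" "wf_dg T3"
  by (auto simp: wf_dg_def C1_def C2_def C3_def P2_def T3_def)

lemma not_poset_dgs: "\<not> is_poset C1" "\<not> is_poset C2" "\<not> is_poset C3" "\<not> is_poset P2"
proof -
  show "\<not> is_poset C1" by (simp add: is_poset_def C1_def)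
  show "\<not> is_poset C2" unfolding is_poset_def C2_def using transD[of "{(0, 1), (1, 0)}" 0 1 "0::nat"] by auto
  show "\<not> is_poset C3" unfolding is_poset_def C3_def using transD[of "{(0, 1), (1, 2), (2, 0)}" 0 1 "2::nat"] by auto
  show "\<not> is_poset P2" unfolding is_poset_def P2_def using transD[of "{(0, 1), (1, 2)}" 0 1 "2::nat"] by auto
qed

lemma poset_like_embed:
  assumes G: "is_poset G"
  shows "poset_like (embed G)"
proof -
  have irr: "(u, u) \<notin> snd G" for u using G by (auto simp: is_poset_def)
  have tr: "(u, z) \<in> snd G" if "(u, v) \<in> snd G" "(v, z) \<in> snd G" for u v z
    using G that by (auto simp: is_poset_def dest: transD)
  have "\<not> homs C1 G \<phi>" "\<not> homs C2 G \<phi>" "homs P2 G \<phi> \<longleftrightarrow> homs T3 G \<phi>" for \<phi>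
    unfolding homs_C1 homs_C2 homs_P2 homs_T3 using irr tr by blast+
  then have "hom_dens C1 G = 0" "hom_dens C2 G = 0" "hom_dens P2 G = hom_dens T3 G"
    unfolding hom_dens_avg fst_dgs by (simp_all add: avg_def)
  then show ?thesis by (simp add: poset_like_def embed_def wf_dgs)
qed

lemma continuous_on_coord: "continuous_on UNIV (\<lambda>x :: (dg \<Rightarrow> real) \<times> real. fst x F)"
  by (rule continuous_on_compose2[OF continuous_on_product_coordinates[of F] continuous_on_fst[OF continuous_on_id]]) auto

lemma Pinf_imp_poset_like:
  assumes "\<Gamma> \<in> Pinf"
  shows "poset_like \<Gamma>"
proof -
  have "closed {x :: (dg \<Rightarrow> real) \<times> real. fst x C1 = 0 \<and> fst x C2 = 0 \<and> fst x P2 = fst x T3}"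
    by (intro closed_Collect_conj closed_Collect_eq continuous_on_coord continuous_on_const)
  then have "closed {x. poset_like x}" by (simp add: poset_like_def)
  moreover have "Pset \<subseteq> {x. poset_like x}" using poset_like_embed by (auto simp: Pset_def)
  ultimately have "closure Pset \<subseteq> {x. poset_like x}" by (rule closure_minimal[rotated])
  then show ?thesis using assms by (auto simp: Pinf_def)
qed

text \<open>The representative that occurs in \<open>ind_dens_lim\<close>.\<close>

definition some_dg :: "(dg \<Rightarrow> real) \<times> real \<Rightarrow> dg" where
  "some_dg x = (SOME G. wf_dg G \<and> embed G = x)"

lemma some_dg:
  assumes "x \<in> Dset"
  shows "wf_dg (some_dg x)" "wf_dg F \<Longrightarrow> hom_dens F (some_dg x) = fst x F" "1 / real (fst (some_dg x)) = snd x"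
proof -
  have "\<exists>G. wf_dg G \<and> embed G = x" using assms by (auto simp: Dset_def)
  from someI_ex[OF this] have *: "wf_dg (some_dg x)" "embed (some_dg x) = x" by (auto simp: some_dg_def)
  show "wf_dg (some_dg x)" by (rule *(1))
  show "hom_dens F (some_dg x) = fst x F" if "wf_dg F"
    using that arg_cong[OF *(2), of "\<lambda>x. fst x F"] by (simp add: embed_def)
  show "1 / real (fst (some_dg x)) = snd x" using arg_cong[OF *(2), of snd] by (simp add: embed_def)
qed

section \<open>Convergence of densities near a digraph limit\<close>

context
  fixes \<Gamma> :: "(dg \<Rightarrow> real) \<times> real"
  assumes \<Gamma>: "\<Gamma> \<in> Dinf"
begin

abbreviation near :: "((dg \<Rightarrow> real) \<times> real) filter" where "near \<equiv> at \<Gamma> within Dset"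

lemma near_nontrivial: "near \<noteq> bot"
  using \<Gamma> unfolding trivial_limit_within Dinf_def by (auto simp: closure_def)

lemma near_Dset: "eventually (\<lambda>x. x \<in> Dset) near"
  by (simp add: eventually_at_filter)

lemma coord_tendsto: "((\<lambda>x. fst x F) \<longlongrightarrow> fst \<Gamma> F) near"
proof -
  have "((\<lambda>x. fst x F) \<longlongrightarrow> fst \<Gamma> F) (at \<Gamma> within UNIV)"
    using continuous_on_coord[of F] unfolding continuous_on_def by blast
  then show ?thesis by (rule tendsto_within_subset) simp
qed

lemma hom_dens_tendsto:
  assumes "wf_dg F"
  shows "((\<lambda>x. hom_dens F (some_dg x)) \<longlongrightarrow> fst \<Gamma> F) near"
  by (rule Lim_transform_eventually[OF coord_tendsto[of F]])
     (use near_Dset in eventually_elim, simp add: some_dg assms)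

text \<open>\<open>embed\<close> puts 0 at ill-formed indices, and this persists in the limit. Such
  coordinates impose no condition when \<Gamma> is approximated by posets.\<close>

lemma Dinf_not_wf: "\<not> wf_dg F \<Longrightarrow> fst \<Gamma> F = 0"
proof -
  assume "\<not> wf_dg F"
  then have "((\<lambda>x. fst x F) \<longlongrightarrow> 0) near"
    by (intro tendsto_eventually, use near_Dset in eventually_elim) (auto simp: Dset_def embed_def)
  then show ?thesis using tendsto_unique[OF near_nontrivial coord_tendsto] by blast
qed

text \<open>A positive value would confine the digraphs near \<Gamma> to bounded size. There are
  finitely many of these, and each is separated from \<Gamma>, which is not itself a finite
  digraph.\<close>

lemma snd_Dinf: "snd \<Gamma> = 0"
proof (rule ccontr)
  assume ne: "snd \<Gamma> \<noteq> 0"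
  have t: "(snd \<longlongrightarrow> snd \<Gamma>) near" by (rule tendsto_snd) simp
  have "eventually (\<lambda>x. 0 \<le> snd x) near"
    using near_Dset by eventually_elim (auto simp: Dset_def embed_def)
  then have "0 \<le> snd \<Gamma>" by (rule tendsto_lowerbound[OF t _ near_nontrivial])
  then have pos: "0 < snd \<Gamma>" using ne by simp
  \<comment> \<open>Near \<Gamma> the inverse size exceeds \<open>snd \<Gamma> / 2\<close>, hence
    this bound on the size.\<close>
  define S where "S = embed ` {G. wf_dg G \<and> real (fst G) < 2 / snd \<Gamma>}"
  have "finite {G. wf_dg G \<and> real (fst G) < 2 / snd \<Gamma>}"
  proof (rule finite_subset)
    let ?M = "nat \<lceil>2 / snd \<Gamma>\<rceil>"
    show "{G. wf_dg G \<and> real (fst G) < 2 / snd \<Gamma>} \<subseteq> {..?M} \<times> Pow ({..?M} \<times> {..?M})"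
    proof
      fix G assume G: "G \<in> {G. wf_dg G \<and> real (fst G) < 2 / snd \<Gamma>}"
      then have "real (fst G) \<le> 2 / snd \<Gamma>" by simp
      also have "\<dots> \<le> real ?M" by (rule real_nat_ceiling_ge)
      finally have "real (fst G) \<le> real ?M" .
      then have "fst G \<le> ?M" by simp
      moreover have "snd G \<subseteq> {0..<fst G} \<times> {0..<fst G}" using G by (simp add: wf_dg_def)
      ultimately show "G \<in> {..?M} \<times> Pow ({..?M} \<times> {..?M})"
        by (cases G) fastforce
    qed
  qed simp
  then have "finite S" by (simp add: S_def)
  have "S \<subseteq> Dset" by (auto simp: S_def Dset_def)
  then have "\<Gamma> \<notin> S" using \<Gamma> by (auto simp: Dinf_def)
  have "eventually (\<lambda>x. x \<noteq> y) near" if "y \<in> S" for y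
  proof (cases "snd y = snd \<Gamma>")
    case False
    then have "eventually (\<lambda>x. snd x \<noteq> snd y) near" by (intro tendsto_imp_eventually_ne[OF t]) simp
    then show ?thesis by (rule eventually_mono) auto
  next
    case True
    have "fst y \<noteq> fst \<Gamma>"
    proof
      assume "fst y = fst \<Gamma>"
      with True have "y = \<Gamma>" by (rule prod_eqI[rotated])
      with that \<open>\<Gamma> \<notin> S\<close> show False by simp
    qed
    then obtain F where "fst \<Gamma> F \<noteq> fst y F" by (metis ext)
    then have "eventually (\<lambda>x. fst x F \<noteq> fst y F) near"
      by (rule tendsto_imp_eventually_ne[OF coord_tendsto])
    then show ?thesis by (rule eventually_mono) auto
  qed
  then have "eventually (\<lambda>x. \<forall>y\<in>S. x \<noteq> y) near"
    using \<open>finite S\<close> by (intro eventually_ball_finite) auto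
  moreover have "eventually (\<lambda>x. snd \<Gamma> / 2 < snd x) near"
    using order_tendstoD(1)[OF t, of "snd \<Gamma> / 2"] pos by simp
  ultimately have "eventually (\<lambda>x. False) near"
    using near_Dset
  proof eventually_elim
    case (elim x)
    then obtain G where G: "wf_dg G" "x = embed G" by (auto simp: Dset_def)
    then have "0 < real (fst G)" by (simp add: wf_dg_def)
    moreover have "snd \<Gamma> / 2 < 1 / real (fst G)" using elim G by (simp add: embed_def)
    ultimately have "real (fst G) < 2 / snd \<Gamma>" using pos by (simp add: field_simps)
    then have "x \<in> S" unfolding S_def G(2) by (intro imageI) (simp add: G(1))
    then show False using elim(1) by blast
  qed
  then show False using near_nontrivial by simp
qed

lemma inverse_size_tendsto: "((\<lambda>x. c / real (fst (some_dg x))) \<longlongrightarrow> 0) near"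
proof -
  have "(snd \<longlongrightarrow> snd \<Gamma>) near" by (rule tendsto_snd) simp
  then have "((\<lambda>x. c * snd x) \<longlongrightarrow> 0) near" by (auto simp: snd_Dinf intro: tendsto_mult_right_zero)
  then show ?thesis
    by (rule Lim_transform_eventually)
       (use near_Dset in eventually_elim, simp add: some_dg(3)[symmetric])
qed

lemma ind_dens_tendsto_iff:
  "((\<lambda>x. ind_dens F (some_dg x)) \<longlongrightarrow> l) near \<longleftrightarrow> ((\<lambda>x. ind_prob (some_dg x) F) \<longlongrightarrow> l) near"
proof -
  have "((\<lambda>x. ind_dens F (some_dg x) - ind_prob (some_dg x) F) \<longlongrightarrow> 0) near"
  proof (rule Lim_null_comparison)
    show "eventually (\<lambda>x. norm (ind_dens F (some_dg x) - ind_prob (some_dg x) F)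
        \<le> (real (fst F))\<^sup>2 / real (fst (some_dg x))) near"
      using near_Dset by eventually_elim (simp add: ind_dens_approx some_dg)
  qed (rule inverse_size_tendsto)
  note d = this
  show ?thesis
  proof
    assume "((\<lambda>x. ind_dens F (some_dg x)) \<longlongrightarrow> l) near"
    from tendsto_diff[OF this d] show "((\<lambda>x. ind_prob (some_dg x) F) \<longlongrightarrow> l) near" by simp
  next
    assume "((\<lambda>x. ind_prob (some_dg x) F) \<longlongrightarrow> l) near"
    from tendsto_add[OF this d] show "((\<lambda>x. ind_dens F (some_dg x)) \<longlongrightarrow> l) near" by simp
  qed
qed

text \<open>\<open>Lim\<close> is meaningful only for a convergent function, so every evaluation of
  \<open>ind_dens_lim\<close> has to supply convergence; it may be shown for
  \<open>ind_prob\<close>, as the sizes tend to infinity.\<close>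

lemma ind_dens_lim_eqI:
  assumes "((\<lambda>x. ind_prob (some_dg x) F) \<longlongrightarrow> l) near"
  shows "ind_dens_lim F \<Gamma> = l"
  using tendsto_Lim[OF near_nontrivial assms[folded ind_dens_tendsto_iff]]
  by (simp add: ind_dens_lim_def some_dg_def)

lemma poset_like_imp_ind_dens_lim:
  assumes K: "poset_like \<Gamma>" and F: "wf_dg F" "\<not> is_poset F"
  shows "ind_dens_lim F \<Gamma> = 0"
proof (rule ind_dens_lim_eqI, rule tendsto_sandwich[where f = "\<lambda>_. 0"])
  show "((\<lambda>x. hom_dens C1 (some_dg x) + hom_dens C2 (some_dg x)
      + (hom_dens P2 (some_dg x) - hom_dens T3 (some_dg x))) \<longlongrightarrow> 0) near"
    using tendsto_add[OF tendsto_add[OF hom_dens_tendsto[OF wf_dgs(1)] hom_dens_tendsto[OF wf_dgs(2)]]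
        tendsto_diff[OF hom_dens_tendsto[OF wf_dgs(4)] hom_dens_tendsto[OF wf_dgs(5)]]] K
    by (simp add: poset_like_def)
  show "eventually (\<lambda>x. ind_prob (some_dg x) F \<le> hom_dens C1 (some_dg x) + hom_dens C2 (some_dg x)
      + (hom_dens P2 (some_dg x) - hom_dens T3 (some_dg x))) near"
    using near_Dset by eventually_elim (rule ind_prob_not_poset[OF some_dg(1) F])
  show "eventually (\<lambda>x. 0 \<le> ind_prob (some_dg x) F) near"
    using near_Dset by eventually_elim (auto simp: ind_prob_def some_dg intro: avg_nonneg)
qed (rule tendsto_const)

text \<open>The order \<open>C1\<close>, \<open>C2\<close>, \<open>C3\<close>, \<open>P2\<close>
  matters: the error terms of each stage are multiples of densities already known to vanish in the
  limit. A zero of \<open>ind_dens_lim\<close> becomes usable only after convergence is established,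
  hence the sandwich in each stage from \<open>C2\<close> on.\<close>

lemma ind_dens_lim_imp_poset_like:
  assumes C1: "ind_dens_lim C1 \<Gamma> = 0" and C2: "ind_dens_lim C2 \<Gamma> = 0"
    and C3: "ind_dens_lim C3 \<Gamma> = 0" and P2: "ind_dens_lim P2 \<Gamma> = 0"
  shows "poset_like \<Gamma>"
proof -
  note h = hom_dens_tendsto[OF wf_dgs(1)] hom_dens_tendsto[OF wf_dgs(2)] hom_dens_tendsto[OF wf_dgs(3)]
    hom_dens_tendsto[OF wf_dgs(4)] hom_dens_tendsto[OF wf_dgs(5)]
  have "((\<lambda>x. ind_prob (some_dg x) C1) \<longlongrightarrow> fst \<Gamma> C1) near"
    by (rule Lim_transform_eventually[OF h(1)])
       (use near_Dset in eventually_elim, simp add: ind_prob_C1 some_dg)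
  from ind_dens_lim_eqI[OF this] have z1: "fst \<Gamma> C1 = 0" using C1 by simp
  have "((\<lambda>x. ind_prob (some_dg x) C2) \<longlongrightarrow> fst \<Gamma> C2) near"
  proof (rule tendsto_sandwich[OF _ _ _ h(2)])
    show "((\<lambda>x. hom_dens C2 (some_dg x) - 2 * hom_dens C1 (some_dg x)) \<longlongrightarrow> fst \<Gamma> C2) near"
      using tendsto_diff[OF h(2) tendsto_mult_left[OF h(1), of 2]] z1 by simp
    show "eventually (\<lambda>x. hom_dens C2 (some_dg x) - 2 * hom_dens C1 (some_dg x) \<le> ind_prob (some_dg x) C2) near"
      using near_Dset by eventually_elim (use ind_prob_C2(2)[OF some_dg(1)] in \<open>simp add: algebra_simps\<close>)
    show "eventually (\<lambda>x. ind_prob (some_dg x) C2 \<le> hom_dens C2 (some_dg x)) near"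
      using near_Dset by eventually_elim (rule ind_prob_C2(1)[OF some_dg(1)])
  qed
  from ind_dens_lim_eqI[OF this] have z2: "fst \<Gamma> C2 = 0" using C2 by simp
  have "((\<lambda>x. ind_prob (some_dg x) C3) \<longlongrightarrow> fst \<Gamma> C3) near"
  proof (rule tendsto_sandwich[OF _ _ _ h(3)])
    show "((\<lambda>x. hom_dens C3 (some_dg x) - 3 * hom_dens C1 (some_dg x) - 3 * hom_dens C2 (some_dg x)) \<longlongrightarrow> fst \<Gamma> C3) near"
      using tendsto_diff[OF tendsto_diff[OF h(3) tendsto_mult_left[OF h(1), of 3]] tendsto_mult_left[OF h(2), of 3]] z1 z2
      by simp
    show "eventually (\<lambda>x. hom_dens C3 (some_dg x) - 3 * hom_dens C1 (some_dg x) - 3 * hom_dens C2 (some_dg x)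
        \<le> ind_prob (some_dg x) C3) near"
      using near_Dset by eventually_elim (use ind_prob_C3(2)[OF some_dg(1)] in \<open>simp add: algebra_simps\<close>)
    show "eventually (\<lambda>x. ind_prob (some_dg x) C3 \<le> hom_dens C3 (some_dg x)) near"
      using near_Dset by eventually_elim (rule ind_prob_C3(1)[OF some_dg(1)])
  qed
  from ind_dens_lim_eqI[OF this] have z3: "fst \<Gamma> C3 = 0" using C3 by simp
  have "((\<lambda>x. ind_prob (some_dg x) P2) \<longlongrightarrow> fst \<Gamma> P2 - fst \<Gamma> T3) near"
  proof (rule tendsto_sandwich[OF _ _ _ tendsto_diff[OF h(4) h(5)]])
    show "((\<lambda>x. hom_dens P2 (some_dg x) - hom_dens T3 (some_dg x) - 3 * hom_dens C1 (some_dg x)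
        - 2 * hom_dens C2 (some_dg x) - hom_dens C3 (some_dg x)) \<longlongrightarrow> fst \<Gamma> P2 - fst \<Gamma> T3) near"
      using tendsto_diff[OF tendsto_diff[OF tendsto_diff[OF tendsto_diff[OF h(4) h(5)]
          tendsto_mult_left[OF h(1), of 3]] tendsto_mult_left[OF h(2), of 2]] h(3)] z1 z2 z3
      by simp
    show "eventually (\<lambda>x. hom_dens P2 (some_dg x) - hom_dens T3 (some_dg x) - 3 * hom_dens C1 (some_dg x)
        - 2 * hom_dens C2 (some_dg x) - hom_dens C3 (some_dg x) \<le> ind_prob (some_dg x) P2) near"
      using near_Dset by eventually_elim (use ind_prob_P2(2)[OF some_dg(1)] in \<open>simp add: algebra_simps\<close>)
    show "eventually (\<lambda>x. ind_prob (some_dg x) P2 \<le> hom_dens P2 (some_dg x) - hom_dens T3 (some_dg x)) near"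
      using near_Dset by eventually_elim (rule ind_prob_P2(1)[OF some_dg(1)])
  qed
  from ind_dens_lim_eqI[OF this] have "fst \<Gamma> P2 = fst \<Gamma> T3" using P2 by simp
  with z1 z2 show ?thesis by (simp add: poset_like_def)
qed

text \<open>The sample size \<open>k\<close> is fixed first, from the required accuracy; only then
  is \<open>G\<close> taken so close to \<Gamma> that the bound with factors \<open>k\<close>,
  \<open>k^2\<close>, \<open>k^3\<close> falls below 1/2. The failure indicator plus the scaled
  squared error then has mean below 1, so a single map is good for both.\<close>

lemma poset_approx:
  assumes K: "poset_like \<Gamma>" and I: "finite I" "\<And>F. F \<in> I \<Longrightarrow> wf_dg F" and e: "e > 0"
  obtains H where "is_poset H" "1 / real (fst H) < e" "\<And>F. F \<in> I \<Longrightarrow> \<bar>hom_dens F H - fst \<Gamma> F\<bar> < e"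
proof -
  \<comment> \<open>\<open>4 / e^2\<close> is the inverse square of \<open>e / 2\<close>, the error
    allowed for the sample; the other \<open>e / 2\<close> is left for the distance between
    \<open>G\<close> and \<Gamma>.\<close>
  define B where "B = (\<Sum>F\<in>I. 3 * (real (fst F))\<^sup>2) * (4 / e\<^sup>2)"
  have B: "0 \<le> B" unfolding B_def by (intro mult_nonneg_nonneg sum_nonneg) auto
  \<comment> \<open>\<open>1 / e\<close> controls the size coordinate, and \<open>2 * B\<close>
    makes the mean scaled error at most 1/2.\<close>
  obtain k0 :: nat where k0: "real k0 > max (1 / e) (2 * B)" using reals_Archimedean2 by blast
  define k where "k = max 1 k0"
  have k: "k \<ge> 1" "real k > 1 / e" "real k > 2 * B" using k0 by (auto simp: k_def)
  have ke: "1 / real k < e" using k e by (simp add: field_simps)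
  have "((\<lambda>x. real k * hom_dens C1 (some_dg x) + (real k)^2 * hom_dens C2 (some_dg x)
      + (real k)^3 * (hom_dens P2 (some_dg x) - hom_dens T3 (some_dg x))) \<longlongrightarrow>
      real k * fst \<Gamma> C1 + (real k)^2 * fst \<Gamma> C2 + (real k)^3 * (fst \<Gamma> P2 - fst \<Gamma> T3)) near"
    by (intro tendsto_add tendsto_mult tendsto_diff tendsto_const hom_dens_tendsto wf_dgs)
  then have "eventually (\<lambda>x. real k * hom_dens C1 (some_dg x) + (real k)^2 * hom_dens C2 (some_dg x)
      + (real k)^3 * (hom_dens P2 (some_dg x) - hom_dens T3 (some_dg x)) < 1 / 2) near"
    by (rule order_tendstoD) (use K in \<open>simp add: poset_like_def\<close>)
  moreover have "eventually (\<lambda>x. \<forall>F\<in>I. dist (hom_dens F (some_dg x)) (fst \<Gamma> F) < e / 2) near"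
    using I e by (intro eventually_ball_finite ballI tendstoD[OF hom_dens_tendsto]) auto
  ultimately have "eventually (\<lambda>x. x \<in> Dset \<and> real k * hom_dens C1 (some_dg x) + (real k)^2 * hom_dens C2 (some_dg x)
      + (real k)^3 * (hom_dens P2 (some_dg x) - hom_dens T3 (some_dg x)) < 1 / 2
      \<and> (\<forall>F\<in>I. dist (hom_dens F (some_dg x)) (fst \<Gamma> F) < e / 2)) near"
    using near_Dset by eventually_elim auto
  from eventually_happens'[OF near_nontrivial this] obtain x where x: "x \<in> Dset"
    "real k * hom_dens C1 (some_dg x) + (real k)^2 * hom_dens C2 (some_dg x)
      + (real k)^3 * (hom_dens P2 (some_dg x) - hom_dens T3 (some_dg x)) < 1 / 2"
    "\<And>F. F \<in> I \<Longrightarrow> dist (hom_dens F (some_dg x)) (fst \<Gamma> F) < e / 2" by blast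
  define G where "G = some_dg x"
  have G: "wf_dg G" using some_dg(1)[OF x(1)] by (simp add: G_def)
  let ?av = "avg {0..<k} {0..<fst G}"
  let ?D = "\<lambda>\<phi>. \<Sum>F\<in>I. (hom_dens F (pull G k \<phi>) - hom_dens F G)\<^sup>2"
  have "?av (\<lambda>\<phi>. of_bool (\<not> is_poset (pull G k \<phi>)) + ?D \<phi> * (4 / e\<^sup>2)) < 1"
  proof -
    have "?av (\<lambda>\<phi>. of_bool (\<not> is_poset (pull G k \<phi>))) < 1 / 2"
      using avg_pull_not_poset[OF G k(1)] x(2) by (simp add: G_def)
    moreover have "?av ?D * (4 / e\<^sup>2) \<le> 1 / 2"
    proof -
      have "?av ?D \<le> (\<Sum>F\<in>I. 3 * (real (fst F))\<^sup>2 / real k)"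
        unfolding avg_sum by (intro sum_mono avg_hom_dens_pull G I k)
      also have "\<dots> = (\<Sum>F\<in>I. 3 * (real (fst F))\<^sup>2) / real k" by (simp add: sum_divide_distrib)
      finally have "?av ?D * (4 / e\<^sup>2) \<le> (\<Sum>F\<in>I. 3 * (real (fst F))\<^sup>2) / real k * (4 / e\<^sup>2)"
        using e by (intro mult_right_mono) auto
      also have "\<dots> = B / real k" by (simp add: B_def)
      also have "\<dots> \<le> 1 / 2" using k by (simp add: field_simps)
      finally show ?thesis .
    qed
    ultimately show ?thesis unfolding avg_add avg_multc by linarith
  qed
  from avg_less_imp_ex[OF this _ verts[OF G]] obtain \<phi>
    where \<phi>: "of_bool (\<not> is_poset (pull G k \<phi>)) + ?D \<phi> * (4 / e\<^sup>2) < 1" by auto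
  have D0: "0 \<le> ?D \<phi> * (4 / e\<^sup>2)" by (intro mult_nonneg_nonneg sum_nonneg) auto
  have pos: "is_poset (pull G k \<phi>)"
  proof (rule ccontr)
    assume "\<not> is_poset (pull G k \<phi>)"
    then have "of_bool (\<not> is_poset (pull G k \<phi>)) = (1::real)" by simp
    then show False using \<phi> D0 by linarith
  qed
  then have D1: "?D \<phi> < (e / 2)\<^sup>2" using \<phi> e by (simp add: field_simps power2_eq_square)
  show thesis
  proof (rule that[OF pos])
    show "1 / real (fst (pull G k \<phi>)) < e" using ke by (simp add: pull_def[OF G])
    fix F assume F: "F \<in> I"
    have "(hom_dens F (pull G k \<phi>) - hom_dens F G)\<^sup>2 \<le> ?D \<phi>"
      using I(1) F by (intro member_le_sum[of F I "\<lambda>F. (hom_dens F (pull G k \<phi>) - hom_dens F G)\<^sup>2"]) auto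
    then have "\<bar>hom_dens F (pull G k \<phi>) - hom_dens F G\<bar>\<^sup>2 < (e / 2)\<^sup>2" using D1 by simp
    then have "\<bar>hom_dens F (pull G k \<phi>) - hom_dens F G\<bar> < e / 2"
      by (rule power2_less_imp_less) (use e in simp)
    moreover have "\<bar>hom_dens F G - fst \<Gamma> F\<bar> < e / 2" using x(3)[OF F] by (simp add: dist_real_def G_def)
    ultimately show "\<bar>hom_dens F (pull G k \<phi>) - fst \<Gamma> F\<bar> < e" by linarith
  qed
qed

text \<open>A basic neighbourhood restricts finitely many densities and the size coordinate, whose
  limit value is 0, so \<open>poset_approx\<close> reaches it.\<close>

lemma poset_like_imp_Pinf:
  assumes K: "poset_like \<Gamma>"
  shows "\<Gamma> \<in> Pinf"
proof -
  have "\<Gamma> \<in> closure Pset"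
    unfolding closure_iff_nhds_not_empty
  proof (intro allI impI)
    fix S U :: "((dg \<Rightarrow> real) \<times> real) set" assume S: "S \<subseteq> U" "open S" "\<Gamma> \<in> S"
    obtain A B where AB: "open A" "open B" "\<Gamma> \<in> A \<times> B" "A \<times> B \<subseteq> S"
      using open_prod_elim[OF S(2,3)] .
    then have "openin (product_topology (\<lambda>_. euclidean) UNIV) A" "fst \<Gamma> \<in> A"
      by (auto simp: open_fun_def)
    from product_topology_open_contains_basis[OF this] obtain X where X: "fst \<Gamma> \<in> Pi\<^sub>E UNIV X"
      "\<And>F. open (X F)" "finite {F. X F \<noteq> UNIV}" "Pi\<^sub>E UNIV X \<subseteq> A" by auto
    let ?I = "{F. X F \<noteq> UNIV}"
    have "\<exists>e. e > 0 \<and> ball (fst \<Gamma> F) e \<subseteq> X F" for F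
      using X(1,2) open_contains_ball by (metis PiE_E UNIV_I)
    then obtain r where r: "\<And>F. r F > 0" "\<And>F. ball (fst \<Gamma> F) (r F) \<subseteq> X F" by metis
    obtain s where s: "s > 0" "ball 0 s \<subseteq> B" using AB snd_Dinf open_contains_ball
      by (metis mem_Times_iff)
    \<comment> \<open>Including \<open>s\<close> keeps the finite set nonempty and lets the same
      \<open>e\<close> serve the size coordinate.\<close>
    define e where "e = Min (insert s (r ` ?I))"
    have e: "e > 0" using X(3) r(1) s(1) by (simp add: e_def)
    have es: "e \<le> s" "\<And>F. F \<in> ?I \<Longrightarrow> e \<le> r F" unfolding e_def using X(3) by (auto intro: Min_le)
    obtain H where H: "is_poset H" "1 / real (fst H) < e"
        "\<And>F. F \<in> {F\<in>?I. wf_dg F} \<Longrightarrow> \<bar>hom_dens F H - fst \<Gamma> F\<bar> < e"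
      by (rule poset_approx[OF K, of "{F\<in>?I. wf_dg F}" e]) (use X(3) e in auto)
    have "fst (embed H) F \<in> X F" for F
    proof (cases "F \<in> ?I")
      case True
      \<comment> \<open>At ill-formed indices both values are 0, so only well-formed ones were
        passed to \<open>poset_approx\<close>.\<close>
      have "\<bar>fst (embed H) F - fst \<Gamma> F\<bar> < e"
        using H(3)[of F] True e Dinf_not_wf[of F] by (auto simp: embed_def)
      then have "fst (embed H) F \<in> ball (fst \<Gamma> F) (r F)"
        using es(2)[OF True] by (simp add: dist_real_def abs_minus_commute)
      then show ?thesis using r(2) by blast
    qed simp
    then have "fst (embed H) \<in> A" using X(4) by auto
    moreover have "snd (embed H) \<in> B" using s(2) H(2) es(1) by (auto simp: embed_def subset_iff)
    ultimately have "embed H \<in> A \<times> B" by (simp add: mem_Times_iff)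
    then have "embed H \<in> S" using AB(4) by (rule subsetD[rotated])
    moreover have "embed H \<in> Pset" using H(1) by (auto simp: Pset_def)
    ultimately show "Pset \<inter> U \<noteq> {}" using S(1) by blast
  qed
  \<comment> \<open>This keeps \<Gamma> out of \<open>Pset\<close>, as a limit lies outside
    \<open>Dset\<close>.\<close>
  moreover have "Pset \<subseteq> Dset" by (auto simp: Pset_def Dset_def is_poset_def)
  ultimately show ?thesis using \<Gamma> by (auto simp: Pinf_def Dinf_def)
qed

end

section \<open>Equivalence of the five conditions\<close>

lemma null_triple_iff:
  "{(x, y, z). x \<in> {0..1} \<and> y \<in> {0..1} \<and> z \<in> {0..1} \<and> P x y z} \<in> null_sets (lebesgue :: (real \<times> real \<times> real) measure)
   \<longleftrightarrow> (AE t in lborel. case t of (x, y, z) \<Rightarrow> x \<in> {0..1} \<and> y \<in> {0..1} \<and> z \<in> {0..1} \<longrightarrow> \<not> P x y z)"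
proof -
  have "?thesis \<longleftrightarrow> ((AE t in lborel. t \<notin> {(x, y, z). x \<in> {0..1} \<and> y \<in> {0..1} \<and> z \<in> {0..1} \<and> P x y z}) \<longleftrightarrow>
    (AE t in lborel. case t of (x, y, z) \<Rightarrow> x \<in> {0..1} \<and> y \<in> {0..1} \<and> z \<in> {0..1} \<longrightarrow> \<not> P x y z))"
    unfolding completion.null_sets_iff_AE AE_completion_iff by simp
  also have "\<dots>" by (intro iffI; elim eventually_mono) (auto split: prod.splits)
  finally show ?thesis by simp
qed

theorem theorem10p1:
  fixes \<Gamma> :: "(dg \<Rightarrow> real) \<times> real"
    and W00 W01 W10 W11 :: "real \<times> real \<Rightarrow> real" and w :: "real \<Rightarrow> real"
  assumes "\<Gamma> \<in> Dinf"
    and "represents W00 W01 W10 W11 w \<Gamma>"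
  defines "i \<equiv> \<Gamma> \<in> Pinf"
    and "ii \<equiv> (\<forall>F. wf_dg F \<and> \<not> is_poset F \<longrightarrow> ind_dens_lim F \<Gamma> = 0)"
    and "iii \<equiv> ind_dens_lim C1 \<Gamma> = 0 \<and> ind_dens_lim C2 \<Gamma> = 0 \<and>
               ind_dens_lim C3 \<Gamma> = 0 \<and> ind_dens_lim P2 \<Gamma> = 0"
    and "iv \<equiv> (AE x in lebesgue_on {0..1}. w x = 0) \<and>
              (AE p in lebesgue_on unit_sq. W11 p = 0) \<and>
              {(x, y, z).
                 x \<in> {0..1} \<and> y \<in> {0..1} \<and> z \<in> {0..1} \<and>
                 W10 (x, y) > 0 \<and> W10 (y, z) > 0 \<and> W10 (x, z) < 1} \<in> null_sets (lebesgue :: (real \<times> real \<times> real) measure)"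
    and "v \<equiv> (\<exists>V00 V01 V10 V11 v. represents V00 V01 V10 V11 v \<Gamma> \<and>
              (\<forall>x\<in>{0..1}. v x = 0) \<and>
              (\<forall>x\<in>{0..1}. \<forall>y\<in>{0..1}. V11 (x, y) = 0) \<and>
              (\<forall>x\<in>{0..1}. V10 (x, x) = 0) \<and>
              (\<forall>x\<in>{0..1}. \<forall>y\<in>{0..1}. \<forall>z\<in>{0..1}.
                 V10 (x, y) > 0 \<and> V10 (y, z) > 0 \<longrightarrow> V10 (x, z) = 1))"
  shows "(i \<longleftrightarrow> ii) \<and> (ii \<longleftrightarrow> iii) \<and> (iii \<longleftrightarrow> iv) \<and> (iv \<longleftrightarrow> v)"
proof -
  have W: "quintuple W00 W01 W10 W11 w"
    and rep: "\<And>F. wf_dg F \<Longrightarrow> fst \<Gamma> F = sub_prob W01 W10 W11 w F"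
    using assms(2) by (auto simp: represents_def)
  \<comment> \<open>Stated for an arbitrary representing quintuple, as it is applied to the given
    one for (iv) and to the strict one for the way back from (v).\<close>
  have kernel: "poset_like \<Gamma> \<longleftrightarrow>
     (AE x in lborel. x \<in> {0..1} \<longrightarrow> U x = 0) \<and> (AE p in lborel. p \<in> unit_sq \<longrightarrow> U11 p = 0) \<and>
     (AE t in lborel. case t of (x, y, z) \<Rightarrow> x \<in> {0..1} \<and> y \<in> {0..1} \<and> z \<in> {0..1} \<longrightarrow>
         \<not> (U10 (x, y) > 0 \<and> U10 (y, z) > 0 \<and> U10 (x, z) < 1))"
    if "represents U00 U01 U10 U11 U \<Gamma>" for U00 U01 U10 U11 U
  proof -
    have U: "quintuple U00 U01 U10 U11 U"
      and eq: "\<And>F. wf_dg F \<Longrightarrow> fst \<Gamma> F = sub_prob U01 U10 U11 U F"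
      using that unfolding represents_def by blast+
    show ?thesis
      unfolding poset_like_def eq[OF wf_dgs(1)] eq[OF wf_dgs(2)] eq[OF wf_dgs(4)] eq[OF wf_dgs(5)]
      by (rule poset_kernel_iff[OF U])
  qed
  have iv: "iv \<longleftrightarrow> poset_like \<Gamma>"
    unfolding iv_def kernel[OF assms(2)] null_triple_iff
    by (simp only: AE_lebesgue_on_iff unit_sq_borel borel_closed closed_atLeastAtMost)
  have "poset_like \<Gamma>" if i using that Pinf_imp_poset_like by (simp add: i_def)
  moreover have i if "poset_like \<Gamma>" unfolding i_def by (rule poset_like_imp_Pinf[OF assms(1) that])
  moreover have ii if "poset_like \<Gamma>"
    unfolding ii_def using poset_like_imp_ind_dens_lim[OF assms(1) that] by blast
  moreover have iii if ii
    using that wf_dgs not_poset_dgs unfolding ii_def iii_def by blast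
  moreover have "poset_like \<Gamma>" if iii
    using that ind_dens_lim_imp_poset_like[OF assms(1)] unfolding iii_def by blast
  moreover have v if "poset_like \<Gamma>"
  proof -
    have k1: "AE x in lborel. x \<in> {0..1} \<longrightarrow> w x = 0"
      and k2: "AE p in lborel. p \<in> unit_sq \<longrightarrow> W11 p = 0"
      and k3: "AE t in lborel. case t of (x, y, z) \<Rightarrow> x \<in> {0..1} \<and> y \<in> {0..1} \<and> z \<in> {0..1} \<longrightarrow>
         \<not> (W10 (x, y) > 0 \<and> W10 (y, z) > 0 \<and> W10 (x, z) < 1)"
      using that unfolding kernel[OF assms(2)] by blast+
    obtain V00 V01 V10 V11 v' where V: "quintuple V00 V01 V10 V11 v'"
      "\<And>F. sub_prob V01 V10 V11 v' F = sub_prob W01 W10 W11 w F"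
      "\<And>x. v' x = 0" "\<And>p. V11 p = 0" "\<And>x. V10 (x, x) = 0"
      "\<And>x y z. x \<in> {0..1} \<Longrightarrow> y \<in> {0..1} \<Longrightarrow> z \<in> {0..1} \<Longrightarrow> V10 (x, y) > 0 \<Longrightarrow> V10 (y, z) > 0 \<Longrightarrow> V10 (x, z) = 1"
      by (rule strict_representation[OF W k1 k2 k3]) (rule that)
    have "represents V00 V01 V10 V11 v' \<Gamma>" using V(1,2) rep by (simp add: represents_def)
    with V(3-6) show ?thesis unfolding v_def by blast
  qed
  moreover have "poset_like \<Gamma>" if strict: v
  proof -
    obtain V00 V01 V10 V11 v' where V: "represents V00 V01 V10 V11 v' \<Gamma>"
      "\<forall>x\<in>{0..1}. v' x = 0" "\<forall>x\<in>{0..1}. \<forall>y\<in>{0..1}. V11 (x, y) = 0"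
      "\<forall>x\<in>{0..1}. \<forall>y\<in>{0..1}. \<forall>z\<in>{0..1}. V10 (x, y) > 0 \<and> V10 (y, z) > 0 \<longrightarrow> V10 (x, z) = 1"
      using strict unfolding v_def by blast
    \<comment> \<open>The pointwise conditions imply the almost everywhere ones, and these determine
      a property of \<Gamma> alone.\<close>
    show ?thesis unfolding kernel[OF V(1)]
    proof (intro conjI AE_I2)
      show "x \<in> {0..1} \<longrightarrow> v' x = 0" for x using V(2) by blast
      show "p \<in> unit_sq \<longrightarrow> V11 p = 0" for p using V(3) by (cases p) (simp add: unit_sq_iff)
      show "case t of (x, y, z) \<Rightarrow> x \<in> {0..1} \<and> y \<in> {0..1} \<and> z \<in> {0..1} \<longrightarrow>
         \<not> (V10 (x, y) > 0 \<and> V10 (y, z) > 0 \<and> V10 (x, z) < 1)" for t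
        using V(4) by (cases t) fastforce
    qed
  qed
  ultimately show ?thesis using iv by blast
qed

end
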